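(* Let $D$ be a simply connected hyperbolic domain and $\{g_t\}_{t\ge0}$ a normalized slit Löwner chain in $D$ driven by $b,\sigma,u_t$. Let $(\tilde b,\tilde\sigma)$ be any other pair of normalized fields, $\tilde b=2\ell_{-2}+\tilde b_{-1}\ell_{-1}+\tilde b_0\ell_0+\tilde b_1\ell_1$, $\tilde\sigma=\ell_{-1}+\tilde\sigma_0\ell_0+\tilde\sigma_1\ell_1$ (real coefficients). Then for some $T_{\max}>0$ there exist a unique $C^1$ time reparameterization $\lambda:[0,T_{\max})\to[0,\tilde T_{\max})$ (with $\lambda(0)=0$) and a unique continuous driving function $\tilde u:[0,\tilde T_{\max})\to\mathbb{R}$ (with $\tilde u_0=0$) such that the slit Löwner chain $\{\tilde g_{\tilde t}\}_{\tilde t\in[0,\tilde T_{\max})}$ driven by $\tilde b,\tilde\sigma,\tilde u$ satisfies $$\tilde g_{\lambda(t)}^{-1}(D)=g_t^{-1}(D)\qquad\text{for all }t\in[0,T_{\max}).$$ Moreover $\dot\lambda(t)>0$ for all $t\in[0,T_{\max})$.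
   Context: Pushforward: $(\phi_*V)(z)=\phi'(\phi^{-1}(z))V(\phi^{-1}(z))$. With $\ell_n^{\mathbb{H}}(z)=-z^{n+1}$ on the upper half-plane and a fixed conformal $\phi:\mathbb{H}\to D$, $\ell_n:=\phi_*\ell_n^{\mathbb{H}}$ (in $\mathbb{D}$: $\ell_n(z)=-2^{n-1}(-i)^n(z-1)^{n+1}(z+1)^{1-n}$). A normalized slit Löwner chain in $D$ driven by $b,\sigma,u$: $b=2\ell_{-2}+b_{-1}\ell_{-1}+b_0\ell_0+b_1\ell_1$, $\sigma=\ell_{-1}+\sigma_0\ell_0+\sigma_1\ell_1$, real coefficients; $\{h_t\}_{t\in\mathbb{R}}$ the flow of automorphisms of $D$ generated by $\sigma$; $u$ continuous real with $u_0=0$; $g_t$ solves $\partial_tg_t(z)=-\frac{1}{h'_{u_t}(g_t(z))}b(h_{u_t}(g_t(z)))$, $g_0(z)=z$; $g_t$ maps the set $D_t$ of points whose solution survives to time $t$ conformally onto $D$, so $g_t^{-1}(D)=D_t$. *)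

theory Defs
  imports "HOL-Analysis.Analysis"
begin

definition UHP :: "complex set" where
  "UHP = {z. Im z > 0}"

definition pushforward ::
  "(complex \<Rightarrow> complex) \<Rightarrow> complex set \<Rightarrow> (complex \<Rightarrow> complex) \<Rightarrow> complex \<Rightarrow> complex" where
  "pushforward \<phi> A V z = deriv \<phi> (inv_into A \<phi> z) * V (inv_into A \<phi> z)"

definition ellH :: "int \<Rightarrow> complex \<Rightarrow> complex" where
  "ellH n z = - (z powi (n + 1))"

definition ell :: "(complex \<Rightarrow> complex) \<Rightarrow> int \<Rightarrow> complex \<Rightarrow> complex" where
  "ell \<phi> n = pushforward \<phi> UHP (ellH n)"

definition b_field :: "(complex \<Rightarrow> complex) \<Rightarrow> real \<Rightarrow> real \<Rightarrow> real \<Rightarrow> complex \<Rightarrow> complex" where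
  "b_field \<phi> bm1 b0 b1 z =
     2 * ell \<phi> (-2) z + of_real bm1 * ell \<phi> (-1) z + of_real b0 * ell \<phi> 0 z + of_real b1 * ell \<phi> 1 z"

definition sigma_field :: "(complex \<Rightarrow> complex) \<Rightarrow> real \<Rightarrow> real \<Rightarrow> complex \<Rightarrow> complex" where
  "sigma_field \<phi> s0 s1 z = ell \<phi> (-1) z + of_real s0 * ell \<phi> 0 z + of_real s1 * ell \<phi> 1 z"

definition is_flow :: "complex set \<Rightarrow> (complex \<Rightarrow> complex) \<Rightarrow> (real \<Rightarrow> complex \<Rightarrow> complex) \<Rightarrow> bool" where
  "is_flow D V h \<longleftrightarrow>
     (\<forall>z\<in>D. h 0 z = z \<and> (\<forall>t. h t z \<in> D \<and> ((\<lambda>s. h s z) has_vector_derivative V (h t z)) (at t)))"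

definition loewner_vf ::
  "(complex \<Rightarrow> complex) \<Rightarrow> (real \<Rightarrow> complex \<Rightarrow> complex) \<Rightarrow> (real \<Rightarrow> real) \<Rightarrow> real \<Rightarrow> complex \<Rightarrow> complex" where
  "loewner_vf b h u s w = - b (h (u s) w) / deriv (h (u s)) w"

text \<open>D_t: the points z of D whose solution of d/ds g_s(z) = F(s, g_s(z)), g_0(z) = z,
  exists (staying in D) up to time t.  By the context, D_t = g_t^{-1}(D).\<close>
definition chain_domain ::
  "complex set \<Rightarrow> (real \<Rightarrow> complex \<Rightarrow> complex) \<Rightarrow> real \<Rightarrow> complex set" where
  "chain_domain D F t = {z \<in> D. 0 \<le> t \<and> (\<exists>\<gamma>. \<gamma> 0 = z \<and>
       (\<forall>s\<in>{0..t}. \<gamma> s \<in> D \<and> (\<gamma> has_vector_derivative F s (\<gamma> s)) (at s within {0..t})))}"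

definition loewner_preimage ::
  "complex set \<Rightarrow> (complex \<Rightarrow> complex) \<Rightarrow> (real \<Rightarrow> complex \<Rightarrow> complex) \<Rightarrow> (real \<Rightarrow> real) \<Rightarrow> real \<Rightarrow> complex set" where
  "loewner_preimage D b h u t = chain_domain D (loewner_vf b h u) t"

definition C1_on :: "real set \<Rightarrow> (real \<Rightarrow> real) \<Rightarrow> bool" where
  "C1_on S f \<longleftrightarrow> (\<exists>f'. continuous_on S f' \<and> (\<forall>t\<in>S. (f has_real_derivative f' t) (at t within S)))"

end

theory Submission
  imports Defs "HOL-Complex_Analysis.Complex_Analysis"
begin

text \<open>In the half-plane the Loewner field of a slit chain is a simple pole plus a real quadratic
  polynomial. A time-dependent real Moebius map can absorb the polynomial, turning the chain into a
  chordal one, \<open>2 / (w - W)\<close>, after a time change. The Moebius map solves an ordinary differential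
  equation in three real parameters, and conversely, given \<open>W\<close>, the Moebius map and the driver of the
  chain are recovered from another locally Lipschitz equation. For existence, pass from the first pair of
  fields to the chordal chain and from there to the second pair. For uniqueness, the chordal domains
  determine capacity and driver: if two reverse chordal flows have the same range, their transition map is
  an automorphism \<open>m\<close> of the half-plane with \<open>m (i y) - i y\<close> tending to 0, hence the identity by
  Schwarz--Pick, and the expansion at infinity and the time derivative give the two data. So every
  competing chain is conjugate to the same chordal chain, and the second equation has only one solution.\<close>

section \<open>Ordinary differential equations on an interval\<close>

text \<open>The conjugation is carried out only while the driver is near 0 and the Moebius map near
  the identity. The constructed chains may simply be cut short. A competing driver may not: it is an
  arbitrary continuous function on a prescribed interval, and nothing bounds it in advance. So
  equations are solved up to a first exit that records its cause. The competitor is identified with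
  the constructed chain up to its exit, where the constructed chain is strictly inside the region,
  so no early exit occurs. Chordal chains are the meeting point because their normalization at
  infinity leaves no Moebius freedom: the domain then fixes the conformal map, which it does not do
  for a general slit chain. Drivers are merely continuous, and the conjugation tolerates this
  because the pole enters the equation of the Moebius map only as a coefficient and is never
  differentiated.\<close>

abbreviation solves :: "(real \<Rightarrow> 'a::real_normed_vector) \<Rightarrow> (real \<Rightarrow> 'a) \<Rightarrow> real \<Rightarrow> bool" where
  "solves g g' T \<equiv> \<forall>s\<in>{0..T}. (g has_vector_derivative g' s) (at s within {0..T})"

lemma solves_continuous: "solves g g' T \<Longrightarrow> continuous_on {0..T} g"
  by (meson continuous_on_vector_derivative)

lemma solves_mono: "solves g g' T \<Longrightarrow> S \<le> T \<Longrightarrow> solves g g' S"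
  by (meson has_vector_derivative_within_subset atLeastatMost_subset_iff order_refl atLeastAtMost_iff order_trans)

text \<open>At the only point of \<open>{0..0}\<close> a derivative within the interval is no
  condition. This covers chains run for time 0.\<close>

lemma solves_0: "solves g g' 0"
  by (simp add: has_vector_derivative_def has_derivative_def bounded_linear_scaleR_left at_within_def)

lemma solves_bound:
  fixes g :: "real \<Rightarrow> 'a::real_normed_vector"
  assumes g: "solves g g' T" and B: "\<And>s. s \<in> {0..T} \<Longrightarrow> norm (g' s) \<le> B"
    and s: "s \<in> {0..T}" "t \<in> {0..T}"
  shows "norm (g s - g t) \<le> B * \<bar>s - t\<bar>"
proof -
  have "norm (g s - g t) \<le> B * norm (s - t)"
  proof (rule differentiable_bound[of "{0..T}" g "\<lambda>s h. h *\<^sub>R g' s"])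
    fix x assume x: "x \<in> {0..T}"
    show "(g has_derivative (\<lambda>h. h *\<^sub>R g' x)) (at x within {0..T})"
      using g x unfolding has_vector_derivative_def by blast
    show "onorm (\<lambda>h. h *\<^sub>R g' x) \<le> B"
      using B[OF x] by (simp add: onorm_scaleR_left[OF bounded_linear_ident] onorm_id)
  qed (use s in auto)
  thus ?thesis by simp
qed

lemma solves_mvt:
  fixes g :: "real \<Rightarrow> real"
  assumes g: "solves g g' T" and s: "s \<le> t" "s \<in> {0..T}" "t \<in> {0..T}"
  shows "\<exists>x\<in>{0..T}. g t - g s = (t - s) * g' x"
proof -
  have "\<exists>x\<in>{s..t}. g t - g s = (\<lambda>h. h *\<^sub>R g' x) (t - s)"
  proof (rule mvt_very_simple)
    fix x assume x: "s \<le> x" "x \<le> t"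
    have "(g has_derivative (\<lambda>h. h *\<^sub>R g' x)) (at x within {0..T})"
      using g x s unfolding has_vector_derivative_def by force
    thus "(g has_derivative (\<lambda>h. h *\<^sub>R g' x)) (at x within {s..t})"
      by (rule has_derivative_subset) (use s in auto)
  qed (use s in auto)
  thus ?thesis using s by auto
qed

lemma solves_mono_real:
  fixes g :: "real \<Rightarrow> real"
  assumes g: "solves g g' T" and B: "\<And>s. s \<in> {0..T} \<Longrightarrow> g' s \<le> B"
    and s: "s \<le> t" "s \<in> {0..T}" "t \<in> {0..T}"
  shows "g t - g s \<le> B * (t - s)"
  using solves_mvt[OF g s] B s mult_left_mono[of _ B "t - s"] by (force simp: mult.commute)

lemma solves_incr:
  fixes g :: "real \<Rightarrow> real"
  assumes g: "solves g g' T" and B: "\<And>s. s \<in> {0..T} \<Longrightarrow> g' s \<ge> 0"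
    and s: "s \<le> t" "s \<in> {0..T}" "t \<in> {0..T}"
  shows "g s \<le> g t"
proof -
  obtain x where "x \<in> {0..T}" "g t - g s = (t - s) * g' x" using solves_mvt[OF g s] by blast
  moreover have "(t - s) * g' x \<ge> 0" using B calculation s by (intro mult_nonneg_nonneg) auto
  ultimately show ?thesis by linarith
qed

lemma solves_strict_incr:
  fixes g :: "real \<Rightarrow> real"
  assumes g: "solves g g' T" and B: "\<And>s. s \<in> {0..T} \<Longrightarrow> g' s > 0"
    and s: "s < t" "s \<in> {0..T}" "t \<in> {0..T}"
  shows "g s < g t"
proof -
  obtain x where "x \<in> {0..T}" "g t - g s = (t - s) * g' x"
    using solves_mvt[OF g _ s(2,3)] s by auto
  moreover have "(t - s) * g' x > 0" using B calculation s by (intro mult_pos_pos) auto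
  ultimately show ?thesis by linarith
qed

lemma solves_derivative_unique:
  assumes "solves g f T" "solves g f' T" "0 < T" "s \<in> {0..T}"
  shows "f s = f' s"
  using vector_derivative_unique_within_closed_interval[of 0 T s g "f s" "f' s"] assms by auto

lemma solves_eq_if_zero_diff:
  assumes "solves g (\<lambda>_. 0) T" "s \<in> {0..T}"
  shows "g s = g 0"
  using solves_bound[OF assms(1), of 0 s 0] assms(2) by auto

text \<open>Contraction in the norm weighted by \<open>exp (- 2 L s)\<close>, which turns a global Lipschitz bound
  into a solution on the whole interval without patching.\<close>
lemma picard_lipschitz:
  fixes f :: "real \<Rightarrow> 'a::banach \<Rightarrow> 'a"
  assumes T: "0 \<le> T" and L: "0 < L"
    and cont: "\<And>g. continuous_on {0..T} g \<Longrightarrow> continuous_on {0..T} (\<lambda>s. f s (g s))"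
    and lip: "\<And>s z z'. s \<in> {0..T} \<Longrightarrow> norm (f s z - f s z') \<le> L * norm (z - z')"
  shows "\<exists>g. g 0 = z0 \<and> solves g (\<lambda>s. f s (g s)) T"
proof -
  \<comment> \<open>Clamping to \<open>{0..T}\<close> extends a continuous function on the interval
    to a bounded continuous one on the line, so the fixed point can be sought in the complete type
    of such functions.\<close>
  define cl where "cl = (\<lambda>s::real. max 0 (min T s))"
  have cl: "cl s \<in> {0..T}" for s using T by (auto simp: cl_def)
  have clid: "cl s = s" if "s \<in> {0..T}" for s using that by (auto simp: cl_def)
  have clc: "continuous_on UNIV cl" unfolding cl_def by (intro continuous_intros)
  \<comment> \<open>\<open>\<psi>\<close> stands for the candidate solution times
    \<open>exp (- 2 * L * s)\<close>; its plain sup norm is the weighted norm.\<close>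
  define G where "G = (\<lambda>(\<psi>::real \<Rightarrow>\<^sub>C 'a) s. f s (exp (2 * L * s) *\<^sub>R \<psi> s))"
  define I where "I = (\<lambda>\<psi> t. integral {0..t} (G \<psi>))"
  define P where "P = (\<lambda>\<psi> t. exp (- 2 * L * t) *\<^sub>R (z0 + I \<psi> t))"
  have Gc: "continuous_on {0..T} (G \<psi>)" for \<psi>
    unfolding G_def by (intro cont continuous_intros continuous_on_apply_bcontfun)
  have Ider: "solves (I \<psi>) (G \<psi>) T" for \<psi>
    unfolding I_def using integral_has_vector_derivative[OF Gc] by auto
  have Pc: "continuous_on {0..T} (P \<psi>)" for \<psi>
    unfolding P_def by (intro continuous_intros solves_continuous[OF Ider])
  have Pb: "(\<lambda>t. P \<psi> (cl t)) \<in> bcontfun" for \<psi>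
  proof -
    have "compact (P \<psi> ` {0..T})" by (intro compact_continuous_image Pc) auto
    hence "bounded (P \<psi> ` {0..T})" by (rule compact_imp_bounded)
    hence "bounded (range (\<lambda>t. P \<psi> (cl t)))" by (rule bounded_subset) (use cl in auto)
    moreover have "continuous_on UNIV (\<lambda>t. P \<psi> (cl t))"
      using cl by (intro continuous_on_compose2[OF Pc clc]) blast
    ultimately show ?thesis by (auto simp: bcontfun_def)
  qed
  define \<Phi> where "\<Phi> = (\<lambda>\<psi>. Bcontfun (\<lambda>t. P \<psi> (cl t)))"
  have ap: "apply_bcontfun (\<Phi> \<psi>) t = P \<psi> (cl t)" for \<psi> t
    unfolding \<Phi>_def by (subst Bcontfun_inverse[OF Pb]) auto
  have contr: "dist (\<Phi> \<psi>1) (\<Phi> \<psi>2) \<le> (1/2) * dist \<psi>1 \<psi>2" for \<psi>1 \<psi>2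
  proof (rule dist_bound)
    fix t0
    define t where "t = cl t0"
    have t: "t \<in> {0..T}" unfolding t_def by (rule cl)
    define d where "d = dist \<psi>1 \<psi>2"
    have d0: "0 \<le> d" by (simp add: d_def)
    have sub: "{0..t} \<subseteq> {0..T}" using t by auto
    \<comment> \<open>The rate \<open>2 * L\<close> produces the contraction factor: the integral of
      \<open>L * d * exp (2 * L * s)\<close> is at most \<open>d / 2\<close> times the weight,
      however long the interval is.\<close>
    have eint: "((\<lambda>s. L * d * exp (2 * L * s)) has_integral
        (d/2) * exp (2 * L * t) - (d/2) * exp (2 * L * 0)) {0..t}"
      using t L by (intro fundamental_theorem_of_calculus)
        (auto intro!: derivative_eq_intros simp flip: has_real_derivative_iff_has_vector_derivative)
    have "norm (I \<psi>1 t - I \<psi>2 t) = norm (integral {0..t} (\<lambda>s. G \<psi>1 s - G \<psi>2 s))"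
      unfolding I_def
      by (subst integral_diff) (auto intro!: integrable_continuous_real continuous_on_subset[OF Gc sub])
    also have "\<dots> \<le> integral {0..t} (\<lambda>s. L * d * exp (2 * L * s))"
    proof (rule integral_norm_bound_integral)
      show "(\<lambda>s. G \<psi>1 s - G \<psi>2 s) integrable_on {0..t}"
        by (intro integrable_continuous_real continuous_on_subset[OF _ sub] continuous_intros Gc)
      show "(\<lambda>s. L * d * exp (2 * L * s)) integrable_on {0..t}"
        using eint by (rule has_integral_integrable)
      fix s assume s: "s \<in> {0..t}"
      have "norm (G \<psi>1 s - G \<psi>2 s) \<le> L * norm (exp (2 * L * s) *\<^sub>R \<psi>1 s - exp (2 * L * s) *\<^sub>R \<psi>2 s)"
        unfolding G_def using s t by (intro lip) auto
      also have "\<dots> = L * (exp (2 * L * s) * dist (\<psi>1 s) (\<psi>2 s))"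
        by (simp add: dist_norm flip: scaleR_diff_right)
      also have "\<dots> \<le> L * (exp (2 * L * s) * d)"
        using L by (intro mult_left_mono) (auto simp: d_def dist_bounded)
      finally show "norm (G \<psi>1 s - G \<psi>2 s) \<le> L * d * exp (2 * L * s)" by (simp add: mult_ac)
    qed
    also have "\<dots> = (d/2) * exp (2 * L * t) - (d/2)"
      using integral_unique[OF eint] by simp
    also have "\<dots> \<le> (d/2) * exp (2 * L * t)" using d0 by simp
    finally have *: "norm (I \<psi>1 t - I \<psi>2 t) \<le> (d/2) * exp (2 * L * t)" .
    have "dist (\<Phi> \<psi>1 t0) (\<Phi> \<psi>2 t0) = exp (- 2 * L * t) * norm (I \<psi>1 t - I \<psi>2 t)"
      unfolding ap t_def[symmetric] P_def dist_norm by (simp flip: scaleR_diff_right)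
    also have "\<dots> \<le> exp (- 2 * L * t) * ((d/2) * exp (2 * L * t))"
      by (intro mult_left_mono *) auto
    also have "\<dots> = d/2" by (simp add: exp_minus field_simps)
    finally show "dist (\<Phi> \<psi>1 t0) (\<Phi> \<psi>2 t0) \<le> (1/2) * dist \<psi>1 \<psi>2" by (simp add: d_def)
  qed
  have "\<exists>!\<psi>. \<Phi> \<psi> = \<psi>"
    by (rule banach_fix_type[of "1/2"]) (use contr in auto)
  then obtain \<psi> where \<psi>: "\<Phi> \<psi> = \<psi>" by auto
  have pv: "exp (2 * L * t) *\<^sub>R \<psi> t = z0 + I \<psi> t" if "t \<in> {0..T}" for t
  proof -
    have "\<psi> t = P \<psi> t" using ap[of \<psi> t] clid[OF that] \<psi> by simp
    thus ?thesis unfolding P_def by (simp add: exp_minus)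
  qed
  have "solves (\<lambda>t. z0 + I \<psi> t) (\<lambda>s. f s (z0 + I \<psi> s)) T"
  proof
    fix s assume s: "s \<in> {0..T}"
    have "f s (z0 + I \<psi> s) = G \<psi> s" unfolding G_def pv[OF s] ..
    thus "((\<lambda>t. z0 + I \<psi> t) has_vector_derivative f s (z0 + I \<psi> s)) (at s within {0..T})"
      using Ider[of \<psi>] s by (auto intro!: derivative_eq_intros)
  qed
  moreover have "z0 + I \<psi> 0 = z0" by (simp add: I_def)
  ultimately show ?thesis by (intro exI[of _ "\<lambda>t. z0 + I \<psi> t"]) auto
qed

text \<open>Gronwall: \<open>exp (- 2 L s) * (norm (g1 s - g2 s))^2\<close> is nonincreasing.\<close>
lemma ode_unique:
  fixes g1 g2 :: "real \<Rightarrow> 'a::real_inner"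
  assumes 1: "solves g1 f1 T" and 2: "solves g2 f2 T" and eq: "g1 0 = g2 0"
    and lip: "\<And>s. s \<in> {0..T} \<Longrightarrow> norm (f1 s - f2 s) \<le> L * norm (g1 s - g2 s)"
    and s: "s \<in> {0..T}"
  shows "g1 s = g2 s"
proof -
  define d where "d = (\<lambda>s. g1 s - g2 s)"
  define N where "N = (\<lambda>s. exp (- 2 * L * s) * (d s \<bullet> d s))"
  define N' where "N' = (\<lambda>s. exp (- 2 * L * s) * (2 * (d s \<bullet> (f1 s - f2 s)) - 2 * L * (d s \<bullet> d s)))"
  have dd: "solves d (\<lambda>s. f1 s - f2 s) T"
    unfolding d_def using 1 2 by (auto intro!: derivative_intros)
  have "solves (\<lambda>s. - N s) (\<lambda>s. - N' s) T"
  proof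
    fix s assume s: "s \<in> {0..T}"
    have d: "(d has_derivative (\<lambda>h. h *\<^sub>R (f1 s - f2 s))) (at s within {0..T})"
      using dd s by (auto simp: has_vector_derivative_def)
    show "((\<lambda>s. - N s) has_vector_derivative - N' s) (at s within {0..T})"
      unfolding N_def N'_def has_vector_derivative_def
      by (rule derivative_eq_intros d refl ext | simp add: algebra_simps inner_commute)+
  qed
  moreover have "- N' s \<ge> 0" if "s \<in> {0..T}" for s
  proof -
    have "d s \<bullet> (f1 s - f2 s) \<le> norm (d s) * norm (f1 s - f2 s)" by (rule norm_cauchy_schwarz)
    also have "\<dots> \<le> norm (d s) * (L * norm (d s))"
      using lip[OF that] by (intro mult_left_mono) (auto simp: d_def)
    also have "\<dots> = L * (d s \<bullet> d s)" by (simp add: dot_square_norm power2_eq_square)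
    finally show ?thesis unfolding N'_def by (simp add: mult_le_0_iff)
  qed
  ultimately have "- N 0 \<le> - N s" using s by (intro solves_incr[where g = "\<lambda>s. - N s" and g' = "\<lambda>s. - N' s" and T = T]) auto
  moreover have "N 0 = 0" by (simp add: N_def d_def eq)
  ultimately have "exp (- 2 * L * s) * (d s \<bullet> d s) \<le> 0" by (simp add: N_def)
  hence "d s \<bullet> d s \<le> 0" by (simp add: mult_le_0_iff)
  hence "d s = 0" using inner_ge_zero[of "d s"] inner_eq_zero_iff[of "d s"] by linarith
  thus ?thesis by (simp add: d_def)
qed

text \<open>The exit time is the least element of the closed level set \<open>N s = 1\<close>; the
  intermediate value theorem turns any overshoot into a hit. The final disjunction keeps the reason
  for stopping, which bootstrap arguments then refute.\<close>

lemma first_exit: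
  fixes N :: "real \<Rightarrow> real"
  assumes b: "0 < b" and c: "continuous_on {0..b} N" and N0: "N 0 < 1"
  shows "\<exists>e. 0 < e \<and> e \<le> b \<and> (\<forall>s\<in>{0..<e}. N s < 1) \<and> N e \<le> 1 \<and> (e = b \<or> N e = 1)"
proof (cases "\<exists>s\<in>{0..b}. N s \<ge> 1")
  case False
  thus ?thesis using b by (intro exI[of _ b]) (auto simp: not_le less_imp_le)
next
  case True
  define A where "A = {s\<in>{0..b}. N s = 1}"
  have ex: "\<exists>s'\<ge>0. s' \<le> s \<and> N s' = 1" if "s \<in> {0..b}" "N s \<ge> 1" for s
    using that N0 by (intro IVT') (auto intro: continuous_on_subset[OF c])
  have ne: "A \<noteq> {}" using True ex by (force simp: A_def)
  have "closed A" unfolding A_def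
    by (rule continuous_closed_preimage_constant[OF c]) auto
  moreover have "bounded A" by (rule bounded_subset[of "{0..b}"]) (auto simp: A_def)
  ultimately have "compact A" by (simp add: compact_eq_bounded_closed)
  then obtain e where e: "e \<in> A" "\<forall>s\<in>A. e \<le> s" using compact_attains_inf[OF _ ne] by blast
  have "e \<noteq> 0" using e(1) N0 by (auto simp: A_def)
  moreover have "N s < 1" if se: "s \<in> {0..<e}" for s
  proof (rule ccontr)
    assume "\<not> N s < 1"
    then obtain s' where "s' \<ge> 0" "s' \<le> s" "N s' = 1" using ex[of s] se e(1) by (auto simp: A_def not_less)
    thus False using e se by (force simp: A_def)
  qed
  ultimately show ?thesis using e by (intro exI[of _ e]) (auto simp: A_def)
qed

text \<open>Continuity of the inverse comes from compactness of \<open>{0..T}\<close>, its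
  derivative from the inverse rule within the interval. Clocks are later read in both directions,
  hence the bundle of identities.\<close>

lemma solves_inverse:
  fixes \<kappa> :: "real \<Rightarrow> real"
  assumes T: "0 \<le> T" and k: "solves \<kappa> k T" and pos: "\<And>s. s \<in> {0..T} \<Longrightarrow> k s > 0" and k0: "\<kappa> 0 = 0"
  shows "\<exists>\<iota>. (\<forall>s\<in>{0..T}. \<iota> (\<kappa> s) = s) \<and> \<kappa> ` {0..T} = {0..\<kappa> T} \<and> \<iota> ` {0..\<kappa> T} = {0..T}
     \<and> (\<forall>s\<in>{0..\<kappa> T}. \<kappa> (\<iota> s) = s) \<and> solves \<iota> (\<lambda>s. 1 / k (\<iota> s)) (\<kappa> T) \<and> strict_mono_on {0..T} \<kappa>"
proof -
  have sm: "strict_mono_on {0..T} \<kappa>"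
    by (auto simp: strict_mono_on_def intro!: solves_strict_incr[OF k pos])
  hence inj: "inj_on \<kappa> {0..T}" by (rule strict_mono_on_imp_inj_on)
  have c: "continuous_on {0..T} \<kappa>" by (rule solves_continuous[OF k])
  have mono: "\<kappa> s \<le> \<kappa> t" if "s \<le> t" "s \<in> {0..T}" "t \<in> {0..T}" for s t
    using sm that by (meson strict_mono_on_leD)
  have im: "\<kappa> ` {0..T} = {0..\<kappa> T}"
  proof (intro equalityI subsetI)
    fix y assume "y \<in> {0..\<kappa> T}"
    then obtain x where "0 \<le> x" "x \<le> T" "\<kappa> x = y" using IVT'[of \<kappa> 0 y T] T c k0 by auto
    thus "y \<in> \<kappa> ` {0..T}" by auto
  qed (use mono[of 0] mono[of _ T] T k0 in auto)
  define \<iota> where "\<iota> = the_inv_into {0..T} \<kappa>"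
  have i1: "\<iota> (\<kappa> s) = s" if "s \<in> {0..T}" for s
    unfolding \<iota>_def by (rule the_inv_into_f_f[OF inj that])
  have i2: "\<kappa> (\<iota> s) = s" "\<iota> s \<in> {0..T}" if "s \<in> {0..\<kappa> T}" for s
  proof -
    from that im obtain r where "r \<in> {0..T}" "s = \<kappa> r" by blast
    thus "\<kappa> (\<iota> s) = s" "\<iota> s \<in> {0..T}" using i1 by auto
  qed
  have ic: "continuous_on {0..\<kappa> T} \<iota>"
    using continuous_on_inv[OF c] i1 im by auto
  have "(\<iota> has_vector_derivative 1 / k (\<iota> s)) (at s within {0..\<kappa> T})" if s: "s \<in> {0..\<kappa> T}" for s
  proof -
    have kk: "k (\<iota> s) > 0" using pos i2[OF s] by auto
    have "(\<iota> has_derivative (\<lambda>h. h * (1 / k (\<iota> s)))) (at (\<kappa> (\<iota> s)) within \<kappa> ` {0..T})"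
    proof (rule has_derivative_inverse_within)
      show "(\<kappa> has_derivative (\<lambda>h. h * k (\<iota> s))) (at (\<iota> s) within {0..T})"
        using k i2[OF s] by (auto simp: has_vector_derivative_def)
      show "continuous (at (\<kappa> (\<iota> s)) within \<kappa> ` {0..T}) \<iota>"
        using ic s i2[OF s] im by (simp add: continuous_on_eq_continuous_within)
      show "linear (\<lambda>h. h * (1 / k (\<iota> s)))"
        by (intro linearI) (auto simp: algebra_simps add_divide_distrib)
    qed (use i1 i2 s kk in \<open>auto simp: o_def\<close>)
    thus ?thesis using i2[OF s] im by (simp add: has_vector_derivative_def)
  qed
  moreover have "\<iota> ` {0..\<kappa> T} = {0..T}"
  proof -
    have "\<iota> ` (\<kappa> ` {0..T}) = {0..T}" using i1 by (force simp: image_image)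
    thus ?thesis by (simp add: im)
  qed
  ultimately show ?thesis using i1 i2 im sm by (intro exI[of _ \<iota>]) auto
qed

lemma solves_compose:
  fixes \<kappa> :: "real \<Rightarrow> real"
  assumes "solves \<kappa> k T" "\<kappa> ` {0..T} \<subseteq> {0..S}" "solves g g' S"
  shows "solves (\<lambda>s. g (\<kappa> s)) (\<lambda>s. k s *\<^sub>R g' (\<kappa> s)) T"
proof
  fix s assume s: "s \<in> {0..T}"
  have "\<kappa> s \<in> {0..S}" using assms(2) s by blast
  hence "(g has_vector_derivative g' (\<kappa> s)) (at (\<kappa> s) within \<kappa> ` {0..T})"
    using assms(2,3) by (meson has_vector_derivative_within_subset)
  thus "((\<lambda>s. g (\<kappa> s)) has_vector_derivative k s *\<^sub>R g' (\<kappa> s)) (at s within {0..T})"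
    using vector_diff_chain_within[of \<kappa> "k s" s "{0..T}" g "g' (\<kappa> s)"] assms(1) s
    by (auto simp: o_def)
qed

text \<open>Composing \<open>f\<close> with the nearest-point projection onto the ball, which is
  1-Lipschitz, makes the local Lipschitz bound global. The solution is stopped when it meets the
  sphere or when \<open>N\<close> reaches 1; up to then the projection is invisible.
  \<open>N\<close> watches quantities outside the state, such as a driver that has been clipped
  inside \<open>f\<close>.\<close>

lemma cutoff_ode:
  fixes f :: "real \<Rightarrow> 'a::euclidean_space \<Rightarrow> 'a" and N :: "real \<Rightarrow> real"
  assumes T: "0 < T" and r: "0 < r" and N: "continuous_on {0..T} N" "N 0 < 1"
    and cont: "\<And>g. continuous_on {0..T} g \<Longrightarrow> g ` {0..T} \<subseteq> cball z0 r \<Longrightarrow> continuous_on {0..T} (\<lambda>s. f s (g s))"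
    and L: "0 < L"
    and lip: "\<And>s z z'. s \<in> {0..T} \<Longrightarrow> z \<in> cball z0 r \<Longrightarrow> z' \<in> cball z0 r \<Longrightarrow> norm (f s z - f s z') \<le> L * norm (z - z')"
  shows "\<exists>e g. 0 < e \<and> e \<le> T \<and> g 0 = z0 \<and> solves g (\<lambda>s. f s (g s)) e
     \<and> (\<forall>s\<in>{0..e}. g s \<in> cball z0 r \<and> N s \<le> 1) \<and> (\<forall>s\<in>{0..<e}. dist z0 (g s) < r \<and> N s < 1)
     \<and> (e = T \<or> N e = 1 \<or> dist z0 (g e) = r)"
proof -
  define \<pi> where "\<pi> = closest_point (cball z0 r)"
  have S: "convex (cball z0 r)" "closed (cball z0 r)" "cball z0 r \<noteq> {}" using r by auto
  have \<pi>: "\<pi> z \<in> cball z0 r" for z unfolding \<pi>_def using S by (intro closest_point_in_set) auto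
  have \<pi>l: "norm (\<pi> z - \<pi> z') \<le> norm (z - z')" for z z'
    using closest_point_lipschitz[OF S] by (simp add: \<pi>_def dist_norm)
  have \<pi>c: "continuous_on UNIV \<pi>" unfolding \<pi>_def by (rule continuous_on_closest_point[OF S])
  have \<pi>id: "\<pi> z = z" if "z \<in> cball z0 r" for z
    unfolding \<pi>_def using that by (rule closest_point_self)
  have "\<exists>g. g 0 = z0 \<and> solves g (\<lambda>s. f s (\<pi> (g s))) T"
  proof (rule picard_lipschitz[OF _ L])
    fix g :: "real \<Rightarrow> 'a" assume g: "continuous_on {0..T} g"
    have "continuous_on {0..T} (\<lambda>s. \<pi> (g s))" using continuous_on_compose2[OF \<pi>c g] by simp
    thus "continuous_on {0..T} (\<lambda>s. f s (\<pi> (g s)))" using \<pi> by (intro cont) auto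
  next
    fix s z z' assume "s \<in> {0..T}"
    hence "norm (f s (\<pi> z) - f s (\<pi> z')) \<le> L * norm (\<pi> z - \<pi> z')" using \<pi> by (intro lip)
    also have "\<dots> \<le> L * norm (z - z')" using \<pi>l L by (intro mult_left_mono) auto
    finally show "norm (f s (\<pi> z) - f s (\<pi> z')) \<le> L * norm (z - z')" .
  qed (use T in auto)
  then obtain g where g: "g 0 = z0" "solves g (\<lambda>s. f s (\<pi> (g s))) T" by blast
  define M where "M = (\<lambda>s. max (N s) (dist z0 (g s) / r))"
  have "continuous_on {0..T} M"
    unfolding M_def using r by (intro continuous_intros N(1) solves_continuous[OF g(2)]) auto
  moreover have "M 0 < 1" using N(2) g(1) by (simp add: M_def)
  ultimately obtain e where e: "0 < e" "e \<le> T" "\<forall>s\<in>{0..<e}. M s < 1" "M e \<le> 1" "e = T \<or> M e = 1"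
    using first_exit[OF T] by blast
  have 1: "dist z0 (g s) < r" "N s < 1" if "s \<in> {0..<e}" for s
    using e(3) that r by (auto simp: M_def)
  have 2: "dist z0 (g e) \<le> r" "N e \<le> 1" using e(4) r by (auto simp: M_def)
  have 3: "g s \<in> cball z0 r" "N s \<le> 1" if "s \<in> {0..e}" for s
    using 1[of s] 2 that by (cases "s = e"; force)+
  have 4: "e = T \<or> N e = 1 \<or> dist z0 (g e) = r"
  proof (cases "e = T")
    case False
    hence "M e = 1" using e(5) by simp
    hence "N e = 1 \<or> dist z0 (g e) / r = 1" by (auto simp: M_def max_def split: if_splits)
    thus ?thesis using r by auto
  qed simp
  have "solves g (\<lambda>s. f s (\<pi> (g s))) e" by (rule solves_mono[OF g(2) e(2)])
  hence "solves g (\<lambda>s. f s (g s)) e" using 3(1) \<pi>id by simp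
  thus ?thesis using e(1,2) g(1) 1 3 4 by (intro exI[of _ e] exI[of _ g]) auto
qed

section \<open>Uniqueness for chordal chains\<close>

abbreviation chordal :: "(real \<Rightarrow> real) \<Rightarrow> real \<Rightarrow> complex \<Rightarrow> complex" where
  "chordal W \<equiv> \<lambda>s w. 2 / (w - of_real (W s))"

section \<open>The chordal field and its reverse flow on the half-plane\<close>

lemma open_UHP: "open UHP"
  unfolding UHP_def by (rule open_halfspace_Im_gt)

lemma connected_UHP: "connected UHP"
  unfolding UHP_def by (intro convex_connected convex_halfspace_Im_gt)

lemma Im_pos_ne_of_real: "Im z > 0 \<Longrightarrow> z - of_real v \<noteq> 0"
  by (auto simp: complex_eq_iff)

lemma Im_le_norm_diff_real: "Im z \<le> norm (z - of_real v)"
  using abs_Im_le_cmod[of "z - of_real v"] by simp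

lemma Im_chordal: "Im (- 2 / (z - of_real v)) = 2 * Im z / (norm (z - of_real v))\<^sup>2"
proof -
  have "- 2 / (z - of_real v) = (- 2 * cnj (z - of_real v)) / of_real ((norm (z - of_real v))\<^sup>2)"
    by (subst complex_div_cnj) (simp flip: complex_norm_square)
  thus ?thesis by (simp only: Im_divide_of_real) simp
qed

lemma norm_chordal: "Im z > 0 \<Longrightarrow> Im z \<ge> y \<Longrightarrow> y > 0 \<Longrightarrow> norm (2 / (z - of_real v)) \<le> 2 / y"
  using Im_le_norm_diff_real[of z v] by (simp add: norm_divide frac_le)

text \<open>Solutions of the chordal equation in reversed time. In this direction the field points
  upwards, so no point is swallowed by the driver and the flow exists from every point of the
  half-plane, unlike the forward flow.\<close>

definition rsol :: "(real \<Rightarrow> real) \<Rightarrow> real \<Rightarrow> complex \<Rightarrow> (real \<Rightarrow> complex) \<Rightarrow> bool" where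
  "rsol V T w \<beta> \<longleftrightarrow> \<beta> 0 = w \<and> solves \<beta> (\<lambda>s. - 2 / (\<beta> s - of_real (V s))) T \<and> (\<forall>s\<in>{0..T}. Im (\<beta> s) > 0)"

lemma solves_Im: "solves \<beta> b T \<Longrightarrow> solves (\<lambda>s. Im (\<beta> s)) (\<lambda>s. Im (b s)) T"
  using bounded_linear.has_vector_derivative[OF bounded_linear_Im] by blast

lemma rsol_solves: "rsol V T w \<beta> \<Longrightarrow> solves \<beta> (\<lambda>s. - 2 / (\<beta> s - of_real (V s))) T"
  by (simp add: rsol_def)

lemma rsol_Im:
  assumes "rsol V T w \<beta>" "s \<in> {0..T}"
  shows "Im w \<le> Im (\<beta> s)"
proof -
  have "solves (\<lambda>s. Im (\<beta> s)) (\<lambda>s. 2 * Im (\<beta> s) / (norm (\<beta> s - of_real (V s)))\<^sup>2) T"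
    unfolding Im_chordal[symmetric] by (rule solves_Im[OF rsol_solves[OF assms(1)]])
  from solves_incr[OF this, of 0 s] assms show ?thesis
    by (auto simp: rsol_def less_imp_le)
qed

text \<open>The derivative of the squared height is 4 times the ratio of the squared height to the
  squared distance from the driver, hence at most 4. This bounds the height of a preimage of a high
  point from below.\<close>

lemma rsol_Im_sq:
  assumes "rsol V T w \<beta>" "s \<in> {0..T}"
  shows "(Im (\<beta> s))\<^sup>2 \<le> (Im w)\<^sup>2 + 4 * s"
proof -
  define I where "I = (\<lambda>s. Im (\<beta> s))"
  define d where "d = (\<lambda>s. 2 * I s / (norm (\<beta> s - of_real (V s)))\<^sup>2)"
  have I: "solves I d T"
    unfolding d_def I_def Im_chordal[symmetric] by (rule solves_Im[OF rsol_solves[OF assms(1)]])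
  have "solves (\<lambda>s. I s * I s) (\<lambda>s. I s * d s + d s * I s) T"
    using I by (intro ballI has_vector_derivative_mult) blast+
  moreover have "I s * d s + d s * I s \<le> 4" if "s \<in> {0..T}" for s
  proof -
    have "0 < I s" using assms(1) that by (auto simp: rsol_def I_def)
    moreover have "I s \<le> norm (\<beta> s - of_real (V s))" unfolding I_def by (rule Im_le_norm_diff_real)
    ultimately have "(I s)\<^sup>2 / (norm (\<beta> s - of_real (V s)))\<^sup>2 \<le> 1"
      by (auto simp: divide_simps intro!: power_mono)
    thus ?thesis unfolding d_def by (simp add: power2_eq_square)
  qed
  ultimately have "I s * I s - I 0 * I 0 \<le> 4 * (s - 0)"
    by (rule solves_mono_real) (use assms in auto)
  thus ?thesis using assms(1) by (simp add: power2_eq_square rsol_def I_def)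
qed

lemma rsol_dist:
  assumes "rsol V T w \<beta>" "s \<in> {0..T}"
  shows "norm (\<beta> s - w) \<le> 2 / Im w * s"
proof -
  have w: "0 < Im w" using assms by (force simp: rsol_def)
  have "norm (\<beta> s - \<beta> 0) \<le> 2 / Im w * \<bar>s - 0\<bar>"
  proof (rule solves_bound)
    show "solves \<beta> (\<lambda>s. - 2 / (\<beta> s - of_real (V s))) T" using assms by (auto simp: rsol_def)
    fix s assume s: "s \<in> {0..T}"
    show "norm (- 2 / (\<beta> s - of_real (V s))) \<le> 2 / Im w"
      using norm_chordal[of "\<beta> s" "Im w" "V s"] rsol_Im[OF assms(1) s] w by (simp add: norm_divide)
  qed (use assms in auto)
  thus ?thesis using assms by (auto simp: rsol_def)
qed

text \<open>Points below height \<open>Im w\<close> are given the field at that height, which makes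
  the field globally Lipschitz. The imaginary part is still nondecreasing along the modified flow,
  so the solution never enters the modified region.\<close>

lemma rsol_exists:
  assumes T: "0 \<le> T" and V: "continuous_on {0..T} V" and w: "0 < Im w"
  shows "\<exists>\<beta>. rsol V T w \<beta>"
proof -
  define \<pi> where "\<pi> = (\<lambda>z. Complex (Re z) (max (Im w) (Im z)))"
  have pIm: "Im w \<le> Im (\<pi> z)" for z by (simp add: \<pi>_def)
  have plip: "norm (\<pi> z - \<pi> z') \<le> norm (z - z')" for z z'
    unfolding \<pi>_def cmod_def
    by (auto intro!: real_sqrt_le_mono add_left_mono simp flip: abs_le_square_iff)
  define f where "f = (\<lambda>s z. - 2 / (\<pi> z - of_real (V s)))"
  have "\<exists>g. g 0 = w \<and> solves g (\<lambda>s. f s (g s)) T"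
  proof (rule picard_lipschitz[OF T, where L = "2 / (Im w * Im w)"])
    fix s z z' assume "s \<in> {0..T}"
    define a b where "a = \<pi> z - of_real (V s)" and "b = \<pi> z' - of_real (V s)"
    have a: "Im w \<le> norm a" "Im w \<le> norm b"
      unfolding a_def b_def using Im_le_norm_diff_real pIm order_trans by blast+
    hence ne: "a \<noteq> 0" "b \<noteq> 0" using w by auto
    have "norm (f s z - f s z') = 2 * norm (a - b) / (norm a * norm b)"
    proof -
      have "f s z - f s z' = 2 * (a - b) / (a * b)"
        unfolding f_def a_def[symmetric] b_def[symmetric] using ne by (simp add: field_simps)
      thus ?thesis by (simp only: norm_divide norm_mult norm_numeral)
    qed
    also have "\<dots> \<le> 2 * norm (a - b) / (Im w * Im w)"
      using a w by (intro divide_left_mono mult_mono mult_pos_pos) auto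
    also have "a - b = \<pi> z - \<pi> z'" by (simp add: a_def b_def)
    also have "2 * norm (\<pi> z - \<pi> z') / (Im w * Im w) \<le> 2 * norm (z - z') / (Im w * Im w)"
      using w plip by (intro divide_right_mono mult_left_mono) auto
    finally show "norm (f s z - f s z') \<le> 2 / (Im w * Im w) * norm (z - z')" by simp
  next
    fix g :: "real \<Rightarrow> complex" assume g: "continuous_on {0..T} g"
    have "\<pi> z - of_real v \<noteq> 0" for z v
      using pIm[of z] w by (intro Im_pos_ne_of_real) auto
    thus "continuous_on {0..T} (\<lambda>s. f s (g s))"
      unfolding f_def \<pi>_def by (intro continuous_intros g V) auto
  qed (use w in auto)
  then obtain g where g: "g 0 = w" "solves g (\<lambda>s. f s (g s)) T" by blast
  have "solves (\<lambda>s. Im (g s)) (\<lambda>s. Im (f s (g s))) T" by (rule solves_Im[OF g(2)])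
  moreover have "Im (f s (g s)) \<ge> 0" if "s \<in> {0..T}" for s
    unfolding f_def Im_chordal using pIm[of "g s"] w by auto
  ultimately have "Im (g 0) \<le> Im (g s)" if "s \<in> {0..T}" for s
    using that by (intro solves_incr[where g = "\<lambda>s. Im (g s)"]) auto
  hence Im: "Im (g s) \<ge> Im w" if "s \<in> {0..T}" for s using that g(1) by auto
  hence "\<pi> (g s) = g s" if "s \<in> {0..T}" for s using that by (auto simp: \<pi>_def complex_eq_iff)
  hence "rsol V T w g" using g Im w unfolding rsol_def f_def by fastforce
  thus ?thesis by blast
qed

lemma has_vector_derivative_exp_within:
  fixes E :: "real \<Rightarrow> complex"
  assumes "(E has_vector_derivative e) (at s within S)"
  shows "((\<lambda>s. exp (E s)) has_vector_derivative e * exp (E s)) (at s within S)"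
  using field_vector_diff_chain_within[OF assms, of exp "exp (E s)"]
  by (auto simp: o_def intro: has_field_derivative_at_within DERIV_exp)

text \<open>Two solutions of the chordal equation satisfy a linear equation for their difference; the
  resulting explicit formula gives uniqueness, injectivity and holomorphy in the initial value.\<close>
lemma rsol_diff:
  assumes T: "0 \<le> T" and V: "continuous_on {0..T} V" and 1: "rsol V T w1 \<beta>1" and 2: "rsol V T w2 \<beta>2"
  shows "\<exists>E. E 0 = 0 \<and> solves E (\<lambda>s. 2 / ((\<beta>1 s - of_real (V s)) * (\<beta>2 s - of_real (V s)))) T
     \<and> (\<forall>s\<in>{0..T}. \<beta>1 s - \<beta>2 s = (w1 - w2) * exp (E s) \<and> norm (E s) \<le> 2 / (Im w1 * Im w2) * s)"
proof -
  define a b where "a = (\<lambda>s. \<beta>1 s - of_real (V s))" and "b = (\<lambda>s. \<beta>2 s - of_real (V s))"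
  have s1: "solves \<beta>1 (\<lambda>s. - 2 / a s) T" and s2: "solves \<beta>2 (\<lambda>s. - 2 / b s) T"
    using 1 2 by (auto simp: rsol_def a_def b_def)
  have w: "0 < Im w1" "0 < Im w2" using 1 2 T by (force simp: rsol_def)+
  have ab: "Im w1 \<le> norm (a s)" "Im w2 \<le> norm (b s)" if "s \<in> {0..T}" for s
    unfolding a_def b_def
    using rsol_Im[OF 1 that] rsol_Im[OF 2 that] Im_le_norm_diff_real order_trans by blast+
  hence ne: "a s \<noteq> 0" "b s \<noteq> 0" if "s \<in> {0..T}" for s using w that by force+
  define e where "e = (\<lambda>s. 2 / (a s * b s))"
  have ce: "continuous_on {0..T} e"
    unfolding e_def using ne
    by (auto simp: a_def b_def intro!: continuous_intros V solves_continuous[OF s1] solves_continuous[OF s2])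
  define E where "E = (\<lambda>s. integral {0..s} e)"
  have E: "solves E e T" unfolding E_def using integral_has_vector_derivative[OF ce] by blast
  have E0: "E 0 = 0" by (simp add: E_def)
  have nE: "norm (E s) \<le> 2 / (Im w1 * Im w2) * s" if "s \<in> {0..T}" for s
  proof -
    have "norm (E s - E 0) \<le> 2 / (Im w1 * Im w2) * \<bar>s - 0\<bar>"
    proof (rule solves_bound[OF E])
      fix s assume s: "s \<in> {0..T}"
      show "norm (e s) \<le> 2 / (Im w1 * Im w2)"
        unfolding e_def using ab[OF s] w
        by (auto simp: norm_divide norm_mult intro!: divide_left_mono mult_mono mult_pos_pos)
    qed (use that in auto)
    thus ?thesis using that E0 by auto
  qed
  \<comment> \<open>Integrating factor: the difference of the two solutions has derivative
    \<open>e s\<close> times itself, so \<open>q\<close> is constant.\<close>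
  define q where "q = (\<lambda>s. (\<beta>1 s - \<beta>2 s) * exp (- E s))"
  have "solves q (\<lambda>s. 0) T"
  proof
    fix s assume s: "s \<in> {0..T}"
    have "(q has_vector_derivative (\<beta>1 s - \<beta>2 s) * (- e s * exp (- E s)) + (- 2 / a s - (- 2 / b s)) * exp (- E s))
        (at s within {0..T})"
      unfolding q_def using s1 s2 E s
      by (intro derivative_intros has_vector_derivative_exp_within) blast+
    also have "\<beta>1 s - \<beta>2 s = a s - b s" by (simp add: a_def b_def)
    also have "(a s - b s) * (- e s * exp (- E s)) + (- 2 / a s - (- 2 / b s)) * exp (- E s) = 0"
      using ne[OF s] by (simp add: e_def field_simps)
    finally show "(q has_vector_derivative 0) (at s within {0..T})" .
  qed
  hence "q s = q 0" if "s \<in> {0..T}" for s using solves_eq_if_zero_diff that by blast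
  moreover have "q 0 = w1 - w2" using 1 2 E0 by (simp add: q_def rsol_def)
  ultimately have q: "q s = w1 - w2" if "s \<in> {0..T}" for s using that by simp
  have "\<beta>1 s - \<beta>2 s = q s * exp (E s)" for s by (simp add: q_def exp_minus)
  hence "\<beta>1 s - \<beta>2 s = (w1 - w2) * exp (E s)" if "s \<in> {0..T}" for s
    using q[OF that] by simp
  thus ?thesis using E E0 nE unfolding e_def a_def b_def by blast
qed

text \<open>For continuous \<open>V\<close> and \<open>w\<close> in the half-plane the choice is
  immaterial, by \<open>rflow_eq\<close>.\<close>

definition rflow :: "(real \<Rightarrow> real) \<Rightarrow> real \<Rightarrow> complex \<Rightarrow> complex" where
  "rflow V T w = (SOME \<beta>. rsol V T w \<beta>) T"

context
  fixes V :: "real \<Rightarrow> real" and T :: real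
  assumes T: "0 \<le> T" and V: "continuous_on {0..T} V"
begin

lemma rsol_some: "w \<in> UHP \<Longrightarrow> rsol V T w (SOME \<beta>. rsol V T w \<beta>)"
  using someI_ex[OF rsol_exists[OF T V]] by (auto simp: UHP_def)

lemma rflow_eq:
  assumes "rsol V T w \<beta>" shows "rflow V T w = \<beta> T"
proof -
  have "rsol V T w (SOME \<beta>. rsol V T w \<beta>)" using assms by (rule someI[of "rsol V T w"])
  from rsol_diff[OF T V this assms] T show ?thesis by (auto simp: rflow_def)
qed

lemma rflow_Im: "w \<in> UHP \<Longrightarrow> Im w \<le> Im (rflow V T w)"
  using rsol_Im[OF rsol_some, of w T] T by (auto simp: rflow_def)

lemma rflow_Im_sq: "w \<in> UHP \<Longrightarrow> (Im (rflow V T w))\<^sup>2 \<le> (Im w)\<^sup>2 + 4 * T"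
  using rsol_Im_sq[OF rsol_some, of w T] T by (auto simp: rflow_def)

lemma rflow_dist: "w \<in> UHP \<Longrightarrow> norm (rflow V T w - w) \<le> 2 / Im w * T"
  using rsol_dist[OF rsol_some, of w T] T by (auto simp: rflow_def)

lemma rflow_inj: "inj_on (rflow V T) UHP"
proof (rule inj_onI)
  fix w1 w2 assume "w1 \<in> UHP" "w2 \<in> UHP" "rflow V T w1 = rflow V T w2"
  moreover from this obtain E where "(SOME \<beta>. rsol V T w1 \<beta>) T - (SOME \<beta>. rsol V T w2 \<beta>) T = (w1 - w2) * exp (E T)"
    using rsol_diff[OF T V rsol_some rsol_some, of w1 w2] T by fastforce
  ultimately show "w1 = w2" by (simp add: rflow_def)
qed

text \<open>By \<open>rsol_diff\<close> the difference quotient at \<open>w1\<close> is exactly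
  \<open>exp (E w T)\<close>, so complex differentiability reduces to continuity of
  \<open>E w T\<close> in \<open>w\<close> at \<open>w1\<close>.\<close>

lemma rflow_deriv:
  assumes w1: "w1 \<in> UHP"
  shows "rflow V T field_differentiable (at w1)"
proof -
  define B where "B = (\<lambda>w. SOME \<beta>. rsol V T w \<beta>)"
  have B: "rsol V T w (B w)" if "w \<in> UHP" for w unfolding B_def by (rule rsol_some[OF that])
  define y where "y = Im w1"
  have y: "0 < y" using w1 by (auto simp: UHP_def y_def)
  have "\<forall>w\<in>UHP. \<exists>E. E 0 = 0 \<and> solves E (\<lambda>s. 2 / ((B w s - of_real (V s)) * (B w1 s - of_real (V s)))) T
     \<and> (\<forall>s\<in>{0..T}. B w s - B w1 s = (w - w1) * exp (E s) \<and> norm (E s) \<le> 2 / (Im w * Im w1) * s)"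
    using rsol_diff[OF T V B B[OF w1]] by blast
  from bchoice[OF this] obtain E where
    E0: "\<And>w. w \<in> UHP \<Longrightarrow> E w 0 = 0" and
    E: "\<And>w. w \<in> UHP \<Longrightarrow> solves (E w) (\<lambda>s. 2 / ((B w s - of_real (V s)) * (B w1 s - of_real (V s)))) T" and
    Ed: "\<And>w s. w \<in> UHP \<Longrightarrow> s \<in> {0..T} \<Longrightarrow> B w s - B w1 s = (w - w1) * exp (E w s)" and
    En: "\<And>w s. w \<in> UHP \<Longrightarrow> s \<in> {0..T} \<Longrightarrow> norm (E w s) \<le> 2 / (Im w * Im w1) * s"
    by metis
  \<comment> \<open>For \<open>Im w > y / 2\<close> the distances to the driver are at least
    \<open>y\<close> and \<open>y / 2\<close>. So the integrands of \<open>E w\<close> and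
    \<open>E w1\<close> differ by at most \<open>4 / y ^ 3\<close> times the distance of the two
    solutions, which is at most \<open>norm (w - w1) * exp (4 / (y * y) * T)\<close>.\<close>
  define C where "C = 4 / y ^ 3 * exp (4 / (y * y) * T) * T"
  have bound: "norm (E w T - E w1 T) \<le> C * norm (w - w1)" if w: "Im w > y / 2" for w
  proof -
    have wU: "w \<in> UHP" using w y by (auto simp: UHP_def)
    define a b where "a = (\<lambda>s. B w1 s - of_real (V s))" and "b = (\<lambda>s. B w s - of_real (V s))"
    have "norm ((E w T - E w1 T) - (E w 0 - E w1 0)) \<le> (4 / y ^ 3 * exp (4 / (y * y) * T) * norm (w - w1)) * \<bar>T - 0\<bar>"
    proof (rule solves_bound)
      show "solves (\<lambda>s. E w s - E w1 s) (\<lambda>s. 2 / (b s * a s) - 2 / (a s * a s)) T"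
        unfolding a_def b_def using E[OF wU] E[OF w1] by (auto intro!: derivative_intros)
      fix s assume s: "s \<in> {0..T}"
      have ay: "y \<le> norm (a s)"
        using rsol_Im[OF B[OF w1] s] Im_le_norm_diff_real[of "B w1 s" "V s"] by (simp add: a_def y_def)
      have yb: "y / 2 \<le> norm (b s)"
        using rsol_Im[OF B[OF wU] s] Im_le_norm_diff_real[of "B w s" "V s"] w by (simp add: b_def)
      have ne: "a s \<noteq> 0" "b s \<noteq> 0" using ay yb y by auto
      have "2 / (b s * a s) - 2 / (a s * a s) = 2 * (a s - b s) / (b s * a s * a s)"
        using ne by (simp add: field_simps)
      hence "norm (2 / (b s * a s) - 2 / (a s * a s)) = 2 * norm (a s - b s) / (norm (b s) * norm (a s) * norm (a s))"
        by (simp only: norm_divide norm_mult norm_numeral)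
      also have "\<dots> \<le> 2 * norm (a s - b s) / (y / 2 * y * y)"
        using ay yb y by (intro divide_left_mono mult_mono mult_pos_pos) auto
      also have "\<dots> = 4 / y ^ 3 * norm (a s - b s)" by (simp add: power3_eq_cube)
      also have "norm (a s - b s) = norm (w - w1) * norm (exp (E w s))"
        by (subst norm_minus_commute) (simp add: a_def b_def Ed[OF wU s] norm_mult)
      also have "4 / y ^ 3 * (norm (w - w1) * norm (exp (E w s)))
          \<le> 4 / y ^ 3 * (norm (w - w1) * exp (4 / (y * y) * T))"
      proof (intro mult_left_mono)
        have "2 / (Im w * Im w1) * s \<le> 2 / (y / 2 * y) * T"
          using s w y by (intro mult_mono divide_left_mono mult_pos_pos) (auto simp: y_def)
        hence "norm (E w s) \<le> 4 / (y * y) * T" using En[OF wU s] by simp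
        thus "norm (exp (E w s)) \<le> exp (4 / (y * y) * T)"
          using norm_exp[of "E w s"] by (meson exp_le_cancel_iff order_trans)
      qed (use y in auto)
      finally show "norm (2 / (b s * a s) - 2 / (a s * a s)) \<le> 4 / y ^ 3 * exp (4 / (y * y) * T) * norm (w - w1)"
        by (simp add: mult_ac)
    qed (use T in auto)
    thus ?thesis using E0[OF wU] E0[OF w1] T by (simp add: C_def mult_ac)
  qed
  have ev: "\<forall>\<^sub>F w in at w1. Im w > y / 2"
  proof -
    have "(Im \<longlongrightarrow> Im w1) (at w1)" by (intro tendsto_intros)
    thus ?thesis by (rule order_tendstoD) (use y in \<open>auto simp: y_def\<close>)
  qed
  have "((\<lambda>w. E w T - E w1 T) \<longlongrightarrow> 0) (at w1)"
  proof (rule Lim_null_comparison)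
    show "\<forall>\<^sub>F w in at w1. norm (E w T - E w1 T) \<le> C * norm (w - w1)"
      using ev by eventually_elim (rule bound)
    have "((\<lambda>w. C * norm (w - w1)) \<longlongrightarrow> C * norm (w1 - w1)) (at w1)" by (intro tendsto_intros)
    thus "((\<lambda>w. C * norm (w - w1)) \<longlongrightarrow> 0) (at w1)" by simp
  qed
  hence "((\<lambda>w. E w T) \<longlongrightarrow> E w1 T) (at w1)" by (rule LIM_zero_cancel)
  hence "((\<lambda>w. exp (E w T)) \<longlongrightarrow> exp (E w1 T)) (at w1)" by (intro tendsto_intros)
  moreover have "\<forall>\<^sub>F w in at w1. (rflow V T w - rflow V T w1) / (w - w1) = exp (E w T)"
    using ev eventually_neq_at_within[of w1 w1 UNIV]
  proof eventually_elim
    case (elim w)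
    hence "w \<in> UHP" using y by (auto simp: UHP_def)
    from Ed[OF this, of T] T elim show ?case by (simp add: rflow_def B_def)
  qed
  ultimately have "(rflow V T has_field_derivative exp (E w1 T)) (at w1)"
    unfolding has_field_derivative_iff by (simp cong: tendsto_cong)
  thus ?thesis by (auto simp: field_differentiable_def)
qed

lemma rflow_holomorphic: "rflow V T holomorphic_on UHP"
  using rflow_deriv by (auto simp: holomorphic_on_def intro: field_differentiable_at_within)

text \<open>On the imaginary axis this is the expansion \<open>w - 2 * T / w\<close> of the flow at
  infinity up to order \<open>1 / w^2\<close>; the capacity in it reveals the time. The quantity
  inside the norm, taken at time \<open>s\<close>, has derivative
  \<open>2 * ((\<beta> s - \<i> * y) - V s) / (\<beta> s - V s)\<close>, which is of order
  \<open>1 / y\<close>.\<close>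

lemma rflow_expansion:
  "\<exists>K. \<forall>y\<ge>1. norm (\<i> * y * (rflow V T (\<i> * y) - \<i> * y) + 2 * of_real T) \<le> K / y"
proof -
  have "compact (V ` {0..T})" by (intro compact_continuous_image V) auto
  then obtain A where A: "\<And>s. s \<in> {0..T} \<Longrightarrow> \<bar>V s\<bar> \<le> A"
    by (force dest!: compact_imp_bounded simp: bounded_iff)
  have "norm (\<i> * y * (rflow V T (\<i> * y) - \<i> * y) + 2 * of_real T) \<le> (2 * (2 * T + A) * T) / y"
    if y: "1 \<le> y" for y :: real
  proof -
    have U: "\<i> * y \<in> UHP" using y by (auto simp: UHP_def)
    define \<beta> where "\<beta> = (SOME \<beta>. rsol V T (\<i> * y) \<beta>)"
    have b: "rsol V T (\<i> * y) \<beta>" unfolding \<beta>_def by (rule rsol_some[OF U])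
    define \<delta> where "\<delta> = (\<lambda>s. \<i> * y * (\<beta> s - \<i> * y) + 2 * of_real s)"
    have "norm (\<delta> T - \<delta> 0) \<le> (2 * (2 * T + A) / y) * \<bar>T - 0\<bar>"
    proof (rule solves_bound)
      show "solves \<delta> (\<lambda>s. \<i> * y * (- 2 / (\<beta> s - of_real (V s))) + 2) T"
      proof
        fix s assume "s \<in> {0..T}"
        hence "(\<beta> has_vector_derivative (- 2 / (\<beta> s - of_real (V s)))) (at s within {0..T})"
          using b by (auto simp: rsol_def)
        thus "(\<delta> has_vector_derivative (\<i> * y * (- 2 / (\<beta> s - of_real (V s))) + 2)) (at s within {0..T})"
          unfolding \<delta>_def by (auto intro!: derivative_eq_intros)
      qed
      fix s assume s: "s \<in> {0..T}"
      have Ib: "y \<le> Im (\<beta> s)" using rsol_Im[OF b s] by simp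
      have n1: "y \<le> norm (\<beta> s - of_real (V s))" using Ib Im_le_norm_diff_real[of "\<beta> s" "V s"] by simp
      have ne: "\<beta> s - of_real (V s) \<noteq> 0" using n1 y by auto
      have "norm (\<beta> s - \<i> * y) \<le> 2 / y * s" using rsol_dist[OF b s] by simp
      also have "\<dots> \<le> 2 / 1 * T" using y s by (intro mult_mono divide_left_mono) auto
      finally have n2: "norm (\<beta> s - \<i> * y) \<le> 2 * T" by simp
      have "\<i> * y * (- 2 / (\<beta> s - of_real (V s))) + 2 = 2 * ((\<beta> s - \<i> * y) - of_real (V s)) / (\<beta> s - of_real (V s))"
        using ne by (simp add: field_simps)
      hence "norm (\<i> * y * (- 2 / (\<beta> s - of_real (V s))) + 2)
          = 2 * norm ((\<beta> s - \<i> * y) - of_real (V s)) / norm (\<beta> s - of_real (V s))"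
        by (simp only: norm_divide norm_mult) simp
      also have "\<dots> \<le> 2 * (2 * T + A) / y"
      proof (intro frac_le mult_left_mono)
        show "norm ((\<beta> s - \<i> * y) - of_real (V s)) \<le> 2 * T + A"
          using norm_triangle_ineq4[of "\<beta> s - \<i> * y" "of_real (V s)"] n2 A[OF s] by simp
      qed (use n1 y T A[OF s] abs_ge_zero[of "V s"] in \<open>auto simp del: abs_ge_zero\<close>)
      finally show "norm (\<i> * y * (- 2 / (\<beta> s - of_real (V s))) + 2) \<le> 2 * (2 * T + A) / y" .
    qed (use T in auto)
    moreover have "\<delta> 0 = 0" using b by (simp add: \<delta>_def rsol_def)
    ultimately have "norm (\<delta> T) \<le> (2 * (2 * T + A) * T) / y" using T by simp
    thus ?thesis unfolding \<delta>_def rflow_eq[OF b] .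
  qed
  thus ?thesis by blast
qed

end

section \<open>Rigidity of half-plane self-maps at infinity\<close>

lemma norm_diff_cnj:
  "(norm (z - cnj b))\<^sup>2 = (norm (z - b))\<^sup>2 + 4 * (Im z * Im b)"
  unfolding cmod_power2 by (simp add: power2_eq_square algebra_simps)

text \<open>The Schwarz lemma carried over by the Cayley maps \<open>C a\<close> and
  \<open>C (m a)\<close>. Rewriting both denominators with \<open>norm_diff_cnj\<close> cancels the
  product of the squared distances and leaves a form without division, in which the limit at
  infinity can be taken.\<close>

lemma schwarz_pick_UHP:
  assumes m: "m holomorphic_on UHP" "m ` UHP \<subseteq> UHP" and a: "a \<in> UHP" and w: "w \<in> UHP"
  shows "(norm (m w - m a))\<^sup>2 * (Im w * Im a) \<le> (norm (w - a))\<^sup>2 * (Im (m w) * Im (m a))"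
proof -
  define C where "C = (\<lambda>b z::complex. (z - b) / (z - cnj b))"
  \<comment> \<open>\<open>S b\<close> undoes \<open>C b\<close>: it carries the disc into the
    half-plane and 0 to \<open>b\<close>.\<close>
  define S where "S = (\<lambda>b \<xi>::complex. (b - cnj b * \<xi>) / (1 - \<xi>))"
  have ne: "z - cnj b \<noteq> 0" if "z \<in> UHP" "b \<in> UHP" for z b
    using that by (auto simp: UHP_def complex_eq_iff)
  have C1: "norm (C b z) < 1" if "z \<in> UHP" "b \<in> UHP" for z b
  proof -
    have "(norm (z - b))\<^sup>2 < (norm (z - cnj b))\<^sup>2"
      using that by (simp add: norm_diff_cnj UHP_def)
    hence "norm (z - b) < norm (z - cnj b)" by (rule power2_less_imp_less) auto
    thus ?thesis using ne[OF that] by (simp add: C_def norm_divide)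
  qed
  have SU: "S b \<xi> \<in> UHP" if "b \<in> UHP" "norm \<xi> < 1" for b \<xi>
  proof -
    have n: "1 - \<xi> \<noteq> 0" using that by auto
    have "S b \<xi> = ((b - cnj b * \<xi>) * cnj (1 - \<xi>)) / of_real ((norm (1 - \<xi>))\<^sup>2)"
      unfolding S_def by (subst complex_div_cnj) (simp flip: complex_norm_square)
    hence "Im (S b \<xi>) = Im ((b - cnj b * \<xi>) * cnj (1 - \<xi>)) / (norm (1 - \<xi>))\<^sup>2"
      by (simp only: Im_divide_of_real)
    also have "Im ((b - cnj b * \<xi>) * cnj (1 - \<xi>)) = Im b * (1 - (norm \<xi>)\<^sup>2)"
      unfolding cmod_power2 by (simp add: power2_eq_square algebra_simps)
    finally show ?thesis using that n by (simp add: UHP_def power_less_one_iff)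
  qed
  have CS: "S b (C b z) = z" if "z \<in> UHP" "b \<in> UHP" for z b
  proof -
    have "b - cnj b \<noteq> 0" using that by (auto simp: UHP_def complex_eq_iff)
    moreover have "1 - C b z = (b - cnj b) / (z - cnj b)" using ne[OF that] by (simp add: C_def field_simps)
    moreover have "b - cnj b * C b z = z * (b - cnj b) / (z - cnj b)" using ne[OF that] by (simp add: C_def field_simps)
    ultimately show ?thesis using ne[OF that] by (simp add: S_def)
  qed
  have ma: "m a \<in> UHP" and mw: "m w \<in> UHP" using m a w by auto
  define g where "g = (\<lambda>\<xi>. C (m a) (m (S a \<xi>)))"
  have S_hol: "S a holomorphic_on ball 0 1"
    unfolding S_def by (intro holomorphic_intros) auto
  have g1: "norm (g \<xi>) < 1" if "norm \<xi> < 1" for \<xi>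
    unfolding g_def using m(2) SU[OF a that] ma by (intro C1) auto
  have "g holomorphic_on ball 0 1"
  proof -
    have "(\<lambda>\<xi>. m (S a \<xi>)) holomorphic_on ball 0 1"
      using holomorphic_on_compose_gen[OF S_hol m(1)] SU[OF a] by (force simp: o_def)
    moreover have "m (S a \<xi>) - cnj (m a) \<noteq> 0" if "\<xi> \<in> ball 0 1" for \<xi>
      using that SU[OF a] m(2) ma by (intro ne) auto
    ultimately show ?thesis unfolding g_def C_def by (intro holomorphic_intros) auto
  qed
  moreover have "g 0 = 0" by (simp add: g_def C_def S_def)
  ultimately have "norm (g (C a w)) \<le> norm (C a w)"
    using g1 C1[OF w a] by (intro Schwarz_Lemma(1)[of g]) auto
  hence "norm (C (m a) (m w)) \<le> norm (C a w)" unfolding g_def CS[OF w a] .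
  hence "norm (m w - m a) * norm (w - cnj a) \<le> norm (w - a) * norm (m w - cnj (m a))"
    unfolding C_def norm_divide using ne[OF w a] ne[OF mw ma] by (simp add: field_simps)
  hence "(norm (m w - m a) * norm (w - cnj a))\<^sup>2 \<le> (norm (w - a) * norm (m w - cnj (m a)))\<^sup>2"
    by (rule power_mono) auto
  thus ?thesis unfolding power_mult_distrib norm_diff_cnj by (simp add: algebra_simps)
qed

text \<open>Schwarz--Pick at \<open>i y\<close> as \<open>y\<close> tends to infinity.\<close>
lemma julia_UHP:
  assumes m: "m holomorphic_on UHP" "m ` UHP \<subseteq> UHP" and w: "w \<in> UHP"
    and lim: "((\<lambda>y::real. m (\<i> * y) - \<i> * y) \<longlongrightarrow> 0) at_top"
  shows "Im w \<le> Im (m w)"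
proof -
  define \<delta> where "\<delta> = (\<lambda>y::real. m (\<i> * y) - \<i> * y)"
  define r where "r = (\<lambda>y::real. complex_of_real (inverse y))"
  have r: "(r \<longlongrightarrow> 0) at_top"
    unfolding r_def using tendsto_of_real[OF tendsto_inverse_0_at_top[OF filterlim_ident], where 'a = complex] by simp
  have d: "(\<delta> \<longlongrightarrow> 0) at_top" using lim by (simp add: \<delta>_def)
  have "((\<lambda>y. (norm ((m w - \<delta> y) * r y - \<i>))\<^sup>2 * Im w) \<longlongrightarrow> (norm ((m w - 0) * 0 - \<i>))\<^sup>2 * Im w) at_top"
    by (intro tendsto_intros d r)
  moreover have "((\<lambda>y. (norm (w * r y - \<i>))\<^sup>2 * (Im (m w) * Im (\<delta> y * r y + \<i>)))
      \<longlongrightarrow> (norm (w * 0 - \<i>))\<^sup>2 * (Im (m w) * Im (0 * 0 + \<i>))) at_top"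
    by (intro tendsto_intros d r)
  moreover have "\<forall>\<^sub>F y in at_top. (norm ((m w - \<delta> y) * r y - \<i>))\<^sup>2 * Im w
      \<le> (norm (w * r y - \<i>))\<^sup>2 * (Im (m w) * Im (\<delta> y * r y + \<i>))"
    using eventually_gt_at_top[of 0]
  proof eventually_elim
    case (elim y)
    have U: "\<i> * y \<in> UHP" using elim by (simp add: UHP_def)
    have ry: "r y = 1 / of_real y" by (simp add: r_def field_simps)
    have 1: "(m w - \<delta> y) * r y - \<i> = (m w - m (\<i> * y)) / of_real y"
      using elim by (simp add: ry \<delta>_def field_simps)
    have 2: "w * r y - \<i> = (w - \<i> * y) / of_real y" using elim by (simp add: ry field_simps)
    have 3: "\<delta> y * r y + \<i> = m (\<i> * y) / of_real y"
      using elim by (simp add: ry \<delta>_def field_simps)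
    have "(norm (m w - m (\<i> * y)))\<^sup>2 * (Im w * Im (\<i> * y)) \<le> (norm (w - \<i> * y))\<^sup>2 * (Im (m w) * Im (m (\<i> * y)))"
      by (rule schwarz_pick_UHP[OF m U w])
    \<comment> \<open>Of the factor \<open>y ^ 3\<close>, the squared distance absorbs
      \<open>y ^ 2\<close> and the height of \<open>\<i> * y\<close> or of its image absorbs
      \<open>y\<close>, so both sides have finite limits: \<open>Im w\<close> and
      \<open>Im (m w)\<close>.\<close>
    hence "(norm (m w - m (\<i> * y)))\<^sup>2 * (Im w * y) / y ^ 3 \<le> (norm (w - \<i> * y))\<^sup>2 * (Im (m w) * Im (m (\<i> * y))) / y ^ 3"
      using elim by (intro divide_right_mono) auto
    thus ?case unfolding 1 2 3 Im_divide_of_real norm_divide power_divide norm_of_real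
      using elim by (simp add: power2_eq_square power3_eq_cube mult_ac)
  qed
  ultimately have "(norm ((m w - 0) * 0 - \<i>))\<^sup>2 * Im w \<le> (norm (w * 0 - \<i>))\<^sup>2 * (Im (m w) * Im (0 * 0 + \<i>))"
    by (intro tendsto_le[OF trivial_limit_at_top_linorder])
  thus ?thesis by simp
qed

text \<open>\<open>julia_UHP\<close> for \<open>m\<close> at \<open>w\<close> and for
  \<open>n\<close> at \<open>m w\<close> makes \<open>m\<close> preserve heights. So
  \<open>m w - w\<close> is a real-valued holomorphic function, constant by the open mapping
  theorem, and the constant is its limit 0.\<close>

lemma hydrodynamic_automorphism_id:
  assumes m: "m holomorphic_on UHP" "m ` UHP \<subseteq> UHP" and n: "n holomorphic_on UHP" "n ` UHP \<subseteq> UHP"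
    and nm: "\<And>w. w \<in> UHP \<Longrightarrow> n (m w) = w"
    and lm: "((\<lambda>y::real. m (\<i> * y) - \<i> * y) \<longlongrightarrow> 0) at_top"
    and ln: "((\<lambda>y::real. n (\<i> * y) - \<i> * y) \<longlongrightarrow> 0) at_top"
    and w: "w \<in> UHP"
  shows "m w = w"
proof -
  define f where "f = (\<lambda>w. m w - w)"
  have Im0: "Im (f z) = 0" if "z \<in> UHP" for z
    using julia_UHP[OF m that lm] julia_UHP[OF n _ ln, of "m z"] m(2) nm[OF that] that
    by (force simp: f_def)
  have fh: "f holomorphic_on UHP" unfolding f_def by (intro holomorphic_intros m)
  have "f constant_on UHP"
  proof (rule ccontr)
    assume "\<not> f constant_on UHP"
    hence "open (f ` UHP)"
      using open_mapping_thm[OF fh open_UHP connected_UHP open_UHP] by auto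
    then obtain e where "e > 0" "ball (f w) e \<subseteq> f ` UHP" using w open_contains_ball by blast
    moreover have "f w + \<i> * of_real (e/2) \<in> ball (f w) e" using \<open>e > 0\<close> by (simp add: dist_norm norm_mult)
    ultimately obtain z where "z \<in> UHP" "f w + \<i> * of_real (e/2) = f z" by blast
    hence "Im (f w + \<i> * of_real (e/2)) = 0" using Im0 by simp
    thus False using Im0[OF w] \<open>e > 0\<close> by simp
  qed
  then obtain c where c: "\<And>z. z \<in> UHP \<Longrightarrow> f z = c" by (auto simp: constant_on_def)
  have "\<forall>\<^sub>F y in at_top. m (\<i> * of_real y) - \<i> * y = c"
    using eventually_gt_at_top[of 0] by eventually_elim (use c in \<open>auto simp: f_def UHP_def\<close>)
  hence "((\<lambda>y::real. c) \<longlongrightarrow> 0) at_top" using lm by (simp cong: tendsto_cong)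
  hence "c = 0" by (simp add: tendsto_const_iff)
  thus ?thesis using c[OF w] by (simp add: f_def)
qed

text \<open>A chordal trajectory read backwards from its end point is a reverse trajectory for the
  reversed driver. Survival to time \<open>T\<close> thus means being a value of the reverse flow,
  which presents the domain as a conformal image of the half-plane.\<close>

lemma rflow_range:
  assumes T: "0 \<le> T" and W: "continuous_on {0..T} W"
  shows "chain_domain UHP (chordal W) T = rflow (\<lambda>s. W (T - s)) T ` UHP"
proof -
  define V where "V = (\<lambda>s. W (T - s))"
  have V: "continuous_on {0..T} V"
    unfolding V_def by (rule continuous_on_compose2[OF W]) (auto intro!: continuous_intros)
  have flip: "solves (\<lambda>s. g (T - s)) (\<lambda>s. - g' (T - s)) T" if "solves g g' T" for g :: "real \<Rightarrow> complex" and g'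
  proof
    fix s assume s: "s \<in> {0..T}"
    have "((\<lambda>s. T - s) has_vector_derivative - 1) (at s within {0..T})"
      by (auto intro!: derivative_eq_intros)
    from vector_diff_chain_within[OF this, of g "g' (T - s)"]
    show "((\<lambda>s. g (T - s)) has_vector_derivative - g' (T - s)) (at s within {0..T})"
      using s that by (auto simp: o_def)
  qed
  show ?thesis unfolding V_def[symmetric]
  proof (intro equalityI subsetI)
    fix z assume "z \<in> chain_domain UHP (chordal W) T"
    then obtain \<gamma> where g: "\<gamma> 0 = z" "\<forall>s\<in>{0..T}. \<gamma> s \<in> UHP" "solves \<gamma> (\<lambda>s. 2 / (\<gamma> s - of_real (W s))) T"
      by (auto simp: chain_domain_def)
    have "rsol V T (\<gamma> T) (\<lambda>s. \<gamma> (T - s))"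
      using flip[OF g(3)] g(2) unfolding rsol_def V_def by (auto simp: UHP_def)
    from rflow_eq[OF T V this] have "z = rflow V T (\<gamma> T)" using g(1) by simp
    moreover have "\<gamma> T \<in> UHP" using g(2) T by auto
    ultimately show "z \<in> rflow V T ` UHP" by blast
  next
    fix z assume "z \<in> rflow V T ` UHP"
    then obtain w where w: "w \<in> UHP" "z = rflow V T w" by blast
    obtain \<beta> where b: "rsol V T w \<beta>" using rsol_exists[OF T V] w(1) by (auto simp: UHP_def)
    have z: "z = \<beta> T" using rflow_eq[OF T V b] w by simp
    have "solves (\<lambda>s. \<beta> (T - s)) (\<lambda>s. 2 / (\<beta> (T - s) - of_real (W s))) T"
      using flip[OF rsol_solves[OF b]] by (simp add: V_def)
    moreover have "\<forall>s\<in>{0..T}. \<beta> (T - s) \<in> UHP" using b by (auto simp: rsol_def UHP_def)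
    moreover from this have "\<beta> T \<in> UHP" using T by force
    ultimately show "z \<in> chain_domain UHP (chordal W) T"
      unfolding chain_domain_def using T z by (auto intro!: exI[of _ "\<lambda>s. \<beta> (T - s)"])
  qed
qed

text \<open>The reverse flow never lowers a point and adds at most \<open>4 * T'\<close> to its
  squared height. Hence \<open>m (\<i> * y)\<close> has height at least \<open>y / 2\<close> for
  large \<open>y\<close>, and both flows displace the points concerned by
  \<open>O(1 / y)\<close>.\<close>

lemma rflow_transition_tendsto:
  assumes T: "0 \<le> T" and V: "continuous_on {0..T} V" and T': "0 \<le> T'" and V': "continuous_on {0..T'} V'"
    and m: "m ` UHP \<subseteq> UHP" "\<And>w. w \<in> UHP \<Longrightarrow> rflow V' T' (m w) = rflow V T w"
  shows "((\<lambda>y::real. m (\<i> * y) - \<i> * y) \<longlongrightarrow> 0) at_top"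
proof (rule Lim_null_comparison)
  show "((\<lambda>y::real. (4 * T' + 2 * T) * inverse y) \<longlongrightarrow> 0) at_top"
    using tendsto_mult_right_zero[OF tendsto_inverse_0_at_top[OF filterlim_ident]] .
  show "\<forall>\<^sub>F y in at_top. norm (m (\<i> * of_real y) - \<i> * y) \<le> (4 * T' + 2 * T) * inverse y"
    \<comment> \<open>With \<open>1 \<le> y\<close> and \<open>16 * T' \<le> y\<close>, the loss
      \<open>4 * T'\<close> is at most 3/4 of the squared height, which leaves
      \<open>(y / 2)^2\<close>.\<close>
    using eventually_ge_at_top[of "max 1 (16 * T')"]
  proof eventually_elim
    case (elim y)
    hence y: "1 \<le> y" "16 * T' \<le> y" by auto
    have U: "\<i> * y \<in> UHP" using y by (simp add: UHP_def)
    define q where "q = m (\<i> * of_real y)"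
    have qU: "q \<in> UHP" using m(1) U unfolding q_def by blast
    have "y \<le> Im (rflow V T (\<i> * y))" using rflow_Im[OF T V U] by simp
    hence "y\<^sup>2 \<le> (Im (rflow V T (\<i> * y)))\<^sup>2" using y by (intro power_mono) auto
    also have "\<dots> \<le> (Im q)\<^sup>2 + 4 * T'"
      using rflow_Im_sq[OF T' V' qU] m(2)[OF U] by (simp add: q_def)
    finally have "y\<^sup>2 - 4 * T' \<le> (Im q)\<^sup>2" by simp
    moreover have "4 * T' \<le> 3/4 * y\<^sup>2"
    proof -
      have "y * 1 \<le> y * y" using y by (intro mult_left_mono) auto
      hence "16 * T' \<le> y * y" using y(2) by linarith
      moreover have "0 \<le> y * y" by simp
      ultimately show ?thesis unfolding power2_eq_square by linarith
    qed
    ultimately have "(y/2)\<^sup>2 \<le> (Im q)\<^sup>2" by (simp add: power_divide)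
    hence Iq: "y/2 \<le> Im q" using qU by (intro power2_le_imp_le[of "y/2"]) (auto simp: UHP_def)
    have "norm (q - \<i> * y) \<le> norm (rflow V T (\<i> * y) - \<i> * y) + norm (rflow V' T' q - q)"
      using norm_triangle_ineq4[of "rflow V T (\<i> * y) - \<i> * y" "rflow V' T' q - q"] m(2)[OF U]
      by (simp add: q_def)
    also have "\<dots> \<le> 2 / y * T + 2 / (y/2) * T'"
    proof (rule add_mono)
      show "norm (rflow V T (\<i> * y) - \<i> * y) \<le> 2 / y * T" using rflow_dist[OF T V U] by simp
      have "norm (rflow V' T' q - q) \<le> 2 / Im q * T'" by (rule rflow_dist[OF T' V' qU])
      also have "\<dots> \<le> 2 / (y/2) * T'"
        using Iq y T' by (intro mult_right_mono divide_left_mono) auto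
      finally show "norm (rflow V' T' q - q) \<le> 2 / (y/2) * T'" .
    qed
    finally show ?case using y by (simp add: q_def field_simps)
  qed
qed

text \<open>Following one flow by the inverse of the other gives a self-map \<open>m\<close> of the
  half-plane whose inverse \<open>n\<close> arises the same way with the roles exchanged; both
  approach the identity along the imaginary axis.\<close>

lemma rflow_eq_on_if_same_range:
  assumes T: "0 \<le> T" and V: "continuous_on {0..T} V" and T': "0 \<le> T'" and V': "continuous_on {0..T'} V'"
    and eq: "rflow V T ` UHP = rflow V' T' ` UHP" and w: "w \<in> UHP"
  shows "rflow V T w = rflow V' T' w"
proof -
  define f f' where "f = rflow V T" and "f' = rflow V' T'"
  obtain g where g: "g holomorphic_on (f ` UHP)" "\<And>z. z \<in> UHP \<Longrightarrow> g (f z) = z"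
    using holomorphic_has_inverse[OF rflow_holomorphic[OF T V] open_UHP rflow_inj[OF T V]]
    unfolding f_def by metis
  obtain g' where g': "g' holomorphic_on (f' ` UHP)" "\<And>z. z \<in> UHP \<Longrightarrow> g' (f' z) = z"
    using holomorphic_has_inverse[OF rflow_holomorphic[OF T' V'] open_UHP rflow_inj[OF T' V']]
    unfolding f'_def by metis
  have eq': "f ` UHP = f' ` UHP" using eq by (simp add: f_def f'_def)
  have fg: "f (g z) = z" "g z \<in> UHP" if "z \<in> f ` UHP" for z using that g(2) by auto
  have fg': "f' (g' z) = z" "g' z \<in> UHP" if "z \<in> f' ` UHP" for z using that g'(2) by auto
  define m n where "m = (\<lambda>w. g' (f w))" and "n = (\<lambda>w. g (f' w))"
  have mU: "m ` UHP \<subseteq> UHP" unfolding m_def using fg' eq' by blast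
  have nU: "n ` UHP \<subseteq> UHP" unfolding n_def using fg eq' by blast
  have fm: "f' (m w) = f w" if "w \<in> UHP" for w unfolding m_def using fg' eq' that by blast
  have fn: "f (n w) = f' w" if "w \<in> UHP" for w unfolding n_def using fg eq' that by blast
  have nm: "n (m w) = w" if "w \<in> UHP" for w
    unfolding n_def fm[OF that] by (rule g(2)[OF that])
  have mh: "m holomorphic_on UHP"
    using holomorphic_on_compose_gen[OF rflow_holomorphic[OF T V] g'(1)] eq'
    unfolding m_def f_def f'_def by (auto simp: o_def)
  have nh: "n holomorphic_on UHP"
    using holomorphic_on_compose_gen[OF rflow_holomorphic[OF T' V'] g(1)] eq'
    unfolding n_def f_def f'_def by (auto simp: o_def)
  have "m w = w"
    using rflow_transition_tendsto[OF T V T' V' mU] rflow_transition_tendsto[OF T' V' T V nU] fm fn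
    by (intro hydrodynamic_automorphism_id[OF mh mU nh nU nm _ _ w]) (auto simp: f_def f'_def)
  thus ?thesis using fm[OF w] by (simp add: f_def f'_def)
qed

text \<open>The two times are not assumed equal. Equal domains make the reverse flows equal, and
  comparing the coefficients in \<open>rflow_expansion\<close> then identifies the times.\<close>

lemma chordal_domain_unique:
  assumes T: "0 \<le> T" and W: "continuous_on {0..T} W" and T': "0 \<le> T'" and W': "continuous_on {0..T'} W'"
    and eq: "chain_domain UHP (chordal W) T = chain_domain UHP (chordal W') T'"
  shows "T = T'" and "\<And>w. w \<in> UHP \<Longrightarrow> rflow (\<lambda>s. W (T - s)) T w = rflow (\<lambda>s. W' (T' - s)) T' w"
proof -
  define V V' where "V = (\<lambda>s. W (T - s))" and "V' = (\<lambda>s. W' (T' - s))"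
  have V: "continuous_on {0..T} V"
    unfolding V_def by (rule continuous_on_compose2[OF W]) (auto intro!: continuous_intros)
  have V': "continuous_on {0..T'} V'"
    unfolding V'_def by (rule continuous_on_compose2[OF W']) (auto intro!: continuous_intros)
  have "rflow V T ` UHP = rflow V' T' ` UHP"
    using eq unfolding rflow_range[OF T W] rflow_range[OF T' W'] V_def V'_def .
  from rflow_eq_on_if_same_range[OF T V T' V' this]
  show *: "rflow (\<lambda>s. W (T - s)) T w = rflow (\<lambda>s. W' (T' - s)) T' w" if "w \<in> UHP" for w
    using that by (simp add: V_def V'_def)
  obtain K K' where
    K: "\<And>y::real. y \<ge> 1 \<Longrightarrow> norm (\<i> * y * (rflow V T (\<i> * y) - \<i> * y) + 2 * of_real T) \<le> K / y" and
    K': "\<And>y::real. y \<ge> 1 \<Longrightarrow> norm (\<i> * y * (rflow V' T' (\<i> * y) - \<i> * y) + 2 * of_real T') \<le> K' / y"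
    using rflow_expansion[OF T V] rflow_expansion[OF T' V'] by metis
  have "((\<lambda>y. (K + K') * inverse y) \<longlongrightarrow> 0) at_top"
    using tendsto_mult_right_zero[OF tendsto_inverse_0_at_top[OF filterlim_ident]] .
  moreover have "\<forall>\<^sub>F y in at_top. norm (2 * of_real T - 2 * of_real T' :: complex) \<le> (K + K') * inverse y"
    using eventually_ge_at_top[of 1]
  proof eventually_elim
    case (elim y)
    have "\<i> * y \<in> UHP" using elim by (simp add: UHP_def)
    from *[OF this] have e: "rflow V T (\<i> * y) = rflow V' T' (\<i> * y)" by (simp add: V_def V'_def)
    define c where "c = \<i> * y * (rflow V T (\<i> * y) - \<i> * y)"
    have "norm ((c + 2 * of_real T) - (c + 2 * of_real T')) \<le> norm (c + 2 * of_real T) + norm (c + 2 * of_real T')"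
      by (rule norm_triangle_ineq4)
    also have "\<dots> \<le> K / y + K' / y" using K[OF elim] K'[OF elim] unfolding c_def e by (rule add_mono)
    finally show ?case by (simp add: divide_inverse distrib_right)
  qed
  ultimately have "norm (2 * of_real T - 2 * of_real T' :: complex) \<le> 0"
    by (rule tendsto_lowerbound) auto
  hence "2 * of_real T = (2 * of_real T' :: complex)" by simp
  thus "T = T'" by simp
qed

text \<open>A single surviving point is followed. At each time the two reverse flows are the same
  injective map and take both current positions back to the starting point. So the positions agree,
  and the velocity \<open>2 / (\<gamma> s - W s)\<close> determines \<open>W s\<close>.\<close>

lemma chordal_driver_unique:
  assumes T: "0 < T" and W: "continuous_on {0..T} W" and W': "continuous_on {0..T} W'"
    and eq: "\<And>s. s \<in> {0..T} \<Longrightarrow> chain_domain UHP (chordal W) s = chain_domain UHP (chordal W') s"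
    and s: "s \<in> {0..T}"
  shows "W s = W' s"
proof -
  \<comment> \<open>Any point of the half-plane would do in place of \<open>\<i>\<close>; its image
    under the reverse flow is a point that survives to time \<open>T\<close>.\<close>
  have "rflow (\<lambda>s. W (T - s)) T \<i> \<in> chain_domain UHP (chordal W) T"
    using rflow_range[of T W] T W by (auto simp: UHP_def)
  then obtain z where z: "z \<in> chain_domain UHP (chordal W) T" "z \<in> chain_domain UHP (chordal W') T"
    using eq[of T] T by auto
  then obtain \<gamma> \<gamma>' where
    g: "\<gamma> 0 = z" "\<forall>s\<in>{0..T}. \<gamma> s \<in> UHP" "solves \<gamma> (\<lambda>s. 2 / (\<gamma> s - of_real (W s))) T" and
    g': "\<gamma>' 0 = z" "\<forall>s\<in>{0..T}. \<gamma>' s \<in> UHP" "solves \<gamma>' (\<lambda>s. 2 / (\<gamma>' s - of_real (W' s))) T"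
    by (auto simp: chain_domain_def)
  have val: "rflow (\<lambda>s. W (t - s)) t (\<gamma> t) = z"
    if t: "t \<in> {0..T}" and W: "continuous_on {0..T} W" and g: "\<gamma> 0 = z" "\<forall>s\<in>{0..T}. \<gamma> s \<in> UHP"
      "solves \<gamma> (\<lambda>s. 2 / (\<gamma> s - of_real (W s))) T" for t W \<gamma>
  proof -
    have t0: "0 \<le> t" and sub: "{0..t} \<subseteq> {0..T}" using t by auto
    have Wt: "continuous_on {0..t} W" using W sub by (rule continuous_on_subset)
    have V: "continuous_on {0..t} (\<lambda>s. W (t - s))"
      by (rule continuous_on_compose2[OF Wt]) (auto intro!: continuous_intros)
    have "solves \<gamma> (\<lambda>s. 2 / (\<gamma> s - of_real (W s))) t" using solves_mono[OF g(3)] t by auto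
    hence "solves (\<lambda>s. \<gamma> (t - s)) (\<lambda>s. - 2 / (\<gamma> (t - s) - of_real (W (t - s)))) t"
    proof (intro ballI)
      fix s assume s: "s \<in> {0..t}" and S: "solves \<gamma> (\<lambda>s. 2 / (\<gamma> s - of_real (W s))) t"
      have "((\<lambda>s. t - s) has_vector_derivative - 1) (at s within {0..t})"
        by (auto intro!: derivative_eq_intros)
      from vector_diff_chain_within[OF this, of \<gamma> "2 / (\<gamma> (t - s) - of_real (W (t - s)))"]
      show "((\<lambda>s. \<gamma> (t - s)) has_vector_derivative - 2 / (\<gamma> (t - s) - of_real (W (t - s)))) (at s within {0..t})"
        using s S by (auto simp: o_def)
    qed
    hence "rsol (\<lambda>s. W (t - s)) t (\<gamma> t) (\<lambda>s. \<gamma> (t - s))"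
      using g(2) t unfolding rsol_def by (auto simp: UHP_def)
    from rflow_eq[OF t0 V this] g(1) show ?thesis by simp
  qed
  have "\<gamma> t = \<gamma>' t" if t: "t \<in> {0..T}" for t
  proof -
    have t0: "0 \<le> t" and sub: "{0..t} \<subseteq> {0..T}" using t by auto
    have Wt: "continuous_on {0..t} W" "continuous_on {0..t} W'"
      using W W' sub by (auto intro: continuous_on_subset)
    have V: "continuous_on {0..t} (\<lambda>s. W (t - s))"
      by (rule continuous_on_compose2[OF Wt(1)]) (auto intro!: continuous_intros)
    have U: "\<gamma> t \<in> UHP" "\<gamma>' t \<in> UHP" using g(2) g'(2) t by auto
    have "rflow (\<lambda>s. W (t - s)) t (\<gamma> t) = rflow (\<lambda>s. W' (t - s)) t (\<gamma>' t)"
      using val[OF t W g] val[OF t W' g'] by simp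
    also have "\<dots> = rflow (\<lambda>s. W (t - s)) t (\<gamma>' t)"
      using chordal_domain_unique(2)[OF t0 Wt(1) t0 Wt(2) eq[OF t] U(2)] by simp
    finally show ?thesis using rflow_inj[OF t0 V] U by (auto dest: inj_onD)
  qed
  hence gg: "\<gamma> t = \<gamma>' t" if "t \<in> {0..T}" for t using that .
  have "solves \<gamma> (\<lambda>s. 2 / (\<gamma>' s - of_real (W' s))) T"
  proof
    fix t assume t: "t \<in> {0..T}"
    show "(\<gamma> has_vector_derivative 2 / (\<gamma>' t - of_real (W' t))) (at t within {0..T})"
      using g'(3) t gg by (auto intro: has_vector_derivative_transform)
  qed
  from solves_derivative_unique[OF g(3) this T s]
  have "2 / (\<gamma> s - of_real (W s)) = 2 / (\<gamma> s - of_real (W' s))" using gg[OF s] by simp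
  moreover have "Im (\<gamma> s) > 0" using g(2) s by (auto simp: UHP_def)
  hence "\<gamma> s - of_real (W s) \<noteq> 0" "\<gamma> s - of_real (W' s) \<noteq> 0"
    using Im_pos_ne_of_real by blast+
  ultimately show ?thesis by (simp add: field_simps)
qed

section \<open>Conjugating a slit chain in the half-plane to a chordal chain\<close>

text \<open>A chart of the real Moebius group around the identity, which is
  \<open>\<rho> = 0\<close>, \<open>k = 1\<close>, \<open>\<beta> = 0\<close>. Here
  \<open>\<beta>\<close> is the image of 0, \<open>k\<close> the derivative at 0 and
  \<open>1 / \<rho>\<close> the point sent to infinity.\<close>

definition mob :: "real \<Rightarrow> real \<Rightarrow> real \<Rightarrow> complex \<Rightarrow> complex" where
  "mob \<rho> k \<beta> w = of_real k * w / (1 - of_real \<rho> * w) + of_real \<beta>"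

lemma one_minus_real_mult_ne_0: "Im w > 0 \<Longrightarrow> 1 - of_real \<rho> * w \<noteq> 0"
  by (cases "\<rho> = 0") (auto simp: complex_eq_iff)

lemma mob_UHP:
  assumes "0 < k" "w \<in> UHP" shows "mob \<rho> k \<beta> w \<in> UHP"
proof -
  have ne: "1 - of_real \<rho> * w \<noteq> 0" using assms one_minus_real_mult_ne_0 by (auto simp: UHP_def)
  have "of_real k * w / (1 - of_real \<rho> * w)
      = (of_real k * w * cnj (1 - of_real \<rho> * w)) / of_real ((norm (1 - of_real \<rho> * w))\<^sup>2)"
    by (subst complex_div_cnj) (simp flip: complex_norm_square)
  hence "Im (mob \<rho> k \<beta> w) = Im (of_real k * w * cnj (1 - of_real \<rho> * w)) / (norm (1 - of_real \<rho> * w))\<^sup>2"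
    unfolding mob_def by (simp only: Im_divide_of_real plus_complex.sel Im_complex_of_real add_0_right)
  also have "Im (of_real k * w * cnj (1 - of_real \<rho> * w)) = k * Im w"
    by (simp add: algebra_simps)
  finally show ?thesis using assms ne by (simp add: UHP_def)
qed

definition mob_inv :: "real \<Rightarrow> real \<Rightarrow> real \<Rightarrow> complex \<Rightarrow> complex" where
  "mob_inv \<rho> k \<beta> v = mob (- \<rho>) 1 0 (of_real (1 / k) * (v - of_real \<beta>))"

lemma mob_inv_UHP:
  assumes "0 < k" "v \<in> UHP" shows "mob_inv \<rho> k \<beta> v \<in> UHP"
  unfolding mob_inv_def by (rule mob_UHP) (use assms in \<open>auto simp: UHP_def\<close>)

lemma mob_mob_inv:
  assumes "0 < k" "v \<in> UHP" shows "mob \<rho> k \<beta> (mob_inv \<rho> k \<beta> v) = v"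
proof -
  define z where "z = of_real (1 / k) * (v - of_real \<beta>)"
  have "Im z > 0" using assms by (auto simp: UHP_def z_def)
  from one_minus_real_mult_ne_0[OF this, of "- \<rho>"]
  have ne: "1 + of_real \<rho> * z \<noteq> 0" by simp
  have i: "mob_inv \<rho> k \<beta> v = z / (1 + of_real \<rho> * z)"
    by (simp add: mob_inv_def mob_def z_def)
  have "1 - of_real \<rho> * (z / (1 + of_real \<rho> * z)) = 1 / (1 + of_real \<rho> * z)"
    using ne by (simp add: field_simps)
  hence "mob \<rho> k \<beta> (mob_inv \<rho> k \<beta> v) = of_real k * z + of_real \<beta>"
    using ne unfolding i mob_def by simp
  also have "\<dots> = v" using assms by (simp add: z_def)
  finally show ?thesis .
qed

lemma mob_has_vector_derivative:
  assumes r: "(\<rho> has_vector_derivative \<rho>') (at \<theta> within S)"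
    and k: "(k has_vector_derivative k') (at \<theta> within S)"
    and b: "(\<beta> has_vector_derivative \<beta>') (at \<theta> within S)"
    and g: "(\<gamma> has_vector_derivative v) (at \<theta> within S)"
    and ne: "1 - of_real (\<rho> \<theta>) * \<gamma> \<theta> \<noteq> 0"
  shows "((\<lambda>\<theta>. mob (\<rho> \<theta>) (k \<theta>) (\<beta> \<theta>) (\<gamma> \<theta>)) has_vector_derivative
    ((of_real k' * \<gamma> \<theta> + of_real (k \<theta>) * v) / (1 - of_real (\<rho> \<theta>) * \<gamma> \<theta>)
     + of_real (k \<theta>) * \<gamma> \<theta> * (of_real \<rho>' * \<gamma> \<theta> + of_real (\<rho> \<theta>) * v) / (1 - of_real (\<rho> \<theta>) * \<gamma> \<theta>)\<^sup>2
     + of_real \<beta>')) (at \<theta> within S)"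
proof -
  define q where "q = (\<lambda>\<theta>. 1 - of_real (\<rho> \<theta>) * \<gamma> \<theta>)"
  have qq: "1 - of_real (\<rho> \<theta>) * \<gamma> \<theta> = q \<theta>" for \<theta> by (simp add: q_def)
  have ofr: "((\<lambda>x. complex_of_real (f x)) has_vector_derivative complex_of_real f') (at \<theta> within S)"
    if "(f has_vector_derivative f') (at \<theta> within S)" for f f'
    using bounded_linear.has_vector_derivative[OF bounded_linear_of_real that] .
  have q: "(q has_vector_derivative - (of_real (\<rho> \<theta>) * v + of_real \<rho>' * \<gamma> \<theta>)) (at \<theta> within S)"
    unfolding q_def using has_vector_derivative_diff[OF has_vector_derivative_const has_vector_derivative_mult[OF ofr[OF r] g]]
    by simp
  have qi: "((\<lambda>\<theta>. inverse (q \<theta>)) has_vector_derivative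
      - (of_real (\<rho> \<theta>) * v + of_real \<rho>' * \<gamma> \<theta>) * - (inverse (q \<theta>) ^ Suc (Suc 0))) (at \<theta> within S)"
    using field_vector_diff_chain_within[OF q DERIV_inverse] ne by (simp add: o_def q_def)
  have "((\<lambda>\<theta>. of_real (k \<theta>) * \<gamma> \<theta> * inverse (q \<theta>) + of_real (\<beta> \<theta>)) has_vector_derivative
     (of_real (k \<theta>) * \<gamma> \<theta> * (- (of_real (\<rho> \<theta>) * v + of_real \<rho>' * \<gamma> \<theta>) * - (inverse (q \<theta>) ^ Suc (Suc 0)))
      + (of_real (k \<theta>) * v + of_real k' * \<gamma> \<theta>) * inverse (q \<theta>)) + of_real \<beta>') (at \<theta> within S)"
    by (intro has_vector_derivative_add has_vector_derivative_mult ofr r k b g qi)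
  also have "(\<lambda>\<theta>. of_real (k \<theta>) * \<gamma> \<theta> * inverse (q \<theta>) + of_real (\<beta> \<theta>)) = (\<lambda>\<theta>. mob (\<rho> \<theta>) (k \<theta>) (\<beta> \<theta>) (\<gamma> \<theta>))"
    by (simp add: mob_def q_def divide_inverse)
  finally show ?thesis
    by (rule has_vector_derivative_eq_rhs)
       (simp only: qq, simp add: divide_inverse power2_eq_square algebra_simps)
qed

subsection \<open>Bounded Lipschitz families\<close>

text \<open>Uniformly in the first argument, these functions form a class closed under sums,
  products and division by members bounded away from 0. Lipschitz bounds for the explicit rational
  right-hand sides then follow the shape of the formulas.\<close>

definition blip :: "'i set \<Rightarrow> 'z::real_normed_vector set \<Rightarrow> ('i \<Rightarrow> 'z \<Rightarrow> real) \<Rightarrow> bool" where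
  "blip I S f \<longleftrightarrow> (\<exists>B\<ge>0. \<forall>t\<in>I. \<forall>z\<in>S. \<bar>f t z\<bar> \<le> B \<and> (\<forall>z'\<in>S. \<bar>f t z - f t z'\<bar> \<le> B * norm (z - z')))"

lemma blipI:
  assumes "\<And>t z. t \<in> I \<Longrightarrow> z \<in> S \<Longrightarrow> \<bar>f t z\<bar> \<le> A"
    and "\<And>t z z'. t \<in> I \<Longrightarrow> z \<in> S \<Longrightarrow> z' \<in> S \<Longrightarrow> \<bar>f t z - f t z'\<bar> \<le> B * norm (z - z')"
  shows "blip I S f"
  unfolding blip_def
proof (intro exI[of _ "max 0 (max A B)"] conjI ballI)
  fix t z assume t: "t \<in> I" "z \<in> S"
  show "\<bar>f t z\<bar> \<le> max 0 (max A B)" using assms(1)[OF t] by linarith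
  fix z' assume "z' \<in> S"
  from assms(2)[OF t this]
  show "\<bar>f t z - f t z'\<bar> \<le> max 0 (max A B) * norm (z - z')"
    by (rule order_trans) (intro mult_right_mono; simp)
qed simp

lemma blipE:
  assumes "blip I S f"
  obtains B where "B \<ge> 0" "\<And>t z. t \<in> I \<Longrightarrow> z \<in> S \<Longrightarrow> \<bar>f t z\<bar> \<le> B"
    "\<And>t z z'. t \<in> I \<Longrightarrow> z \<in> S \<Longrightarrow> z' \<in> S \<Longrightarrow> \<bar>f t z - f t z'\<bar> \<le> B * norm (z - z')"
  using assms unfolding blip_def by blast

lemma blip_param: "(\<And>t. t \<in> I \<Longrightarrow> \<bar>g t\<bar> \<le> A) \<Longrightarrow> blip I S (\<lambda>t z. g t)"
  by (rule blipI[where B = 0]) auto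

lemma blip_const: "blip I S (\<lambda>t z. c)"
  by (rule blip_param[of _ _ "\<bar>c\<bar>"]) auto

lemma blip_linear:
  assumes l: "bounded_linear l" and S: "bounded S"
  shows "blip I S (\<lambda>t z. l z)"
proof -
  interpret bounded_linear l by (rule l)
  obtain K where K: "\<And>z. norm (l z) \<le> norm z * K" using bounded by blast
  have "bounded (l ` S)" by (rule bounded_linear_image[OF S l])
  then obtain A where "\<forall>x\<in>l ` S. norm x \<le> A" unfolding bounded_iff by blast
  moreover have "\<bar>l z - l z'\<bar> \<le> K * norm (z - z')" for z z'
    using K[of "z - z'"] by (simp add: diff mult.commute)
  ultimately show ?thesis by (intro blipI[where A = A and B = K]) auto
qed

lemma blip_add:
  assumes "blip I S f" "blip I S g" shows "blip I S (\<lambda>t z. f t z + g t z)"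
proof -
  obtain A where A: "\<And>t z. t \<in> I \<Longrightarrow> z \<in> S \<Longrightarrow> \<bar>f t z\<bar> \<le> A"
    "\<And>t z z'. t \<in> I \<Longrightarrow> z \<in> S \<Longrightarrow> z' \<in> S \<Longrightarrow> \<bar>f t z - f t z'\<bar> \<le> A * norm (z - z')"
    using assms(1) by (rule blipE) blast
  obtain B where B: "\<And>t z. t \<in> I \<Longrightarrow> z \<in> S \<Longrightarrow> \<bar>g t z\<bar> \<le> B"
    "\<And>t z z'. t \<in> I \<Longrightarrow> z \<in> S \<Longrightarrow> z' \<in> S \<Longrightarrow> \<bar>g t z - g t z'\<bar> \<le> B * norm (z - z')"
    using assms(2) by (rule blipE) blast
  show ?thesis
  proof (rule blipI)
    fix t z z' assume z: "t \<in> I" "z \<in> S" "z' \<in> S"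
    show "\<bar>f t z + g t z\<bar> \<le> A + B" using A(1)[OF z(1,2)] B(1)[OF z(1,2)] by linarith
    show "\<bar>f t z + g t z - (f t z' + g t z')\<bar> \<le> (A + B) * norm (z - z')"
      using A(2)[OF z] B(2)[OF z] unfolding distrib_right by linarith
  qed
qed

lemma blip_mult:
  assumes "blip I S f" "blip I S g" shows "blip I S (\<lambda>t z. f t z * g t z)"
proof -
  obtain A where A: "A \<ge> 0" "\<And>t z. t \<in> I \<Longrightarrow> z \<in> S \<Longrightarrow> \<bar>f t z\<bar> \<le> A"
    "\<And>t z z'. t \<in> I \<Longrightarrow> z \<in> S \<Longrightarrow> z' \<in> S \<Longrightarrow> \<bar>f t z - f t z'\<bar> \<le> A * norm (z - z')"
    using assms(1) by (rule blipE) blast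
  obtain B where B: "B \<ge> 0" "\<And>t z. t \<in> I \<Longrightarrow> z \<in> S \<Longrightarrow> \<bar>g t z\<bar> \<le> B"
    "\<And>t z z'. t \<in> I \<Longrightarrow> z \<in> S \<Longrightarrow> z' \<in> S \<Longrightarrow> \<bar>g t z - g t z'\<bar> \<le> B * norm (z - z')"
    using assms(2) by (rule blipE) blast
  show ?thesis
  proof (rule blipI)
    fix t z z' assume z: "t \<in> I" "z \<in> S" "z' \<in> S"
    show "\<bar>f t z * g t z\<bar> \<le> A * B"
      unfolding abs_mult using A B z by (intro mult_mono) auto
    have "f t z * g t z - f t z' * g t z' = f t z * (g t z - g t z') + (f t z - f t z') * g t z'"
      by (simp add: algebra_simps)
    hence "\<bar>f t z * g t z - f t z' * g t z'\<bar> \<le> \<bar>f t z\<bar> * \<bar>g t z - g t z'\<bar> + \<bar>f t z - f t z'\<bar> * \<bar>g t z'\<bar>"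
      by (metis abs_mult abs_triangle_ineq)
    also have "\<dots> \<le> A * (B * norm (z - z')) + (A * norm (z - z')) * B"
      using A B z by (intro add_mono mult_mono) auto
    finally show "\<bar>f t z * g t z - f t z' * g t z'\<bar> \<le> (2 * A * B) * norm (z - z')" by (simp add: mult_ac)
  qed
qed

lemma blip_inverse:
  assumes g: "blip I S g" and e: "0 < e" "\<And>t z. t \<in> I \<Longrightarrow> z \<in> S \<Longrightarrow> e \<le> \<bar>g t z\<bar>"
  shows "blip I S (\<lambda>t z. inverse (g t z))"
proof -
  obtain B where B: "B \<ge> 0" "\<And>t z. t \<in> I \<Longrightarrow> z \<in> S \<Longrightarrow> \<bar>g t z\<bar> \<le> B"
    "\<And>t z z'. t \<in> I \<Longrightarrow> z \<in> S \<Longrightarrow> z' \<in> S \<Longrightarrow> \<bar>g t z - g t z'\<bar> \<le> B * norm (z - z')"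
    using g by (rule blipE) blast
  show ?thesis
  proof (rule blipI)
    fix t z z' assume z: "t \<in> I" "z \<in> S" "z' \<in> S"
    have n: "e \<le> \<bar>g t z\<bar>" "e \<le> \<bar>g t z'\<bar>" using e z by auto
    show "\<bar>inverse (g t z)\<bar> \<le> inverse e" using n e by (simp add: le_imp_inverse_le)
    have "inverse (g t z) - inverse (g t z') = (g t z' - g t z) / (g t z * g t z')"
      using n e by (auto simp: field_simps)
    hence "\<bar>inverse (g t z) - inverse (g t z')\<bar> = \<bar>g t z - g t z'\<bar> / (\<bar>g t z\<bar> * \<bar>g t z'\<bar>)"
      by (simp add: abs_mult abs_minus_commute)
    also have "\<dots> \<le> (B * norm (z - z')) / (e * e)"
      using n e B z by (intro frac_le mult_mono) auto
    finally show "\<bar>inverse (g t z) - inverse (g t z')\<bar> \<le> (B / (e * e)) * norm (z - z')" by simp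
  qed
qed

lemma blip_minus: "blip I S f \<Longrightarrow> blip I S (\<lambda>t z. - f t z)"
  using blip_mult[OF blip_const[of I S "-1"], of f] by simp

lemma blip_diff: "blip I S f \<Longrightarrow> blip I S g \<Longrightarrow> blip I S (\<lambda>t z. f t z - g t z)"
  using blip_add[OF _ blip_minus, of I S f g] by simp

lemma blip_power: "blip I S f \<Longrightarrow> blip I S (\<lambda>t z. f t z ^ n)"
  by (induction n) (auto intro: blip_const blip_mult)

lemma blip_divide:
  assumes "blip I S f" "blip I S g" "0 < e" "\<And>t z. t \<in> I \<Longrightarrow> z \<in> S \<Longrightarrow> e \<le> \<bar>g t z\<bar>"
  shows "blip I S (\<lambda>t z. f t z / g t z)"
  unfolding divide_inverse by (intro blip_mult assms(1) blip_inverse[OF assms(2-4)])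

lemmas blip_intros = blip_const blip_add blip_minus blip_diff blip_mult blip_power

lemma blip_Pair_lipschitz:
  assumes "blip I S f" "blip I S g" "blip I S h"
  shows "\<exists>L>0. \<forall>t\<in>I. \<forall>z\<in>S. \<forall>z'\<in>S.
    norm ((f t z, g t z, h t z) - (f t z', g t z', h t z')) \<le> L * norm (z - z')"
proof -
  obtain A where A: "A \<ge> 0"
    "\<And>t z z'. t \<in> I \<Longrightarrow> z \<in> S \<Longrightarrow> z' \<in> S \<Longrightarrow> \<bar>f t z - f t z'\<bar> \<le> A * norm (z - z')"
    using assms(1) by (rule blipE) blast
  obtain B where B: "B \<ge> 0"
    "\<And>t z z'. t \<in> I \<Longrightarrow> z \<in> S \<Longrightarrow> z' \<in> S \<Longrightarrow> \<bar>g t z - g t z'\<bar> \<le> B * norm (z - z')"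
    using assms(2) by (rule blipE) blast
  obtain C where C: "C \<ge> 0"
    "\<And>t z z'. t \<in> I \<Longrightarrow> z \<in> S \<Longrightarrow> z' \<in> S \<Longrightarrow> \<bar>h t z - h t z'\<bar> \<le> C * norm (z - z')"
    using assms(3) by (rule blipE) blast
  have "norm ((f t z, g t z, h t z) - (f t z', g t z', h t z')) \<le> (A + B + C + 1) * norm (z - z')"
    if z: "t \<in> I" "z \<in> S" "z' \<in> S" for t z z'
  proof -
    have "norm ((f t z, g t z, h t z) - (f t z', g t z', h t z'))
        \<le> \<bar>f t z - f t z'\<bar> + (\<bar>g t z - g t z'\<bar> + \<bar>h t z - h t z'\<bar>)"
      using norm_Pair_le[of "f t z - f t z'" "(g t z - g t z', h t z - h t z')"]
        norm_Pair_le[of "g t z - g t z'" "h t z - h t z'"] by simp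
    also have "\<dots> \<le> A * norm (z - z') + (B * norm (z - z') + C * norm (z - z'))"
      using A(2)[OF z] B(2)[OF z] C(2)[OF z] by linarith
    also have "\<dots> \<le> (A + B + C + 1) * norm (z - z')" by (simp add: algebra_simps)
    finally show ?thesis .
  qed
  thus ?thesis using A(1) B(1) C(1) by (intro exI[of _ "A + B + C + 1"]) auto
qed

section \<open>The coefficients of the conjugation and the chordal clock\<close>

text \<open>In the half-plane, \<open>A x z = ((1 + s0 x) z + x) / (1 - s1 x z)\<close> runs through the group generated
  by \<open>p z = 1 + s0 z + s1 z\<^sup>2\<close> and is parametrised by \<open>x = A x 0\<close>; \<open>F x\<close> is the Loewner
  field \<open>A x\<close>-pushed forward, expanded at its pole \<open>x\<close>.

  With \<open>K w = K0 + K1 w + e2 w\<^sup>2 = e0 + e1 (w - x) + e2 (w - x)\<^sup>2\<close>, the sum \<open>K + F x\<close> is the pullback under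
  \<open>mob \<rho> k \<beta>\<close> of \<open>speed / (w - drv)\<close>; here \<open>nn\<close> is the nonlinearity of that map at \<open>x\<close>. The right-hand
  side \<open>RF\<close> makes \<open>K\<close> the pullback of the time derivative of the Moebius map.\<close>

locale slit_coeffs =
  fixes bm1 b0 b1 s0 s1 :: real
begin

definition p :: "real \<Rightarrow> real" where "p x = 1 + s0 * x + s1 * x\<^sup>2"
text \<open>Chosen so that \<open>p x\<close> stays above 1/2 for \<open>x\<close> up to
  \<open>\<eta>\<close> in absolute value. The factor 10 in \<open>r\<close> leaves room to recover
  the pole from the chordal driver, see \<open>pole_bounds\<close>.\<close>

definition \<eta> :: real where "\<eta> = 1 / (2 * (1 + \<bar>s0\<bar> + \<bar>s1\<bar>))"
definition r :: real where "r = \<eta> / 10"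
text \<open>\<open>cc\<close>, \<open>a0\<close>, \<open>a1\<close>, \<open>a2\<close> are the
  Laurent coefficients at the pole obtained by expanding \<open>F_eq_pullback\<close>. The pullback
  divides everything by \<open>p x\<close>; only in \<open>a2\<close> does the division fail to
  cancel.\<close>

definition cc :: "real \<Rightarrow> real" where "cc x = 2 * (p x)\<^sup>2"
definition a0 :: "real \<Rightarrow> real" where "a0 x = 6 * p x * s1 * x + bm1 * p x"
definition a1 :: "real \<Rightarrow> real" where "a1 x = 6 * s1\<^sup>2 * x\<^sup>2 + 2 * bm1 * s1 * x + b0"
definition a2 :: "real \<Rightarrow> real" where
  "a2 x = (2 * s1 ^ 3 * x ^ 3 + bm1 * s1\<^sup>2 * x\<^sup>2 + b0 * s1 * x + b1) / p x"

definition F :: "real \<Rightarrow> complex \<Rightarrow> complex" where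
  "F x w = of_real (cc x) / (w - of_real x) + of_real (a0 x) + of_real (a1 x) * (w - of_real x)
     + of_real (a2 x) * (w - of_real x)\<^sup>2"

definition nn :: "real \<Rightarrow> real \<Rightarrow> real" where "nn x \<rho> = \<rho> / (1 - \<rho> * x)"
text \<open>In terms of \<open>v = w - x\<close> the desired pullback is
  \<open>cc x * (1 - nn x \<rho> * v) ^ 3 / v\<close>. Expanding the cube and subtracting the
  coefficients of \<open>F\<close> gives \<open>e0\<close>, \<open>e1\<close>, \<open>e2\<close>;
  the poles cancel. \<open>K0\<close> and \<open>K1\<close> recentre the remaining quadratic at
  0.\<close>

definition e0 :: "real \<Rightarrow> real \<Rightarrow> real" where "e0 x \<rho> = - 3 * nn x \<rho> * cc x - a0 x"
definition e1 :: "real \<Rightarrow> real \<Rightarrow> real" where "e1 x \<rho> = 3 * (nn x \<rho>)\<^sup>2 * cc x - a1 x"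
definition e2 :: "real \<Rightarrow> real \<Rightarrow> real" where "e2 x \<rho> = - (nn x \<rho> ^ 3) * cc x - a2 x"
definition K0 :: "real \<Rightarrow> real \<Rightarrow> real" where "K0 x \<rho> = e0 x \<rho> - e1 x \<rho> * x + e2 x \<rho> * x\<^sup>2"
definition K1 :: "real \<Rightarrow> real \<Rightarrow> real" where "K1 x \<rho> = e1 x \<rho> - 2 * e2 x \<rho> * x"

text \<open>Comparing powers of \<open>w\<close> in the requirement that the time derivative of
  \<open>mob \<rho> k \<beta> w\<close> be \<open>k / (1 - \<rho> * w)^2\<close> times
  \<open>K w\<close>: the constant term gives \<open>R3\<close>, the linear one then
  \<open>R2\<close>, the quadratic one then \<open>R1\<close>.\<close>

definition R1 :: "real \<Rightarrow> real \<Rightarrow> real" where "R1 x \<rho> = e2 x \<rho> + \<rho> * K1 x \<rho> + \<rho>\<^sup>2 * K0 x \<rho>"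
definition R2 :: "real \<Rightarrow> real \<Rightarrow> real \<Rightarrow> real" where "R2 x \<rho> k = k * (K1 x \<rho> + 2 * \<rho> * K0 x \<rho>)"
definition R3 :: "real \<Rightarrow> real \<Rightarrow> real \<Rightarrow> real" where "R3 x \<rho> k = k * K0 x \<rho>"
definition RF :: "real \<Rightarrow> real \<times> real \<times> real \<Rightarrow> real \<times> real \<times> real" where
  "RF x \<zeta> = (R1 x (fst \<zeta>), R2 x (fst \<zeta>) (fst (snd \<zeta>)), R3 x (fst \<zeta>) (fst (snd \<zeta>)))"

text \<open>With \<open>M\<close> the Moebius map, \<open>drv\<close> is \<open>M x\<close>. A pole
  with residue \<open>c\<close> at \<open>x\<close> is carried to one with residue \<open>c\<close>
  times the square of the derivative of \<open>M\<close> at \<open>x\<close>, which is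
  \<open>speed\<close>.\<close>

definition drv :: "real \<Rightarrow> real \<times> real \<times> real \<Rightarrow> real" where
  "drv x \<zeta> = fst (snd \<zeta>) * x / (1 - fst \<zeta> * x) + snd (snd \<zeta>)"
definition speed :: "real \<Rightarrow> real \<times> real \<times> real \<Rightarrow> real" where
  "speed x \<zeta> = cc x * (fst (snd \<zeta>) / (1 - fst \<zeta> * x)\<^sup>2)\<^sup>2"

abbreviation \<zeta>0 :: "real \<times> real \<times> real" where "\<zeta>0 \<equiv> (0, 1, 0)"
abbreviation Z :: "(real \<times> real \<times> real) set" where "Z \<equiv> cball \<zeta>0 r"

lemma \<eta>_bounds: "0 < \<eta>" "\<eta> \<le> 1/2" and r_bounds: "0 < r" "r \<le> 1/20"
proof -
  show e: "0 < \<eta>" "\<eta> \<le> 1/2" unfolding \<eta>_def by (auto simp: divide_simps)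
  show "0 < r" "r \<le> 1/20" using e by (auto simp: r_def)
qed

lemma p_ge:
  assumes "\<bar>x\<bar> \<le> \<eta>" shows "1/2 \<le> p x"
proof -
  have s: "0 < 1 + \<bar>s0\<bar> + \<bar>s1\<bar>" by linarith
  have "\<bar>s0 * x\<bar> \<le> \<bar>s0\<bar> * \<eta>" unfolding abs_mult using assms by (intro mult_left_mono) auto
  moreover have "\<bar>s1 * x\<^sup>2\<bar> \<le> \<bar>s1\<bar> * \<eta>"
  proof -
    have "\<bar>x\<bar> * \<bar>x\<bar> \<le> \<eta> * 1" using assms \<eta>_bounds by (intro mult_mono) auto
    thus ?thesis unfolding abs_mult by (intro mult_left_mono) (auto simp: power2_eq_square)
  qed
  moreover have "(1 + \<bar>s0\<bar> + \<bar>s1\<bar>) * \<eta> = 1/2" using s by (simp add: \<eta>_def)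
  hence "\<bar>s0\<bar> * \<eta> + \<bar>s1\<bar> * \<eta> \<le> 1/2" using \<eta>_bounds by (simp add: distrib_right)
  ultimately show ?thesis unfolding p_def by linarith
qed

lemma Z_bounds:
  assumes "\<zeta> \<in> Z"
  shows "\<bar>fst \<zeta>\<bar> \<le> r" "\<bar>fst (snd \<zeta>) - 1\<bar> \<le> r" "\<bar>snd (snd \<zeta>)\<bar> \<le> r"
proof -
  obtain \<rho> k \<beta> where z: "\<zeta> = (\<rho>, k, \<beta>)" by (cases \<zeta>)
  have n: "norm (\<rho>, k - 1, \<beta>) \<le> r" using assms by (simp add: z mem_cball dist_commute[of \<zeta>0]) (simp add: dist_norm)
  have s: "norm (k - 1, \<beta>) \<le> r" using norm_snd_le[of "(k - 1, \<beta>)" \<rho>] n by linarith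
  show "\<bar>fst \<zeta>\<bar> \<le> r" using norm_fst_le[of \<rho> "(k - 1, \<beta>)"] n by (simp add: z)
  show "\<bar>fst (snd \<zeta>) - 1\<bar> \<le> r" using norm_fst_le[of "k - 1" \<beta>] s by (simp add: z)
  show "\<bar>snd (snd \<zeta>)\<bar> \<le> r" using norm_snd_le[of \<beta> "k - 1"] s by (simp add: z)
qed

lemma region_bounds:
  assumes "\<bar>x\<bar> \<le> \<eta>" "\<zeta> \<in> Z"
  shows "1/2 \<le> 1 - fst \<zeta> * x" "1/2 \<le> fst (snd \<zeta>)" "0 < speed x \<zeta>" "1/2 \<le> cc x"
proof -
  have "\<bar>fst \<zeta> * x\<bar> \<le> r * \<eta>" unfolding abs_mult using Z_bounds[OF assms(2)] assms(1) by (intro mult_mono) auto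
  also have "\<dots> \<le> 1/20 * (1/2)" using r_bounds \<eta>_bounds by (intro mult_mono) auto
  finally show 1: "1/2 \<le> 1 - fst \<zeta> * x" by linarith
  show 2: "1/2 \<le> fst (snd \<zeta>)" using Z_bounds[OF assms(2)] r_bounds by linarith
  have "(1/2)\<^sup>2 \<le> (p x)\<^sup>2" using p_ge[OF assms(1)] by (intro power_mono) auto
  thus 3: "1/2 \<le> cc x" by (simp add: cc_def power_divide)
  show "0 < speed x \<zeta>" unfolding speed_def using 1 2 3
    by (intro mult_pos_pos zero_less_power divide_pos_pos) auto
qed

text \<open>With \<open>n = nn x \<rho>\<close> and \<open>d = 1 - \<rho> * x\<close> everything
  reduces to \<open>1 - n * v = q / d\<close>: the sum of the fields is
  \<open>c * (1 - n * v) ^ 3 / v\<close>, and the distance of the images of \<open>w\<close> and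
  \<open>x\<close> is \<open>k * v / (q * d)\<close>.\<close>

lemma transport_identity:
  fixes w :: complex
  assumes w: "0 < Im w" and x: "1 - \<rho> * x \<noteq> 0" and k: "k \<noteq> 0"
  defines "q \<equiv> 1 - of_real \<rho> * w"
  shows "of_real k / q\<^sup>2 * (of_real (K0 x \<rho>) + of_real (K1 x \<rho>) * w + of_real (e2 x \<rho>) * w\<^sup>2 + F x w)
    = of_real (speed x (\<rho>, k, \<beta>)) / (mob \<rho> k \<beta> w - of_real (drv x (\<rho>, k, \<beta>)))"
proof -
  define v where "v = w - of_real x"
  define d :: complex where "d = 1 - of_real \<rho> * of_real x"
  define n :: complex where "n = of_real \<rho> / d"
  define c :: complex where "c = of_real (cc x)"
  have q0: "q \<noteq> 0" unfolding q_def by (rule one_minus_real_mult_ne_0[OF w])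
  have v0: "v \<noteq> 0" unfolding v_def by (rule Im_pos_ne_of_real[OF w])
  have d0: "d \<noteq> 0" unfolding d_def using x by (metis of_real_1 of_real_diff of_real_eq_0_iff of_real_mult)
  have k0: "complex_of_real k \<noteq> 0" using k by simp
  have nn: "of_real (nn x \<rho>) = n" by (simp add: nn_def n_def d_def)
  have qd: "q = d * (1 - n * v)" using d0 by (simp add: n_def q_def v_def field_simps) (simp add: d_def algebra_simps)
  have w: "w = v + of_real x" by (simp add: v_def)
  have "of_real (K0 x \<rho>) + of_real (K1 x \<rho>) * w + of_real (e2 x \<rho>) * w\<^sup>2
      = of_real (e0 x \<rho>) + of_real (e1 x \<rho>) * v + of_real (e2 x \<rho>) * v\<^sup>2"
    unfolding K0_def K1_def w by (simp add: algebra_simps power2_eq_square)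
  also have "\<dots> + F x w = c / v - 3 * n * c + 3 * n\<^sup>2 * c * v - n ^ 3 * c * v\<^sup>2"
    unfolding F_def e0_def e1_def e2_def v_def[symmetric] c_def[symmetric]
    by (simp add: nn c_def[symmetric] algebra_simps)
  also have "\<dots> = c * (1 - n * v) ^ 3 / v"
    using v0 by (simp add: field_simps power2_eq_square power3_eq_cube)
  finally have 1: "of_real (K0 x \<rho>) + of_real (K1 x \<rho>) * w + of_real (e2 x \<rho>) * w\<^sup>2 + F x w
      = c * (1 - n * v) ^ 3 / v" .
  have "mob \<rho> k \<beta> w - of_real (drv x (\<rho>, k, \<beta>)) = of_real k * w / q - of_real k * of_real x / d"
    by (simp add: mob_def drv_def q_def d_def)
  also have "\<dots> = of_real k * v / (q * d)"
    using q0 d0 by (simp add: field_simps) (simp add: q_def d_def v_def algebra_simps)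
  finally have 2: "mob \<rho> k \<beta> w - of_real (drv x (\<rho>, k, \<beta>)) = of_real k * v / (q * d)" .
  have 3: "of_real (speed x (\<rho>, k, \<beta>)) = c * (of_real k / d\<^sup>2)\<^sup>2"
    by (simp add: speed_def c_def d_def)
  have nv: "1 - n * v = q / d" using qd d0 by simp
  show ?thesis unfolding 1 2 3 nv using q0 d0 v0 k0
    by (simp add: field_simps power2_eq_square power3_eq_cube)
qed

text \<open>The velocity \<open>v\<close> is left free: it is the slit field when a slit trajectory
  is pushed forward, and the unknown to be solved for when a chordal trajectory is pulled
  back.\<close>

lemma mob_flow_derivative:
  assumes z: "(\<zeta> has_vector_derivative \<mu> *\<^sub>R RF x (\<zeta> \<theta>)) (at \<theta> within S)"
    and g: "(\<gamma> has_vector_derivative v) (at \<theta> within S)" and U: "0 < Im (\<gamma> \<theta>)"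
  defines "q \<equiv> 1 - of_real (fst (\<zeta> \<theta>)) * \<gamma> \<theta>"
  shows "((\<lambda>\<theta>. mob (fst (\<zeta> \<theta>)) (fst (snd (\<zeta> \<theta>))) (snd (snd (\<zeta> \<theta>))) (\<gamma> \<theta>)) has_vector_derivative
    (of_real (fst (snd (\<zeta> \<theta>))) / q\<^sup>2 * (of_real \<mu> * (of_real (K0 x (fst (\<zeta> \<theta>))) + of_real (K1 x (fst (\<zeta> \<theta>))) * \<gamma> \<theta>
       + of_real (e2 x (fst (\<zeta> \<theta>))) * (\<gamma> \<theta>)\<^sup>2) + v))) (at \<theta> within S)"
proof -
  have ne: "1 - of_real (fst (\<zeta> \<theta>)) * \<gamma> \<theta> \<noteq> 0" by (rule one_minus_real_mult_ne_0[OF U])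
  have 1: "((\<lambda>\<theta>. fst (\<zeta> \<theta>)) has_vector_derivative \<mu> * R1 x (fst (\<zeta> \<theta>))) (at \<theta> within S)"
    using bounded_linear.has_vector_derivative[OF bounded_linear_fst z] by (simp add: RF_def)
  have s: "((\<lambda>\<theta>. snd (\<zeta> \<theta>)) has_vector_derivative snd (\<mu> *\<^sub>R RF x (\<zeta> \<theta>))) (at \<theta> within S)"
    by (rule bounded_linear.has_vector_derivative[OF bounded_linear_snd z])
  have 2: "((\<lambda>\<theta>. fst (snd (\<zeta> \<theta>))) has_vector_derivative \<mu> * R2 x (fst (\<zeta> \<theta>)) (fst (snd (\<zeta> \<theta>)))) (at \<theta> within S)"
    using bounded_linear.has_vector_derivative[OF bounded_linear_fst s] by (simp add: RF_def)
  have 3: "((\<lambda>\<theta>. snd (snd (\<zeta> \<theta>))) has_vector_derivative \<mu> * R3 x (fst (\<zeta> \<theta>)) (fst (snd (\<zeta> \<theta>)))) (at \<theta> within S)"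
    using bounded_linear.has_vector_derivative[OF bounded_linear_snd s] by (simp add: RF_def)
  define \<rho> k w m where "\<rho> = complex_of_real (fst (\<zeta> \<theta>))" and "k = complex_of_real (fst (snd (\<zeta> \<theta>)))"
    and "w = \<gamma> \<theta>" and "m = complex_of_real \<mu>"
  define A B C where "A = complex_of_real (K0 x (fst (\<zeta> \<theta>)))" and "B = complex_of_real (K1 x (fst (\<zeta> \<theta>)))"
    and "C = complex_of_real (e2 x (fst (\<zeta> \<theta>)))"
  have q: "q = 1 - \<rho> * w" "q \<noteq> 0" using ne by (simp_all add: q_def \<rho>_def w_def)
  have "(m * (k * (B + 2 * \<rho> * A)) * w + k * v) / q
      + k * w * (m * (C + \<rho> * B + \<rho>\<^sup>2 * A) * w + \<rho> * v) / q\<^sup>2 + m * (k * A)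
      = k / q\<^sup>2 * (m * (A + B * w + C * w\<^sup>2) + v)"
  proof -
    have "(m * (k * (B + 2 * \<rho> * A)) * w + k * v) / q
      + k * w * (m * (C + \<rho> * B + \<rho>\<^sup>2 * A) * w + \<rho> * v) / q\<^sup>2 + m * (k * A)
      = ((m * (k * (B + 2 * \<rho> * A)) * w + k * v) * q
      + k * w * (m * (C + \<rho> * B + \<rho>\<^sup>2 * A) * w + \<rho> * v) + m * (k * A) * q\<^sup>2) / q\<^sup>2"
      using q(2) by (simp add: field_simps power2_eq_square)
    also have "(m * (k * (B + 2 * \<rho> * A)) * w + k * v) * q
      + k * w * (m * (C + \<rho> * B + \<rho>\<^sup>2 * A) * w + \<rho> * v) + m * (k * A) * q\<^sup>2
      = k * (m * (A + B * w + C * w\<^sup>2) + v)"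
      unfolding q(1) by (simp add: algebra_simps power2_eq_square)
    finally show ?thesis by simp
  qed
  thus ?thesis
    using mob_has_vector_derivative[OF 1 2 3 g ne]
    by (simp add: q_def[symmetric] R1_def R2_def R3_def A_def[symmetric] B_def[symmetric] C_def[symmetric]
        \<rho>_def[symmetric] k_def[symmetric] w_def[symmetric] m_def[symmetric] q(1)[symmetric])
qed

text \<open>Everything is parametrised by the chordal time \<open>\<theta>\<close>; \<open>\<kappa> \<theta>\<close> is the time of the original chain.\<close>
definition conv :: "real \<Rightarrow> (real \<Rightarrow> real) \<Rightarrow> (real \<Rightarrow> real) \<Rightarrow> (real \<Rightarrow> real \<times> real \<times> real) \<Rightarrow> (real \<Rightarrow> real) \<Rightarrow> bool" where
  "conv \<Theta> \<kappa> x \<zeta> W \<longleftrightarrow> 0 \<le> \<Theta> \<and> \<kappa> 0 = 0 \<and> \<zeta> 0 = \<zeta>0 \<and> x 0 = 0 \<and> continuous_on {0..\<Theta>} x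
     \<and> (\<forall>\<theta>\<in>{0..\<Theta>}. \<bar>x \<theta>\<bar> \<le> \<eta> \<and> \<zeta> \<theta> \<in> Z \<and> W \<theta> = drv (x \<theta>) (\<zeta> \<theta>))
     \<and> solves \<zeta> (\<lambda>\<theta>. (2 / speed (x \<theta>) (\<zeta> \<theta>)) *\<^sub>R RF (x \<theta>) (\<zeta> \<theta>)) \<Theta>
     \<and> solves \<kappa> (\<lambda>\<theta>. 2 / speed (x \<theta>) (\<zeta> \<theta>)) \<Theta>"

lemma convD:
  assumes "conv \<Theta> \<kappa> x \<zeta> W"
  shows "0 \<le> \<Theta>" "\<kappa> 0 = 0" "\<zeta> 0 = \<zeta>0" "x 0 = 0" "continuous_on {0..\<Theta>} x"
    "solves \<zeta> (\<lambda>\<theta>. (2 / speed (x \<theta>) (\<zeta> \<theta>)) *\<^sub>R RF (x \<theta>) (\<zeta> \<theta>)) \<Theta>"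
    "solves \<kappa> (\<lambda>\<theta>. 2 / speed (x \<theta>) (\<zeta> \<theta>)) \<Theta>"
    "\<theta> \<in> {0..\<Theta>} \<Longrightarrow> \<bar>x \<theta>\<bar> \<le> \<eta>" "\<theta> \<in> {0..\<Theta>} \<Longrightarrow> \<zeta> \<theta> \<in> Z"
    "\<theta> \<in> {0..\<Theta>} \<Longrightarrow> W \<theta> = drv (x \<theta>) (\<zeta> \<theta>)"
  by (insert assms, unfold conv_def, (elim conjE, (assumption | drule (1) bspec, (elim conjE)?, assumption))+)

lemma conv_mono:
  assumes c: "conv \<Theta> \<kappa> x \<zeta> W" and t: "0 \<le> \<Theta>'" "\<Theta>' \<le> \<Theta>"
  shows "conv \<Theta>' \<kappa> x \<zeta> W"
proof -
  have "continuous_on {0..\<Theta>'} x"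
    by (rule continuous_on_subset[OF convD(5)[OF c]]) (use t in auto)
  moreover have "\<theta> \<in> {0..\<Theta>}" if "\<theta> \<in> {0..\<Theta>'}" for \<theta> using that t by simp
  ultimately show ?thesis
    unfolding conv_def using t(1) convD(2-4)[OF c] convD(8-10)[OF c]
      solves_mono[OF convD(6)[OF c] t(2)] solves_mono[OF convD(7)[OF c] t(2)] by (intro conjI ballI) blast+
qed

lemma conv_W_continuous: "conv \<Theta> \<kappa> x \<zeta> W \<Longrightarrow> continuous_on {0..\<Theta>} W"
proof -
  assume c: "conv \<Theta> \<kappa> x \<zeta> W"
  have z: "continuous_on {0..\<Theta>} \<zeta>" by (rule solves_continuous[OF convD(6)[OF c]])
  have "1 - fst (\<zeta> \<theta>) * x \<theta> \<noteq> 0" if "\<theta> \<in> {0..\<Theta>}" for \<theta>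
    using region_bounds(1)[OF convD(8,9)[OF c that]] by linarith
  hence "continuous_on {0..\<Theta>} (\<lambda>\<theta>. drv (x \<theta>) (\<zeta> \<theta>))"
    unfolding drv_def by (intro continuous_intros convD(5)[OF c] z) blast
  thus ?thesis by (rule continuous_on_eq) (simp add: convD(10)[OF c])
qed

lemma conv_inverse:
  assumes c: "conv \<Theta> \<kappa> x \<zeta> W"
  shows "\<exists>\<iota>. (\<forall>s\<in>{0..\<Theta>}. \<iota> (\<kappa> s) = s) \<and> \<kappa> ` {0..\<Theta>} = {0..\<kappa> \<Theta>} \<and> \<iota> ` {0..\<kappa> \<Theta>} = {0..\<Theta>}
     \<and> (\<forall>s\<in>{0..\<kappa> \<Theta>}. \<kappa> (\<iota> s) = s) \<and> solves \<iota> (\<lambda>s. speed (x (\<iota> s)) (\<zeta> (\<iota> s)) / 2) (\<kappa> \<Theta>)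
     \<and> strict_mono_on {0..\<Theta>} \<kappa>"
proof -
  have pos: "2 / speed (x s) (\<zeta> s) > 0" if "s \<in> {0..\<Theta>}" for s
    using region_bounds(3)[OF convD(8,9)[OF c that]] by simp
  from solves_inverse[OF convD(1,7)[OF c] pos convD(2)[OF c]] show ?thesis by simp
qed

text \<open>The Moebius maps carry slit trajectories, run on the clock \<open>\<kappa>\<close>, to
  chordal ones and back. As the map is the identity at time 0, starting points are unchanged and the
  two domains are the same set.\<close>

lemma conv_chain_domain:
  assumes c: "conv \<Theta> \<kappa> x \<zeta> W" and X: "\<And>\<theta>. \<theta> \<in> {0..\<Theta>} \<Longrightarrow> X (\<kappa> \<theta>) = x \<theta>"
  shows "chain_domain UHP (\<lambda>s. F (X s)) (\<kappa> \<Theta>) = chain_domain UHP (chordal W) \<Theta>"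
proof -
  note T = convD(1-3)[OF c] and z = convD(6)[OF c] and k = convD(7)[OF c] and reg = convD(8-10)[OF c]
  obtain \<iota> where \<iota>: "\<And>s. s \<in> {0..\<Theta>} \<Longrightarrow> \<iota> (\<kappa> s) = s" "\<kappa> ` {0..\<Theta>} = {0..\<kappa> \<Theta>}" "\<iota> ` {0..\<kappa> \<Theta>} = {0..\<Theta>}"
     "\<And>s. s \<in> {0..\<kappa> \<Theta>} \<Longrightarrow> \<kappa> (\<iota> s) = s" "solves \<iota> (\<lambda>s. speed (x (\<iota> s)) (\<zeta> (\<iota> s)) / 2) (\<kappa> \<Theta>)"
    using conv_inverse[OF c] by metis
  have "\<kappa> \<Theta> \<in> \<kappa> ` {0..\<Theta>}" using T by simp
  hence kT: "0 \<le> \<kappa> \<Theta>" unfolding \<iota>(2) by simp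
  have kpos: "0 < fst (snd (\<zeta> \<theta>))" "1 - fst (\<zeta> \<theta>) * x \<theta> \<noteq> 0" "0 < speed (x \<theta>) (\<zeta> \<theta>)" if "\<theta> \<in> {0..\<Theta>}" for \<theta>
    using region_bounds[OF reg(1,2)[OF that]] by auto
  define M where "M = (\<lambda>\<theta>. mob (fst (\<zeta> \<theta>)) (fst (snd (\<zeta> \<theta>))) (snd (snd (\<zeta> \<theta>))))"
  define N where "N = (\<lambda>\<theta>. mob_inv (fst (\<zeta> \<theta>)) (fst (snd (\<zeta> \<theta>))) (snd (snd (\<zeta> \<theta>))))"
  define dM where "dM = (\<lambda>\<theta> w. of_real (fst (snd (\<zeta> \<theta>))) / (1 - of_real (fst (\<zeta> \<theta>)) * w)\<^sup>2 :: complex)"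
  define Kf where "Kf = (\<lambda>\<theta> w. of_real (K0 (x \<theta>) (fst (\<zeta> \<theta>))) + of_real (K1 (x \<theta>) (fst (\<zeta> \<theta>))) * w
       + of_real (e2 (x \<theta>) (fst (\<zeta> \<theta>))) * w\<^sup>2 :: complex)"
  define \<mu> where "\<mu> = (\<lambda>\<theta>. complex_of_real (2 / speed (x \<theta>) (\<zeta> \<theta>)))"
  have der: "((\<lambda>\<theta>. M \<theta> (\<gamma> \<theta>)) has_vector_derivative dM \<theta> (\<gamma> \<theta>) * (\<mu> \<theta> * Kf \<theta> (\<gamma> \<theta>) + v)) (at \<theta> within {0..\<Theta>})"
    if "\<theta> \<in> {0..\<Theta>}" "(\<gamma> has_vector_derivative v) (at \<theta> within {0..\<Theta>})" "\<gamma> \<theta> \<in> UHP" for \<theta> \<gamma> v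
    unfolding M_def dM_def \<mu>_def Kf_def using z that
    by (intro mob_flow_derivative) (auto simp: UHP_def)
  have tr: "dM \<theta> w * (\<mu> \<theta> * Kf \<theta> w + \<mu> \<theta> * F (x \<theta>) w) = 2 / (M \<theta> w - of_real (W \<theta>))"
    if t: "\<theta> \<in> {0..\<Theta>}" and w: "w \<in> UHP" for \<theta> w
  proof -
    have "dM \<theta> w * (Kf \<theta> w + F (x \<theta>) w) = of_real (speed (x \<theta>) (\<zeta> \<theta>)) / (M \<theta> w - of_real (W \<theta>))"
      unfolding dM_def Kf_def M_def reg(3)[OF t]
      using transport_identity[of w "fst (\<zeta> \<theta>)" "x \<theta>" "fst (snd (\<zeta> \<theta>))" "snd (snd (\<zeta> \<theta>))"] kpos[OF t] w
      by (simp add: UHP_def)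
    hence "\<mu> \<theta> * (dM \<theta> w * (Kf \<theta> w + F (x \<theta>) w)) = \<mu> \<theta> * of_real (speed (x \<theta>) (\<zeta> \<theta>)) / (M \<theta> w - of_real (W \<theta>))"
      by simp
    also have "\<mu> \<theta> * of_real (speed (x \<theta>) (\<zeta> \<theta>)) = 2" using kpos(3)[OF t] by (simp add: \<mu>_def)
    finally show ?thesis by (simp add: algebra_simps)
  qed
  have MU: "M \<theta> w \<in> UHP" "N \<theta> w \<in> UHP" "M \<theta> (N \<theta> w) = w" if "\<theta> \<in> {0..\<Theta>}" "w \<in> UHP" for \<theta> w
    unfolding M_def N_def using kpos(1)[OF that(1)] that(2) by (auto intro: mob_UHP mob_inv_UHP mob_mob_inv)
  have M0: "M 0 w = w" "N 0 w = w" for w using T by (auto simp: M_def N_def mob_def mob_inv_def)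
  show ?thesis
  proof (intro equalityI subsetI)
    fix a assume "a \<in> chain_domain UHP (\<lambda>s. F (X s)) (\<kappa> \<Theta>)"
    then obtain \<gamma> where g: "\<gamma> 0 = a" "\<And>s. s \<in> {0..\<kappa> \<Theta>} \<Longrightarrow> \<gamma> s \<in> UHP" "solves \<gamma> (\<lambda>s. F (X s) (\<gamma> s)) (\<kappa> \<Theta>)"
      and a: "a \<in> UHP" by (auto simp: chain_domain_def)
    have ks: "\<kappa> \<theta> \<in> {0..\<kappa> \<Theta>}" if "\<theta> \<in> {0..\<Theta>}" for \<theta> using \<iota>(2) that by blast
    have gk: "solves (\<lambda>\<theta>. \<gamma> (\<kappa> \<theta>)) (\<lambda>\<theta>. (2 / speed (x \<theta>) (\<zeta> \<theta>)) *\<^sub>R F (X (\<kappa> \<theta>)) (\<gamma> (\<kappa> \<theta>))) \<Theta>"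
      using solves_compose[OF k _ g(3)] \<iota>(2) by blast
    define \<delta> where "\<delta> = (\<lambda>\<theta>. M \<theta> (\<gamma> (\<kappa> \<theta>)))"
    have "solves \<delta> (\<lambda>\<theta>. 2 / (\<delta> \<theta> - of_real (W \<theta>))) \<Theta>"
    proof
      fix \<theta> assume t: "\<theta> \<in> {0..\<Theta>}"
      have gv: "((\<lambda>\<theta>. \<gamma> (\<kappa> \<theta>)) has_vector_derivative \<mu> \<theta> * F (x \<theta>) (\<gamma> (\<kappa> \<theta>))) (at \<theta> within {0..\<Theta>})"
        using bspec[OF gk t] X[OF t] by (simp add: \<mu>_def scaleR_conv_of_real)
      show "(\<delta> has_vector_derivative 2 / (\<delta> \<theta> - of_real (W \<theta>))) (at \<theta> within {0..\<Theta>})"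
        using der[OF t gv g(2)[OF ks[OF t]]] unfolding tr[OF t g(2)[OF ks[OF t]]] \<delta>_def .
    qed
    moreover have "\<delta> \<theta> \<in> UHP" if "\<theta> \<in> {0..\<Theta>}" for \<theta>
      unfolding \<delta>_def using MU(1) that g(2) ks by blast
    moreover have "\<delta> 0 = a" using g(1) T M0 by (simp add: \<delta>_def)
    ultimately show "a \<in> chain_domain UHP (chordal W) \<Theta>"
      using T a unfolding chain_domain_def by blast
  next
    fix a assume "a \<in> chain_domain UHP (chordal W) \<Theta>"
    then obtain \<gamma> where g: "\<gamma> 0 = a" "\<And>s. s \<in> {0..\<Theta>} \<Longrightarrow> \<gamma> s \<in> UHP" "solves \<gamma> (\<lambda>s. 2 / (\<gamma> s - of_real (W s))) \<Theta>"
      and a: "a \<in> UHP" by (auto simp: chain_domain_def)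
    define \<delta> where "\<delta> = (\<lambda>\<theta>. N \<theta> (\<gamma> \<theta>))"
    have dU: "\<delta> \<theta> \<in> UHP" "M \<theta> (\<delta> \<theta>) = \<gamma> \<theta>" if "\<theta> \<in> {0..\<Theta>}" for \<theta>
      unfolding \<delta>_def using MU[OF that] g(2)[OF that] by auto
    have dder: "(\<delta> has_vector_derivative \<mu> \<theta> * F (x \<theta>) (\<delta> \<theta>)) (at \<theta> within {0..\<Theta>})" if t: "\<theta> \<in> {0..\<Theta>}" and T0: "0 < \<Theta>" for \<theta>
    proof -
      define \<rho>\<^sub>1 k\<^sub>1 \<beta>\<^sub>1 where "\<rho>\<^sub>1 = (\<lambda>\<theta>. fst (\<zeta> \<theta>))" and "k\<^sub>1 = (\<lambda>\<theta>. fst (snd (\<zeta> \<theta>)))" and "\<beta>\<^sub>1 = (\<lambda>\<theta>. snd (snd (\<zeta> \<theta>)))"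
      obtain z' where zd: "(\<zeta> has_vector_derivative z') (at \<theta> within {0..\<Theta>})" using z t by blast
      note sd = bounded_linear.has_vector_derivative[OF bounded_linear_snd zd]
      obtain r' k' b' where rd: "(\<rho>\<^sub>1 has_vector_derivative r') (at \<theta> within {0..\<Theta>})"
        and kd: "(k\<^sub>1 has_vector_derivative k') (at \<theta> within {0..\<Theta>})"
        and bd: "(\<beta>\<^sub>1 has_vector_derivative b') (at \<theta> within {0..\<Theta>})"
        using bounded_linear.has_vector_derivative[OF bounded_linear_fst zd]
          bounded_linear.has_vector_derivative[OF bounded_linear_fst sd]
          bounded_linear.has_vector_derivative[OF bounded_linear_snd sd]
        unfolding \<rho>\<^sub>1_def k\<^sub>1_def \<beta>\<^sub>1_def by blast
      have k1: "0 < k\<^sub>1 \<theta>" using kpos(1)[OF t] by (simp add: k\<^sub>1_def)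
      have ofr: "((\<lambda>x. complex_of_real (f x)) has_vector_derivative complex_of_real f') (at \<theta> within {0..\<Theta>})"
        if "(f has_vector_derivative f') (at \<theta> within {0..\<Theta>})" for f f'
        using bounded_linear.has_vector_derivative[OF bounded_linear_of_real that] .
      have "((\<lambda>\<theta>. inverse (k\<^sub>1 \<theta>)) has_vector_derivative k' * - (inverse (k\<^sub>1 \<theta>) ^ Suc (Suc 0))) (at \<theta> within {0..\<Theta>})"
        using field_vector_diff_chain_within[OF kd DERIV_inverse] k1 by (simp add: o_def)
      note ki = ofr[OF this]
      have gd: "(\<gamma> has_vector_derivative 2 / (\<gamma> \<theta> - of_real (W \<theta>))) (at \<theta> within {0..\<Theta>})" using g(3) t by blast
      note zz = has_vector_derivative_mult[OF ki has_vector_derivative_diff[OF gd ofr[OF bd]]]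
      have Im: "0 < Im (of_real (inverse (k\<^sub>1 \<theta>)) * (\<gamma> \<theta> - of_real (\<beta>\<^sub>1 \<theta>)))"
        using k1 g(2)[OF t] by (simp add: UHP_def)
      \<comment> \<open>Only differentiability of \<open>\<delta>\<close> is taken from the formula
        for the inverse map. The value of the derivative comes from differentiating
        \<open>M \<theta> (\<delta> \<theta>) = \<gamma> \<theta>\<close> and cancelling
        \<open>dM\<close>.\<close>
      obtain d where d: "((\<lambda>\<theta>. mob (- \<rho>\<^sub>1 \<theta>) 1 0 (of_real (inverse (k\<^sub>1 \<theta>)) * (\<gamma> \<theta> - of_real (\<beta>\<^sub>1 \<theta>)))) has_vector_derivative d) (at \<theta> within {0..\<Theta>})"
        using mob_has_vector_derivative[OF has_vector_derivative_minus[OF rd] has_vector_derivative_const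
            has_vector_derivative_const zz one_minus_real_mult_ne_0[OF Im]] by blast
      hence d: "(\<delta> has_vector_derivative d) (at \<theta> within {0..\<Theta>})"
        by (simp add: \<delta>_def N_def mob_inv_def \<rho>\<^sub>1_def k\<^sub>1_def \<beta>\<^sub>1_def inverse_eq_divide)
      have 1: "((\<lambda>\<theta>. M \<theta> (\<delta> \<theta>)) has_vector_derivative dM \<theta> (\<delta> \<theta>) * (\<mu> \<theta> * Kf \<theta> (\<delta> \<theta>) + d)) (at \<theta> within {0..\<Theta>})"
        by (rule der[OF t d dU(1)[OF t]])
      have 2: "((\<lambda>\<theta>. M \<theta> (\<delta> \<theta>)) has_vector_derivative 2 / (\<gamma> \<theta> - of_real (W \<theta>))) (at \<theta> within {0..\<Theta>})"
        using gd t dU(2) by (auto intro: has_vector_derivative_transform)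
      have "dM \<theta> (\<delta> \<theta>) * (\<mu> \<theta> * Kf \<theta> (\<delta> \<theta>) + d) = 2 / (\<gamma> \<theta> - of_real (W \<theta>))"
        using vector_derivative_unique_within_closed_interval[of 0 \<Theta> \<theta>, OF T0 _ _ _] 1 2 t by auto
      also have "\<dots> = dM \<theta> (\<delta> \<theta>) * (\<mu> \<theta> * Kf \<theta> (\<delta> \<theta>) + \<mu> \<theta> * F (x \<theta>) (\<delta> \<theta>))"
        using tr[OF t dU(1)[OF t]] dU(2)[OF t] by simp
      finally have "dM \<theta> (\<delta> \<theta>) * (\<mu> \<theta> * Kf \<theta> (\<delta> \<theta>) + d) = dM \<theta> (\<delta> \<theta>) * (\<mu> \<theta> * Kf \<theta> (\<delta> \<theta>) + \<mu> \<theta> * F (x \<theta>) (\<delta> \<theta>))" .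
      moreover have "dM \<theta> (\<delta> \<theta>) \<noteq> 0"
        using one_minus_real_mult_ne_0[of "\<delta> \<theta>" "fst (\<zeta> \<theta>)"] dU(1)[OF t] kpos(1)[OF t] by (simp add: dM_def UHP_def)
      ultimately have "d = \<mu> \<theta> * F (x \<theta>) (\<delta> \<theta>)" by simp
      thus ?thesis using d by simp
    qed
    have dd: "solves \<delta> (\<lambda>\<theta>. \<mu> \<theta> * F (x \<theta>) (\<delta> \<theta>)) \<Theta>" if "0 < \<Theta>" using dder that by blast
    have ist: "\<iota> s \<in> {0..\<Theta>}" if "s \<in> {0..\<kappa> \<Theta>}" for s using \<iota>(3) that by blast
    have "solves (\<lambda>s. \<delta> (\<iota> s)) (\<lambda>s. F (X s) (\<delta> (\<iota> s))) (\<kappa> \<Theta>)"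
    \<comment> \<open>Uniqueness of derivatives, used for \<open>\<delta>\<close>, fails on a
      one-point interval; there the claim is vacuous.\<close>
    proof (cases "0 < \<Theta>")
      case True
      have "solves (\<lambda>s. \<delta> (\<iota> s)) (\<lambda>s. (speed (x (\<iota> s)) (\<zeta> (\<iota> s)) / 2) *\<^sub>R (\<mu> (\<iota> s) * F (x (\<iota> s)) (\<delta> (\<iota> s)))) (\<kappa> \<Theta>)"
        using solves_compose[OF \<iota>(5) _ dd[OF True]] \<iota>(3) by blast
      moreover have "(speed (x (\<iota> s)) (\<zeta> (\<iota> s)) / 2) *\<^sub>R (\<mu> (\<iota> s) * F (x (\<iota> s)) (\<delta> (\<iota> s))) = F (X s) (\<delta> (\<iota> s))"
        if s: "s \<in> {0..\<kappa> \<Theta>}" for s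
        using kpos(3)[OF ist[OF s]] X[OF ist[OF s]] \<iota>(4)[OF s] by (simp add: \<mu>_def scaleR_conv_of_real)
      ultimately show ?thesis by auto
    next
      case False
      hence k0: "\<kappa> \<Theta> = 0" using T by simp
      show ?thesis unfolding k0 by (rule solves_0)
    qed
    moreover have "\<delta> (\<iota> s) \<in> UHP" if "s \<in> {0..\<kappa> \<Theta>}" for s using dU(1) ist that by blast
    moreover have "\<delta> (\<iota> 0) = a" using \<iota>(1)[of 0] T g(1) M0 by (simp add: \<delta>_def)
    ultimately show "a \<in> chain_domain UHP (\<lambda>s. F (X s)) (\<kappa> \<Theta>)"
      using kT a unfolding chain_domain_def by (auto intro!: exI[of _ "\<lambda>s. \<delta> (\<iota> s)"])
  qed
qed

end

section \<open>Solving for the Moebius map from either driver: Lipschitz bounds, existence,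
  uniqueness\<close>

context slit_coeffs
begin

text \<open>The inverse Moebius map on the real line. It expresses the pole through the chordal
  driver and thereby eliminates the slit driver from the backward equation.\<close>

definition pole :: "real \<Rightarrow> real \<times> real \<times> real \<Rightarrow> real" where
  "pole W \<zeta> = ((W - snd (snd \<zeta>)) / fst (snd \<zeta>)) / (1 + fst \<zeta> * ((W - snd (snd \<zeta>)) / fst (snd \<zeta>)))"

lemma pole_drv:
  assumes "\<bar>x\<bar> \<le> \<eta>" "\<zeta> \<in> Z" shows "pole (drv x \<zeta>) \<zeta> = x"
proof -
  have n: "1 - fst \<zeta> * x \<noteq> 0" "fst (snd \<zeta>) \<noteq> 0" using region_bounds[OF assms] by auto
  have z: "(drv x \<zeta> - snd (snd \<zeta>)) / fst (snd \<zeta>) = x / (1 - fst \<zeta> * x)"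
    using n by (simp add: drv_def)
  have "1 + fst \<zeta> * (x / (1 - fst \<zeta> * x)) = 1 / (1 - fst \<zeta> * x)" using n by (simp add: field_simps)
  thus ?thesis using n unfolding pole_def z by simp
qed

text \<open>The numerator \<open>W - \<beta>\<close> is at most \<open>2 * r\<close> and two
  denominators are at least 1/2, so the pole is at most \<open>8 * r\<close>, below
  \<open>10 * r = \<eta>\<close>. The strict inequality means that the pole cannot be what stops the
  backward solution.\<close>

lemma pole_bounds:
  assumes W: "\<bar>W\<bar> \<le> r" and z: "\<zeta> \<in> Z"
  shows "1/2 \<le> 1 + fst \<zeta> * ((W - snd (snd \<zeta>)) / fst (snd \<zeta>))" "\<bar>pole W \<zeta>\<bar> < \<eta>" "drv (pole W \<zeta>) \<zeta> = W"
proof -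
  define q where "q = (W - snd (snd \<zeta>)) / fst (snd \<zeta>)"
  have k: "1/2 \<le> fst (snd \<zeta>)" using Z_bounds[OF z] r_bounds by linarith
  have "\<bar>W - snd (snd \<zeta>)\<bar> \<le> 2 * r" using W Z_bounds(3)[OF z] by linarith
  hence "\<bar>q\<bar> \<le> 2 * r / (1/2)" unfolding q_def abs_divide using k r_bounds by (intro frac_le) auto
  hence q: "\<bar>q\<bar> \<le> 4 * r" by simp
  have "\<bar>fst \<zeta> * q\<bar> \<le> r * (4 * r)" unfolding abs_mult using Z_bounds(1)[OF z] q r_bounds by (intro mult_mono) auto
  also have "\<dots> \<le> 1/20 * (4 * (1/20))" using r_bounds by (intro mult_mono) auto
  finally have rq: "\<bar>fst \<zeta> * q\<bar> \<le> 1/50" by simp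
  thus "1/2 \<le> 1 + fst \<zeta> * ((W - snd (snd \<zeta>)) / fst (snd \<zeta>))" unfolding q_def by linarith
  have d: "1/2 \<le> 1 + fst \<zeta> * q" using rq by linarith
  have "\<bar>q / (1 + fst \<zeta> * q)\<bar> \<le> 4 * r / (1/2)" unfolding abs_divide using q d r_bounds by (intro frac_le) auto
  also have "\<dots> < \<eta>" using \<eta>_bounds by (simp add: r_def)
  finally show "\<bar>pole W \<zeta>\<bar> < \<eta>" by (simp add: pole_def q_def)
  have p: "pole W \<zeta> = q / (1 + fst \<zeta> * q)" by (simp add: pole_def q_def)
  have "1 - fst \<zeta> * pole W \<zeta> = 1 / (1 + fst \<zeta> * q)" unfolding p using d by (simp add: field_simps)
  hence "drv (pole W \<zeta>) \<zeta> = fst (snd \<zeta>) * q + snd (snd \<zeta>)"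
    unfolding drv_def times_divide_eq_right[symmetric] p using d by simp
  also have "\<dots> = W" using k by (simp add: q_def)
  finally show "drv (pole W \<zeta>) \<zeta> = W" .
qed

text \<open>The constant is \<open>1/2 * ((1/2) / 2^2)^2\<close>, from
  \<open>cc x \<ge> 1/2\<close>, \<open>k \<ge> 1/2\<close> and
  \<open>(1 - \<rho> * x)^2 \<le> 4\<close>.\<close>

lemma speed_ge:
  assumes "\<bar>x\<bar> \<le> \<eta>" "\<zeta> \<in> Z" shows "1/128 \<le> speed x \<zeta>" "1/4 \<le> (1 - fst \<zeta> * x)\<^sup>2"
proof -
  note b = region_bounds[OF assms]
  have "\<bar>fst \<zeta> * x\<bar> \<le> 1 * 1" unfolding abs_mult
    using Z_bounds[OF assms(2)] assms(1) r_bounds \<eta>_bounds by (intro mult_mono) auto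
  hence "1 - fst \<zeta> * x \<le> 2" by linarith
  hence u: "(1 - fst \<zeta> * x)\<^sup>2 \<le> 2\<^sup>2" using b by (intro power_mono) auto
  show l: "1/4 \<le> (1 - fst \<zeta> * x)\<^sup>2" using power_mono[OF b(1), of 2] by (simp add: power_divide)
  have "(1/2) / 2\<^sup>2 \<le> fst (snd \<zeta>) / (1 - fst \<zeta> * x)\<^sup>2" using b u l by (intro frac_le) auto
  hence "((1/2) / 2\<^sup>2)\<^sup>2 \<le> (fst (snd \<zeta>) / (1 - fst \<zeta> * x)\<^sup>2)\<^sup>2" by (intro power_mono) auto
  hence "1/2 * ((1/2) / 2\<^sup>2)\<^sup>2 \<le> speed x \<zeta>" unfolding speed_def using b(4) by (intro mult_mono) auto
  thus "1/128 \<le> speed x \<zeta>" by (simp add: power2_eq_square)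
qed

text \<open>\<open>X\<close> may depend on the state, so that one statement serves the forward
  equation, where the pole is given, and the backward one, where it is
  \<open>pole t z\<close>.\<close>

lemma blip_RF:
  assumes X: "blip I Z X" and Xb: "\<And>t z. t \<in> I \<Longrightarrow> z \<in> Z \<Longrightarrow> \<bar>X t z\<bar> \<le> \<eta>"
  shows "blip I Z (\<lambda>t z. fst (RF (X t z) z))" "blip I Z (\<lambda>t z. fst (snd (RF (X t z) z)))"
    "blip I Z (\<lambda>t z. snd (snd (RF (X t z) z)))" "blip I Z (\<lambda>t z. 2 / speed (X t z) z)"
proof -
  have \<rho>: "blip I Z (\<lambda>t z. fst z)" by (rule blip_linear[OF bounded_linear_fst bounded_cball])
  have k: "blip I Z (\<lambda>t z. fst (snd z))"
    by (rule blip_linear[OF bounded_linear_compose[OF bounded_linear_fst bounded_linear_snd] bounded_cball])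
  have p: "blip I Z (\<lambda>t z. p (X t z))" unfolding p_def by (intro blip_intros X)
  have pg: "1/2 \<le> \<bar>p (X t z)\<bar>" if "t \<in> I" "z \<in> Z" for t z using p_ge[OF Xb[OF that]] by linarith
  have cc: "blip I Z (\<lambda>t z. cc (X t z))" unfolding cc_def by (intro blip_intros p)
  have a0: "blip I Z (\<lambda>t z. a0 (X t z))" unfolding a0_def by (intro blip_intros p X)
  have a1: "blip I Z (\<lambda>t z. a1 (X t z))" unfolding a1_def by (intro blip_intros X)
  have a2: "blip I Z (\<lambda>t z. a2 (X t z))" unfolding a2_def
    by (rule blip_divide[where e = "1/2"]) (intro blip_intros X p pg | simp)+
  have dg: "1/2 \<le> \<bar>1 - fst z * X t z\<bar>" "1/4 \<le> \<bar>(1 - fst z * X t z)\<^sup>2\<bar>" "1/128 \<le> \<bar>speed (X t z) z\<bar>"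
    if "t \<in> I" "z \<in> Z" for t z
    using region_bounds(1)[OF Xb[OF that] that(2)] speed_ge[OF Xb[OF that] that(2)] by linarith+
  have nn: "blip I Z (\<lambda>t z. nn (X t z) (fst z))" unfolding nn_def
    by (rule blip_divide[where e = "1/2"]) (intro blip_intros X \<rho> dg(1) | simp)+
  have e: "blip I Z (\<lambda>t z. e0 (X t z) (fst z))" "blip I Z (\<lambda>t z. e1 (X t z) (fst z))" "blip I Z (\<lambda>t z. e2 (X t z) (fst z))"
    unfolding e0_def e1_def e2_def by (intro blip_intros nn cc a0 a1 a2)+
  have K: "blip I Z (\<lambda>t z. K0 (X t z) (fst z))" "blip I Z (\<lambda>t z. K1 (X t z) (fst z))"
    unfolding K0_def K1_def by (intro blip_intros e X)+
  show "blip I Z (\<lambda>t z. fst (RF (X t z) z))" "blip I Z (\<lambda>t z. fst (snd (RF (X t z) z)))"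
    "blip I Z (\<lambda>t z. snd (snd (RF (X t z) z)))"
    unfolding RF_def R1_def R2_def R3_def fst_conv snd_conv by (intro blip_intros e K \<rho> k)+
  have kd: "blip I Z (\<lambda>t z. fst (snd z) / (1 - fst z * X t z)\<^sup>2)"
    by (rule blip_divide[where e = "1/4"]) (intro blip_intros X \<rho> k dg(2) | simp)+
  have "blip I Z (\<lambda>t z. speed (X t z) z)" unfolding speed_def by (intro blip_intros cc kd)
  thus "blip I Z (\<lambda>t z. 2 / speed (X t z) z)"
    by (intro blip_divide[where e = "1/128"] blip_const dg(3)) auto
qed

lemma RF_lipschitz:
  "\<exists>L>0. \<forall>x\<in>{-\<eta>..\<eta>}. \<forall>z\<in>Z. \<forall>z'\<in>Z. norm (RF x z - RF x z') \<le> L * norm (z - z')"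
proof -
  have X: "blip {-\<eta>..\<eta>} Z (\<lambda>x z. x)" by (rule blip_param[where A = \<eta>]) auto
  have b: "\<bar>x\<bar> \<le> \<eta>" if "x \<in> {-\<eta>..\<eta>}" for x using that by auto
  show ?thesis using blip_Pair_lipschitz[OF blip_RF(1-3)[OF X b]] by simp
qed

text \<open>The field \<open>RF\<close> in chordal time, hence the factor \<open>2 / speed\<close>,
  with the pole computed from the chordal driver.\<close>

definition backward :: "real \<Rightarrow> real \<times> real \<times> real \<Rightarrow> real \<times> real \<times> real" where
  "backward W \<zeta> = (2 / speed (pole W \<zeta>) \<zeta>) *\<^sub>R RF (pole W \<zeta>) \<zeta>"

lemma backward_lipschitz:
  "\<exists>L>0. \<forall>W\<in>{-r..r}. \<forall>z\<in>Z. \<forall>z'\<in>Z. norm (backward W z - backward W z') \<le> L * norm (z - z')"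
proof -
  have \<rho>: "blip {-r..r} Z (\<lambda>t z. fst z)" by (rule blip_linear[OF bounded_linear_fst bounded_cball])
  have k: "blip {-r..r} Z (\<lambda>t z. fst (snd z))"
    by (rule blip_linear[OF bounded_linear_compose[OF bounded_linear_fst bounded_linear_snd] bounded_cball])
  have \<beta>: "blip {-r..r} Z (\<lambda>t z. snd (snd z))"
    by (rule blip_linear[OF bounded_linear_compose[OF bounded_linear_snd bounded_linear_snd] bounded_cball])
  have W: "blip {-r..r} Z (\<lambda>t z. t)" by (rule blip_param[where A = r]) auto
  have kg: "1/2 \<le> \<bar>fst (snd z)\<bar>" if "z \<in> Z" for z using Z_bounds[OF that] r_bounds by linarith
  have wb: "\<bar>W\<bar> \<le> r" if "W \<in> {-r..r}" for W using that by auto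
  have q: "blip {-r..r} Z (\<lambda>t z. (t - snd (snd z)) / fst (snd z))"
    by (rule blip_divide[where e = "1/2"]) (intro blip_intros W \<beta> k kg | simp)+
  have g: "1/2 \<le> \<bar>1 + fst z * ((t - snd (snd z)) / fst (snd z))\<bar>" if "t \<in> {-r..r}" "z \<in> Z" for t z
    using pole_bounds(1)[OF wb[OF that(1)] that(2)] by linarith
  have X: "blip {-r..r} Z pole"
    unfolding pole_def[abs_def] by (rule blip_divide[where e = "1/2", OF q _ _ g]) (intro blip_intros \<rho> q | simp)+
  have Xb: "\<bar>pole t z\<bar> \<le> \<eta>" if "t \<in> {-r..r}" "z \<in> Z" for t z
    using pole_bounds(2)[OF wb[OF that(1)] that(2)] by simp
  note B = blip_RF[OF X Xb]
  have "backward W z = (2 / speed (pole W z) z * fst (RF (pole W z) z), 2 / speed (pole W z) z * fst (snd (RF (pole W z) z)),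
      2 / speed (pole W z) z * snd (snd (RF (pole W z) z)))" for W z
    unfolding backward_def by (simp add: RF_def)
  thus ?thesis using blip_Pair_lipschitz[OF blip_mult[OF B(4,1)] blip_mult[OF B(4,2)] blip_mult[OF B(4,3)]] by simp
qed

lemma RF_continuous:
  assumes x: "continuous_on A x" and g: "continuous_on A g"
    and b: "\<And>s. s \<in> A \<Longrightarrow> \<bar>x s\<bar> \<le> \<eta>" "\<And>s. s \<in> A \<Longrightarrow> g s \<in> Z"
  shows "continuous_on A (\<lambda>s. RF (x s) (g s))" "continuous_on A (\<lambda>s. speed (x s) (g s))"
proof -
  have n: "1 - fst (g s) * x s \<noteq> 0" if "s \<in> A" for s using region_bounds(1)[OF b[OF that]] by auto
  have pn: "p (x s) \<noteq> 0" if "s \<in> A" for s using p_ge[OF b(1)[OF that]] by auto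
  have p: "continuous_on A (\<lambda>s. p (x s))" unfolding p_def by (intro continuous_intros x)
  have c: "continuous_on A (\<lambda>s. cc (x s))" unfolding cc_def by (intro continuous_intros p)
  have a: "continuous_on A (\<lambda>s. a0 (x s))" "continuous_on A (\<lambda>s. a1 (x s))"
    unfolding a0_def a1_def by (intro continuous_intros p x)+
  have a2: "continuous_on A (\<lambda>s. a2 (x s))"
    unfolding a2_def using pn by (intro continuous_intros p x) auto
  have nn: "continuous_on A (\<lambda>s. nn (x s) (fst (g s)))"
    unfolding nn_def using n by (intro continuous_intros g x) auto
  have e: "continuous_on A (\<lambda>s. e0 (x s) (fst (g s)))" "continuous_on A (\<lambda>s. e1 (x s) (fst (g s)))"
    "continuous_on A (\<lambda>s. e2 (x s) (fst (g s)))"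
    unfolding e0_def e1_def e2_def by (intro continuous_intros nn c a a2)+
  have K: "continuous_on A (\<lambda>s. K0 (x s) (fst (g s)))" "continuous_on A (\<lambda>s. K1 (x s) (fst (g s)))"
    unfolding K0_def K1_def by (intro continuous_intros e x)+
  show "continuous_on A (\<lambda>s. RF (x s) (g s))"
    unfolding RF_def R1_def R2_def R3_def by (intro continuous_intros e K g)
  show "continuous_on A (\<lambda>s. speed (x s) (g s))"
    unfolding speed_def using n by (intro continuous_intros c g x) auto
qed

lemma pole_continuous:
  assumes W: "continuous_on A W" and g: "continuous_on A g"
    and b: "\<And>s. s \<in> A \<Longrightarrow> \<bar>W s\<bar> \<le> r" "\<And>s. s \<in> A \<Longrightarrow> g s \<in> Z"
  shows "continuous_on A (\<lambda>s. pole (W s) (g s))"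
proof -
  have k: "fst (snd (g s)) \<noteq> 0" if "s \<in> A" for s using Z_bounds[OF b(2)[OF that]] r_bounds by auto
  have q: "continuous_on A (\<lambda>s. (W s - snd (snd (g s))) / fst (snd (g s)))"
    using k by (intro continuous_intros W g) auto
  have "1 + fst (g s) * ((W s - snd (snd (g s))) / fst (snd (g s))) \<noteq> 0" if "s \<in> A" for s
    using pole_bounds(1)[OF b[OF that]] by linarith
  thus ?thesis unfolding pole_def by (intro continuous_intros q g) auto
qed

text \<open>Here the slit driver is given and time is that of the slit chain. The driver is clipped
  to keep the Lipschitz bound, and the clipping is inactive up to the exit. The final disjunction
  serves the competing chain, whose driver has no bound in advance.\<close>

lemma forward_ode:
  assumes T: "0 < T" and x: "continuous_on {0..T} x" "x 0 = 0"
  shows "\<exists>e \<zeta>. 0 < e \<and> e \<le> T \<and> \<zeta> 0 = \<zeta>0 \<and> solves \<zeta> (\<lambda>s. RF (x s) (\<zeta> s)) e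
     \<and> (\<forall>s\<in>{0..e}. \<zeta> s \<in> Z \<and> \<bar>x s\<bar> \<le> \<eta>) \<and> (e = T \<or> \<bar>x e\<bar> = \<eta> \<or> dist \<zeta>0 (\<zeta> e) = r)"
proof -
  obtain L where L: "0 < L" "\<And>x z z'. x \<in> {-\<eta>..\<eta>} \<Longrightarrow> z \<in> Z \<Longrightarrow> z' \<in> Z \<Longrightarrow> norm (RF x z - RF x z') \<le> L * norm (z - z')"
    using RF_lipschitz by blast
  define \<xi> where "\<xi> = (\<lambda>s. max (-\<eta>) (min \<eta> (x s)))"
  have \<xi>: "\<xi> s \<in> {-\<eta>..\<eta>}" "\<bar>\<xi> s\<bar> \<le> \<eta>" for s using \<eta>_bounds by (auto simp: \<xi>_def)
  have \<xi>c: "continuous_on {0..T} \<xi>" unfolding \<xi>_def by (intro continuous_intros x)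
  have Nc: "continuous_on {0..T} (\<lambda>s. \<bar>x s\<bar> / \<eta>)" using \<eta>_bounds by (intro continuous_intros x) auto
  have N0: "\<bar>x 0\<bar> / \<eta> < 1" using x by simp
  have "\<exists>e g. 0 < e \<and> e \<le> T \<and> g 0 = \<zeta>0 \<and> solves g (\<lambda>s. RF (\<xi> s) (g s)) e
     \<and> (\<forall>s\<in>{0..e}. g s \<in> cball \<zeta>0 r \<and> \<bar>x s\<bar> / \<eta> \<le> 1) \<and> (\<forall>s\<in>{0..<e}. dist \<zeta>0 (g s) < r \<and> \<bar>x s\<bar> / \<eta> < 1)
     \<and> (e = T \<or> \<bar>x e\<bar> / \<eta> = 1 \<or> dist \<zeta>0 (g e) = r)"
    by (rule cutoff_ode[OF T r_bounds(1) Nc N0 _ L(1) L(2)[OF \<xi>(1)]])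
       (auto intro!: RF_continuous \<xi>c \<xi>)
  then obtain e g where e: "0 < e" "e \<le> T" "g 0 = \<zeta>0" "solves g (\<lambda>s. RF (\<xi> s) (g s)) e"
     "\<And>s. s \<in> {0..e} \<Longrightarrow> g s \<in> Z" "\<And>s. s \<in> {0..e} \<Longrightarrow> \<bar>x s\<bar> / \<eta> \<le> 1"
     "e = T \<or> \<bar>x e\<bar> / \<eta> = 1 \<or> dist \<zeta>0 (g e) = r" by blast
  have xb: "\<bar>x s\<bar> \<le> \<eta>" if "s \<in> {0..e}" for s using e(6)[OF that] \<eta>_bounds by simp
  have "\<xi> s = x s" if "s \<in> {0..e}" for s using xb[OF that] by (auto simp: \<xi>_def)
  hence "solves g (\<lambda>s. RF (x s) (g s)) e" using e(4) by simp
  moreover have "e = T \<or> \<bar>x e\<bar> = \<eta> \<or> dist \<zeta>0 (g e) = r" using e(7) \<eta>_bounds by auto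
  ultimately show ?thesis using e(1-3) e(5) xb by blast
qed

text \<open>Chordal time is the integral of \<open>speed / 2\<close>, and \<open>\<kappa>\<close> is
  the inverse clock. The exact end value \<open>\<kappa> \<Theta> = e\<close> keeps the exit
  alternatives of \<open>forward_ode\<close> applicable after the change of clock.\<close>

lemma forward_conv:
  assumes e: "0 < e" and x: "continuous_on {0..e} X" "X 0 = 0"
    and z: "\<zeta> 0 = \<zeta>0" "solves \<zeta> (\<lambda>s. RF (X s) (\<zeta> s)) e"
    and b: "\<And>s. s \<in> {0..e} \<Longrightarrow> \<bar>X s\<bar> \<le> \<eta>" "\<And>s. s \<in> {0..e} \<Longrightarrow> \<zeta> s \<in> Z"
  shows "\<exists>\<Theta> \<kappa> W. 0 < \<Theta> \<and> conv \<Theta> \<kappa> (\<lambda>\<theta>. X (\<kappa> \<theta>)) (\<lambda>\<theta>. \<zeta> (\<kappa> \<theta>)) W \<and> \<kappa> \<Theta> = e"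
proof -
  have zc: "continuous_on {0..e} \<zeta>" by (rule solves_continuous[OF z(2)])
  have sc: "continuous_on {0..e} (\<lambda>s. speed (X s) (\<zeta> s) / 2)"
    by (intro continuous_intros RF_continuous x zc b) auto
  define \<tau> where "\<tau> = (\<lambda>s. integral {0..s} (\<lambda>s. speed (X s) (\<zeta> s) / 2))"
  have \<tau>: "solves \<tau> (\<lambda>s. speed (X s) (\<zeta> s) / 2) e"
    unfolding \<tau>_def using integral_has_vector_derivative[OF sc] by blast
  have \<tau>0: "\<tau> 0 = 0" by (simp add: \<tau>_def)
  have pos: "speed (X s) (\<zeta> s) / 2 > 0" if "s \<in> {0..e}" for s
    using region_bounds(3)[OF b[OF that]] by simp
  define \<Theta> where "\<Theta> = \<tau> e"
  obtain \<kappa> where \<kappa>: "\<forall>s\<in>{0..e}. \<kappa> (\<tau> s) = s" "\<tau> ` {0..e} = {0..\<Theta>}" "\<kappa> ` {0..\<Theta>} = {0..e}"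
    "solves \<kappa> (\<lambda>s. 1 / (speed (X (\<kappa> s)) (\<zeta> (\<kappa> s)) / 2)) \<Theta>" "strict_mono_on {0..e} \<tau>"
    using solves_inverse[OF less_imp_le[OF e] \<tau> pos \<tau>0] unfolding \<Theta>_def by metis
  have T: "0 < \<Theta>" using strict_mono_onD[OF \<kappa>(5), of 0 e] e \<tau>0 by (simp add: \<Theta>_def)
  have ke: "\<kappa> \<Theta> = e" using \<kappa>(1) e by (simp add: \<Theta>_def)
  have k0: "\<kappa> 0 = 0" using \<kappa>(1) e \<tau>0 by force
  have ks: "\<kappa> s \<in> {0..e}" if "s \<in> {0..\<Theta>}" for s using \<kappa>(3) that by blast
  have kd: "solves \<kappa> (\<lambda>\<theta>. 2 / speed (X (\<kappa> \<theta>)) (\<zeta> (\<kappa> \<theta>))) \<Theta>" using \<kappa>(4) by simp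
  have "solves (\<lambda>s. \<zeta> (\<kappa> s)) (\<lambda>\<theta>. (2 / speed (X (\<kappa> \<theta>)) (\<zeta> (\<kappa> \<theta>))) *\<^sub>R RF (X (\<kappa> \<theta>)) (\<zeta> (\<kappa> \<theta>))) \<Theta>"
    using solves_compose[OF kd _ z(2)] \<kappa>(3) by blast
  moreover have "continuous_on {0..\<Theta>} (\<lambda>\<theta>. X (\<kappa> \<theta>))"
    using ks by (intro continuous_on_compose2[OF x(1) solves_continuous[OF kd]]) blast
  ultimately have "conv \<Theta> \<kappa> (\<lambda>\<theta>. X (\<kappa> \<theta>)) (\<lambda>\<theta>. \<zeta> (\<kappa> \<theta>)) (\<lambda>\<theta>. drv (X (\<kappa> \<theta>)) (\<zeta> (\<kappa> \<theta>)))"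
    unfolding conv_def using T k0 x(2) z(1) kd b ks by simp
  thus ?thesis using T ke by blast
qed

text \<open>The strict bounds before \<open>\<Theta>\<close> are the margin against which an early
  exit of a competing chain is refuted.\<close>

lemma backward_conv:
  assumes T: "0 < T" and W: "continuous_on {0..T} W" "W 0 = 0"
  shows "\<exists>\<Theta> \<kappa> x \<zeta>. 0 < \<Theta> \<and> \<Theta> \<le> T \<and> conv \<Theta> \<kappa> x \<zeta> W \<and> (\<forall>\<theta>\<in>{0..\<Theta>}. \<bar>W \<theta>\<bar> \<le> r)
     \<and> (\<forall>\<theta>\<in>{0..<\<Theta>}. dist \<zeta>0 (\<zeta> \<theta>) < r \<and> \<bar>x \<theta>\<bar> < \<eta>)"
proof -
  obtain L where L: "0 < L" "\<And>W z z'. W \<in> {-r..r} \<Longrightarrow> z \<in> Z \<Longrightarrow> z' \<in> Z \<Longrightarrow> norm (backward W z - backward W z') \<le> L * norm (z - z')"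
    using backward_lipschitz by blast
  define \<xi> where "\<xi> = (\<lambda>s. max (-r) (min r (W s)))"
  have \<xi>: "\<xi> s \<in> {-r..r}" "\<bar>\<xi> s\<bar> \<le> r" for s using r_bounds by (auto simp: \<xi>_def)
  have \<xi>c: "continuous_on {0..T} \<xi>" unfolding \<xi>_def by (intro continuous_intros W)
  have Nc: "continuous_on {0..T} (\<lambda>s. \<bar>W s\<bar> / r)" using r_bounds by (intro continuous_intros W) auto
  have N0: "\<bar>W 0\<bar> / r < 1" using W by simp
  have bc: "continuous_on {0..T} (\<lambda>s. backward (\<xi> s) (g s))"
    if g: "continuous_on {0..T} g" and gZ: "g ` {0..T} \<subseteq> Z" for g
  proof -
    have gz: "g s \<in> Z" if "s \<in> {0..T}" for s using gZ that by blast
    have pc: "continuous_on {0..T} (\<lambda>s. pole (\<xi> s) (g s))" using gz by (intro pole_continuous \<xi>c g \<xi>) auto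
    have pb: "\<bar>pole (\<xi> s) (g s)\<bar> \<le> \<eta>" if "s \<in> {0..T}" for s using pole_bounds(2)[OF \<xi>(2)[of s] gz[OF that]] by simp
    have "speed (pole (\<xi> s) (g s)) (g s) \<noteq> 0" if "s \<in> {0..T}" for s
      using region_bounds(3)[OF pb[OF that] gz[OF that]] by simp
    thus ?thesis unfolding backward_def
      using gz pb by (intro continuous_intros RF_continuous pc g) auto
  qed
  have "\<exists>e g. 0 < e \<and> e \<le> T \<and> g 0 = \<zeta>0 \<and> solves g (\<lambda>s. backward (\<xi> s) (g s)) e
     \<and> (\<forall>s\<in>{0..e}. g s \<in> cball \<zeta>0 r \<and> \<bar>W s\<bar> / r \<le> 1) \<and> (\<forall>s\<in>{0..<e}. dist \<zeta>0 (g s) < r \<and> \<bar>W s\<bar> / r < 1)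
     \<and> (e = T \<or> \<bar>W e\<bar> / r = 1 \<or> dist \<zeta>0 (g e) = r)"
    by (rule cutoff_ode[OF T r_bounds(1) Nc N0 bc L(1) L(2)[OF \<xi>(1)]])
  then obtain e g where e: "0 < e" "e \<le> T" "g 0 = \<zeta>0" "solves g (\<lambda>s. backward (\<xi> s) (g s)) e"
     "\<And>s. s \<in> {0..e} \<Longrightarrow> g s \<in> Z" "\<And>s. s \<in> {0..e} \<Longrightarrow> \<bar>W s\<bar> / r \<le> 1"
     "\<And>s. s \<in> {0..<e} \<Longrightarrow> dist \<zeta>0 (g s) < r" by blast
  have wb: "\<bar>W s\<bar> \<le> r" if "s \<in> {0..e}" for s using e(6)[OF that] r_bounds by simp
  have "\<xi> s = W s" if "s \<in> {0..e}" for s using wb[OF that] by (auto simp: \<xi>_def)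
  hence sol: "solves g (\<lambda>s. backward (W s) (g s)) e" using e(4) by simp
  define x where "x = (\<lambda>s. pole (W s) (g s))"
  have gc: "continuous_on {0..e} g" by (rule solves_continuous[OF sol])
  have Wc: "continuous_on {0..e} W" by (rule continuous_on_subset[OF W(1)]) (use e in auto)
  have xc: "continuous_on {0..e} x" unfolding x_def by (intro pole_continuous Wc gc wb e(5))
  have x: "\<bar>x s\<bar> < \<eta>" "drv (x s) (g s) = W s" if "s \<in> {0..e}" for s
    unfolding x_def using pole_bounds(2,3)[OF wb e(5), OF that that] by auto
  have x0: "x 0 = 0" using W(2) e(3) by (simp add: x_def pole_def)
  have sc: "continuous_on {0..e} (\<lambda>s. 2 / speed (x s) (g s))"
  proof -
    have "speed (x s) (g s) \<noteq> 0" if "s \<in> {0..e}" for s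
      using region_bounds(3)[OF less_imp_le[OF x(1)] e(5), OF that that] by simp
    thus ?thesis using x(1) by (intro continuous_intros RF_continuous xc gc e(5)) (auto simp: less_imp_le)
  qed
  define \<kappa> where "\<kappa> = (\<lambda>s. integral {0..s} (\<lambda>s. 2 / speed (x s) (g s)))"
  have \<kappa>: "solves \<kappa> (\<lambda>s. 2 / speed (x s) (g s)) e"
    unfolding \<kappa>_def using integral_has_vector_derivative[OF sc] by blast
  have sol': "solves g (\<lambda>s. (2 / speed (x s) (g s)) *\<^sub>R RF (x s) (g s)) e"
    using sol by (simp add: backward_def x_def)
  have "conv e \<kappa> x g W"
    unfolding conv_def using e(1,3,5) x(1) x(2) x0 xc \<kappa> sol'
    by (simp add: \<kappa>_def less_imp_le)
  thus ?thesis using e(1,2,7) wb x(1) by (intro exI[of _ e] exI[of _ \<kappa>] exI[of _ x] exI[of _ g]) auto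
qed

text \<open>For a given \<open>W\<close> both Moebius curves solve the backward equation, which is
  Lipschitz while \<open>W\<close> is at most \<open>r\<close> in absolute value. The pole then
  follows from \<open>pole_drv\<close>, and the clock by integration.\<close>

lemma conv_unique:
  assumes 1: "conv \<Theta> \<kappa> x \<zeta> W" and 2: "conv \<Theta> \<kappa>' x' \<zeta>' W'"
    and W: "\<And>\<theta>. \<theta> \<in> {0..\<Theta>} \<Longrightarrow> W \<theta> = W' \<theta>" "\<And>\<theta>. \<theta> \<in> {0..\<Theta>} \<Longrightarrow> \<bar>W \<theta>\<bar> \<le> r"
    and t: "\<theta> \<in> {0..\<Theta>}"
  shows "\<zeta> \<theta> = \<zeta>' \<theta>" "x \<theta> = x' \<theta>" "\<kappa> \<theta> = \<kappa>' \<theta>"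
proof -
  obtain L where L: "0 < L" "\<And>W z z'. W \<in> {-r..r} \<Longrightarrow> z \<in> Z \<Longrightarrow> z' \<in> Z \<Longrightarrow> norm (backward W z - backward W z') \<le> L * norm (z - z')"
    using backward_lipschitz by blast
  have x: "x \<theta> = pole (W \<theta>) (\<zeta> \<theta>)" "x' \<theta> = pole (W \<theta>) (\<zeta>' \<theta>)" if "\<theta> \<in> {0..\<Theta>}" for \<theta>
    using pole_drv[OF convD(8,9)[OF 1 that]] pole_drv[OF convD(8,9)[OF 2 that]]
      convD(10)[OF 1 that] convD(10)[OF 2 that] W(1)[OF that] by auto
  have z: "\<zeta> \<theta> = \<zeta>' \<theta>" if t: "\<theta> \<in> {0..\<Theta>}" for \<theta>
  proof (rule ode_unique[OF convD(6)[OF 1] convD(6)[OF 2] _ _ t])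
    fix s assume s: "s \<in> {0..\<Theta>}"
    have "W s \<in> {-r..r}" using W(2)[OF s] by auto
    from L(2)[OF this convD(9)[OF 1 s] convD(9)[OF 2 s]]
    show "norm ((2 / speed (x s) (\<zeta> s)) *\<^sub>R RF (x s) (\<zeta> s) - (2 / speed (x' s) (\<zeta>' s)) *\<^sub>R RF (x' s) (\<zeta>' s))
        \<le> L * norm (\<zeta> s - \<zeta>' s)"
      unfolding backward_def x[OF s] .
  qed (simp add: convD(3)[OF 1] convD(3)[OF 2])
  thus "\<zeta> \<theta> = \<zeta>' \<theta>" using t by blast
  have xx: "x \<theta> = x' \<theta>" if "\<theta> \<in> {0..\<Theta>}" for \<theta> using x[OF that] z[OF that] by simp
  thus "x \<theta> = x' \<theta>" using t by blast
  show "\<kappa> \<theta> = \<kappa>' \<theta>"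
  \<comment> \<open>The two clocks have equal derivatives by now, so the Lipschitz constant 0
    suffices.\<close>
  proof (rule ode_unique[OF convD(7)[OF 1] convD(7)[OF 2] _ _ t, where L = 0])
    fix s assume s: "s \<in> {0..\<Theta>}"
    show "norm (2 / speed (x s) (\<zeta> s) - 2 / speed (x' s) (\<zeta>' s)) \<le> 0 * norm (\<kappa> s - \<kappa>' s)"
      using z[OF s] xx[OF s] by simp
  qed (simp add: convD(2)[OF 1] convD(2)[OF 2])
qed

end

section \<open>Transfer between the domain and the half-plane\<close>

lemma b_field_conformal:
  assumes "inj_on \<phi> UHP" "w \<in> UHP"
  shows "b_field \<phi> bm1 b0 b1 (\<phi> w)
    = - (deriv \<phi> w * (2 / w + of_real bm1 + of_real b0 * w + of_real b1 * w\<^sup>2))"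
  using assms by (simp add: b_field_def ell_def pushforward_def ellH_def algebra_simps divide_inverse)

lemma sigma_field_conformal:
  assumes "inj_on \<phi> UHP" "w \<in> UHP"
  shows "sigma_field \<phi> s0 s1 (\<phi> w) = - (deriv \<phi> w * (1 + of_real s0 * w + of_real s1 * w\<^sup>2))"
  using assms by (simp add: sigma_field_def ell_def pushforward_def ellH_def algebra_simps)

section \<open>The flow of \<open>\<sigma>\<close> in half-plane coordinates and the driver
  coordinate\<close>

context slit_coeffs
begin

definition A :: "real \<Rightarrow> complex \<Rightarrow> complex" where
  "A x z = (of_real (1 + s0 * x) * z + of_real x) / (1 - of_real (s1 * x) * z)"

text \<open>The inverse of \<open>A x\<close>: the half-plane flow map at time \<open>U x\<close>,
  which sends \<open>x\<close> to 0. This is why the Loewner field has its pole at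
  \<open>x\<close>.\<close>

definition B :: "real \<Rightarrow> complex \<Rightarrow> complex" where
  "B x w = (w - of_real x) / (of_real (s1 * x) * w + of_real (1 + s0 * x))"

lemma B_denom_ne_0:
  assumes x: "\<bar>x\<bar> \<le> \<eta>" and w: "w \<in> UHP"
  shows "of_real (s1 * x) * w + of_real (1 + s0 * x) \<noteq> 0"
proof
  assume z: "of_real (s1 * x) * w + of_real (1 + s0 * x) = 0"
  hence "s1 * x * Im w = 0" by (simp add: complex_eq_iff)
  hence sx: "s1 * x = 0" using w by (auto simp: UHP_def)
  hence "1 + s0 * x = 0" using z by (metis add.left_neutral mult_zero_left of_real_0 of_real_eq_0_iff)
  moreover have "p x = 1 + s0 * x" using sx by (auto simp: p_def power2_eq_square)
  ultimately show False using p_ge[OF x] by simp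
qed

lemma B_eq_if_A_eq:
  assumes x: "\<bar>x\<bar> \<le> \<eta>" and z: "z \<in> UHP" and w: "w \<in> UHP" and e: "A x z = w"
  shows "z = B x w"
proof -
  have n: "1 - of_real (s1 * x) * z \<noteq> 0" using one_minus_real_mult_ne_0[of z "s1 * x"] z by (simp add: UHP_def)
  have "of_real (1 + s0 * x) * z + of_real x = w * (1 - of_real (s1 * x) * z)"
    using e n unfolding A_def by (simp only: divide_eq_eq if_True not_False_eq_True)
  hence "z * (of_real (s1 * x) * w + of_real (1 + s0 * x)) = w - of_real x"
    by (simp add: algebra_simps)
  thus ?thesis unfolding B_def using B_denom_ne_0[OF x w] by (simp add: eq_divide_eq)
qed

lemma B_UHP:
  assumes x: "\<bar>x\<bar> \<le> \<eta>" and w: "w \<in> UHP"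
  shows "B x w \<in> UHP"
proof -
  define L where "L = of_real (s1 * x) * w + of_real (1 + s0 * x)"
  have n: "L \<noteq> 0" unfolding L_def by (rule B_denom_ne_0[OF x w])
  have "B x w = ((w - of_real x) * cnj L) / of_real ((norm L)\<^sup>2)"
    unfolding B_def L_def[symmetric] by (subst complex_div_cnj) (simp flip: complex_norm_square)
  hence "Im (B x w) = Im ((w - of_real x) * cnj L) / (norm L)\<^sup>2" by (simp only: Im_divide_of_real)
  also have "Im ((w - of_real x) * cnj L) = p x * Im w"
    by (simp add: L_def p_def algebra_simps power2_eq_square)
  finally show ?thesis using p_ge[OF x] w n by (simp add: UHP_def)
qed

lemma B_has_field_derivative:
  assumes x: "\<bar>x\<bar> \<le> \<eta>" and w: "w \<in> UHP"
  shows "(B x has_field_derivative of_real (p x) / (of_real (s1 * x) * w + of_real (1 + s0 * x))\<^sup>2) (at w)"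
proof -
  define L where "L = of_real (s1 * x) * w + of_real (1 + s0 * x)"
  have n: "L \<noteq> 0" unfolding L_def by (rule B_denom_ne_0[OF x w])
  have "(B x has_field_derivative (1 * L - (w - of_real x) * of_real (s1 * x)) / (L * L)) (at w)"
    unfolding B_def[abs_def] L_def
    by (rule DERIV_divide) (auto intro!: derivative_eq_intros simp: n[unfolded L_def, simplified])
  also have "1 * L - (w - of_real x) * of_real (s1 * x) = of_real (p x)"
    by (simp add: L_def p_def algebra_simps power2_eq_square)
  finally show ?thesis by (simp add: L_def power2_eq_square)
qed

text \<open>The prefactor is the reciprocal of the derivative of \<open>B x\<close>. In the variable
  \<open>v = w - x\<close> one has \<open>B x w = v / L\<close> with \<open>L\<close> affine in
  \<open>v\<close>, so the right-hand side is a Laurent polynomial in \<open>v\<close>.\<close>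

lemma F_eq_pullback:
  assumes x: "\<bar>x\<bar> \<le> \<eta>" and w: "w \<in> UHP"
  shows "F x w = (of_real (s1 * x) * w + of_real (1 + s0 * x))\<^sup>2 / of_real (p x)
    * (2 / B x w + of_real bm1 + of_real b0 * B x w + of_real b1 * (B x w)\<^sup>2)"
proof -
  define v where "v = w - of_real x"
  define P where "P = complex_of_real (p x)"
  define S X where "S = complex_of_real s1" and "X = complex_of_real x"
  define L where "L = P + S * X * v"
  have Le: "of_real (s1 * x) * w + of_real (1 + s0 * x) = L"
    by (simp add: L_def v_def P_def S_def X_def p_def algebra_simps power2_eq_square)
  have L0: "L \<noteq> 0" using B_denom_ne_0[OF x w] unfolding Le .
  have v0: "v \<noteq> 0" using w unfolding v_def by (intro Im_pos_ne_of_real) (simp add: UHP_def)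
  have P0: "P \<noteq> 0" using p_ge[OF x] by (simp add: P_def)
  have B: "B x w = v / L" unfolding B_def Le v_def ..
  have "L\<^sup>2 / P * (2 / (v / L) + of_real bm1 + of_real b0 * (v / L) + of_real b1 * (v / L)\<^sup>2)
      = (2 * L ^ 3 / v + of_real bm1 * L\<^sup>2 + of_real b0 * L * v + of_real b1 * v\<^sup>2) / P"
    using L0 v0 P0 by (simp add: field_simps power2_eq_square power3_eq_cube)
  also have "2 * L ^ 3 / v = 2 * P ^ 3 / v + 6 * P\<^sup>2 * S * X + 6 * P * S\<^sup>2 * X\<^sup>2 * v + 2 * S ^ 3 * X ^ 3 * v\<^sup>2"
    using v0 by (simp add: L_def field_simps power2_eq_square power3_eq_cube)
  also have "(2 * P ^ 3 / v + 6 * P\<^sup>2 * S * X + 6 * P * S\<^sup>2 * X\<^sup>2 * v + 2 * S ^ 3 * X ^ 3 * v\<^sup>2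
        + of_real bm1 * L\<^sup>2 + of_real b0 * L * v + of_real b1 * v\<^sup>2) / P
      = 2 * P\<^sup>2 / v + (6 * P * S * X + of_real bm1 * P) + (6 * S\<^sup>2 * X\<^sup>2 + 2 * of_real bm1 * S * X + of_real b0) * v
        + (2 * S ^ 3 * X ^ 3 + of_real bm1 * S\<^sup>2 * X\<^sup>2 + of_real b0 * S * X + of_real b1) / P * v\<^sup>2"
    using v0 P0 by (simp add: L_def field_simps power2_eq_square power3_eq_cube)
  also have "\<dots> = F x w"
    unfolding F_def cc_def a0_def a1_def a2_def v_def[symmetric] by (simp add: P_def S_def X_def)
  finally show ?thesis unfolding Le B P_def ..
qed

text \<open>\<open>U x\<close> is the time the half-plane flow takes from \<open>x\<close> to 0,
  since its derivative is \<open>1 / p x\<close>. \<open>X\<close> is defined for every driver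
  value, and a value of \<open>X\<close> within \<open>\<eta>\<close> certifies that the argument
  lies in the range of \<open>U\<close>; arbitrary drivers can thus be monitored through
  \<open>X\<close>.\<close>

definition driver_coordinates :: "(real \<Rightarrow> real) \<Rightarrow> (real \<Rightarrow> real) \<Rightarrow> bool" where
  "driver_coordinates U X \<longleftrightarrow> U 0 = 0 \<and> continuous_on UNIV X
     \<and> (\<forall>x\<in>{-\<eta>..\<eta>}. (U has_vector_derivative 1 / p x) (at x within {-\<eta>..\<eta>}) \<and> X (U x) = x)
     \<and> (\<forall>v. \<bar>X v\<bar> \<le> \<eta> \<longrightarrow> U (X v) = v)"

lemma driver_coordinates_exist: "\<exists>U X. driver_coordinates U X"
proof -
  define I where "I = {-\<eta>..\<eta>}"
  have pp: "p x > 0" if "x \<in> I" for x using p_ge[of x] that by (force simp: I_def)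
  have pc: "continuous_on I (\<lambda>x. 1 / p x)"
  proof -
    have "p x \<noteq> 0" if "x \<in> I" for x using pp[OF that] by simp
    thus ?thesis unfolding p_def by (intro continuous_intros) auto
  qed
  define U where "U = (\<lambda>x. integral {-\<eta>..x} (\<lambda>x. 1 / p x) - integral {-\<eta>..0} (\<lambda>x. 1 / p x))"
  have U: "(U has_vector_derivative 1 / p x) (at x within I)" if "x \<in> I" for x
    unfolding U_def using integral_has_vector_derivative[OF pc[unfolded I_def], of x] that
    by (auto simp: I_def intro!: derivative_eq_intros)
  have U0: "U 0 = 0" by (simp add: U_def)
  have Uc: "continuous_on I U" using U by (rule continuous_on_vector_derivative)
  have sm: "U x < U y" if "x < y" "x \<in> I" "y \<in> I" for x y
  proof -
    have "\<exists>z\<in>{x<..<y}. U y - U x = (\<lambda>h. h *\<^sub>R (1 / p z)) (y - x)"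
    proof (rule mvt_simple[OF that(1)])
      fix z assume z: "x \<le> z" "z \<le> y"
      hence "z \<in> I" using that by (auto simp: I_def)
      from U[OF this] have "(U has_derivative (\<lambda>h. h *\<^sub>R (1 / p z))) (at z within I)"
        by (simp add: has_vector_derivative_def)
      thus "(U has_derivative (\<lambda>h. h *\<^sub>R (1 / p z))) (at z within {x..y})"
        by (rule has_derivative_subset) (use that in \<open>auto simp: I_def\<close>)
    qed
    then obtain z where "z \<in> {x<..<y}" "U y - U x = (y - x) * (1 / p z)" by auto
    moreover from this have "z \<in> I" using that by (auto simp: I_def)
    hence "(y - x) * (1 / p z) > 0" using pp that by (intro mult_pos_pos) auto
    ultimately show ?thesis by linarith
  qed
  have inj: "inj_on U I" by (rule linorder_inj_onI') (use sm in force)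
  define lo hi where "lo = U (-\<eta>)" and "hi = U \<eta>"
  have mono: "U x \<le> U y" if "x \<le> y" "x \<in> I" "y \<in> I" for x y
    using sm[of x y] that by (cases "x = y") auto
  have im: "U ` I = {lo..hi}"
  proof (intro equalityI subsetI)
    fix v assume "v \<in> {lo..hi}"
    then obtain x where "-\<eta> \<le> x" "x \<le> \<eta>" "U x = v"
      using IVT'[of U "-\<eta>" v \<eta>] Uc \<eta>_bounds by (auto simp: lo_def hi_def I_def)
    thus "v \<in> U ` I" by (auto simp: I_def)
  next
    fix v assume "v \<in> U ` I"
    then obtain x where x: "x \<in> I" "v = U x" by blast
    thus "v \<in> {lo..hi}" using mono[of "-\<eta>" x] mono[of x \<eta>] \<eta>_bounds by (auto simp: lo_def hi_def I_def)
  qed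
  define Y where "Y = the_inv_into I U"
  have Y1: "Y (U x) = x" if "x \<in> I" for x unfolding Y_def by (rule the_inv_into_f_f[OF inj that])
  have Y2: "Y v \<in> I" "U (Y v) = v" if v: "v \<in> {lo..hi}" for v
  proof -
    obtain x where "x \<in> I" "v = U x" using v im by blast
    thus "Y v \<in> I" "U (Y v) = v" using Y1 by auto
  qed
  have Yc: "continuous_on {lo..hi} Y"
  proof -
    have "continuous_on (U ` I) Y" by (rule continuous_on_inv[OF Uc]) (auto simp: I_def Y1)
    thus ?thesis by (simp add: im)
  qed
  have lh: "lo < hi" using sm[of "-\<eta>" \<eta>] \<eta>_bounds by (simp add: lo_def hi_def I_def)
  have Ylo: "Y lo = -\<eta>" and Yhi: "Y hi = \<eta>"
    using Y1[of "-\<eta>"] Y1[of \<eta>] \<eta>_bounds by (simp_all add: lo_def hi_def I_def)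
  define c where "c = (\<lambda>v. max lo (min hi v))"
  have c: "c v \<in> {lo..hi}" for v using lh by (auto simp: c_def)
  have cc: "continuous_on UNIV c" unfolding c_def by (intro continuous_intros)
  \<comment> \<open>Beyond the range of \<open>U\<close> the inverse is continued with slope 1. It
    leaves \<open>{-\<eta>..\<eta>}\<close> there at once, which gives the certificate
    clause.\<close>
  define X where "X = (\<lambda>v. Y (c v) + (v - c v))"
  have Xc: "continuous_on UNIV X"
    unfolding X_def using c by (intro continuous_intros cc continuous_on_compose2[OF Yc cc]) blast
  have X1: "X (U x) = x" if "x \<in> I" for x
  proof -
    have "U x \<in> {lo..hi}" using that im by blast
    hence "c (U x) = U x" by (auto simp: c_def)
    thus ?thesis using Y1[OF that] by (simp add: X_def)
  qed
  have X2: "U (X v) = v" if "\<bar>X v\<bar> \<le> \<eta>" for v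
  proof -
    have "v \<in> {lo..hi}"
    proof (rule ccontr)
      assume "v \<notin> {lo..hi}"
      then consider "v < lo" | "hi < v" by force
      thus False
      proof cases
        case 1
        hence "c v = lo" using lh by (auto simp: c_def)
        hence "X v = -\<eta> + (v - lo)" using Ylo by (simp add: X_def)
        thus False using 1 that by linarith
      next
        case 2
        hence "c v = hi" using lh by (auto simp: c_def)
        hence "X v = \<eta> + (v - hi)" using Yhi by (simp add: X_def)
        thus False using 2 that by linarith
      qed
    qed
    moreover from this have "c v = v" by (auto simp: c_def)
    ultimately show ?thesis using Y2(2) by (simp add: X_def)
  qed
  show ?thesis unfolding driver_coordinates_def
    using U0 Xc U X1 X2 unfolding I_def by blast
qed

section \<open>Carrying chains between the domain and the half-plane along
  \<open>\<phi>\<close>\<close>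

context
  fixes \<phi> D h U X
  assumes openD: "open D" and hol: "\<phi> holomorphic_on UHP" and bij: "bij_betw \<phi> UHP D"
    and flow: "is_flow D (sigma_field \<phi> s0 s1) h" and UX: "driver_coordinates U X"
begin

lemma inverse_conformal:
  defines "\<psi> \<equiv> inv_into UHP \<phi>"
  shows "w \<in> UHP \<Longrightarrow> \<psi> (\<phi> w) = w" and "z \<in> D \<Longrightarrow> \<psi> z \<in> UHP" and "z \<in> D \<Longrightarrow> \<phi> (\<psi> z) = z"
    and "w \<in> UHP \<Longrightarrow> deriv \<phi> w \<noteq> 0"
    and "w \<in> UHP \<Longrightarrow> (\<phi> has_field_derivative deriv \<phi> w) (at w)"
    and "z \<in> D \<Longrightarrow> (\<psi> has_field_derivative 1 / deriv \<phi> (\<psi> z)) (at z)"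
proof -
  have inj: "inj_on \<phi> UHP" and im: "\<phi> ` UHP = D" using bij by (auto simp: bij_betw_def)
  obtain g where g: "g holomorphic_on \<phi> ` UHP" "\<And>z. z \<in> UHP \<Longrightarrow> deriv \<phi> z * deriv g (\<phi> z) = 1"
    "\<And>z. z \<in> UHP \<Longrightarrow> g (\<phi> z) = z"
    using holomorphic_has_inverse[OF hol open_UHP inj] by metis
  show 1: "\<psi> (\<phi> w) = w" if "w \<in> UHP" for w unfolding \<psi>_def by (rule inv_into_f_f[OF inj that])
  show 2: "\<psi> z \<in> UHP" if "z \<in> D" for z unfolding \<psi>_def using that im by (metis inv_into_into)
  show 3: "\<phi> (\<psi> z) = z" if "z \<in> D" for z unfolding \<psi>_def using that im by (metis f_inv_into_f)
  show 4: "deriv \<phi> w \<noteq> 0" if "w \<in> UHP" for w using g(2)[OF that] by auto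
  show "(\<phi> has_field_derivative deriv \<phi> w) (at w)" if "w \<in> UHP" for w
    by (rule holomorphic_derivI[OF hol open_UHP that])
  show "(\<psi> has_field_derivative 1 / deriv \<phi> (\<psi> z)) (at z)" if z: "z \<in> D" for z
  proof (rule has_field_derivative_transform_within_open[OF _ openD z])
    have "(g has_field_derivative deriv g z) (at z)"
      using g(1) openD z unfolding im by (rule holomorphic_derivI)
    moreover have "deriv \<phi> (\<psi> z) * deriv g z = 1" using g(2)[OF 2[OF z]] unfolding 3[OF z] .
    hence "deriv g z = 1 / deriv \<phi> (\<psi> z)" using 4[OF 2[OF z]] by (simp add: field_simps)
    ultimately show "(g has_field_derivative 1 / deriv \<phi> (\<psi> z)) (at z)" by simp
    show "g y = \<psi> y" if "y \<in> D" for y using g(3)[OF 2[OF that]] unfolding 3[OF that] .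
  qed
qed

text \<open>\<open>A x\<close> undoes the flow at time \<open>U x\<close>: the derivative in \<open>x\<close> of \<open>A x (\<psi> (h (U x) (\<phi> w)))\<close> vanishes.\<close>
lemma flow_eq:
  assumes x: "\<bar>x\<bar> \<le> \<eta>" and w: "w \<in> UHP"
  shows "h (U x) (\<phi> w) = \<phi> (B x w)"
proof -
  have inj: "inj_on \<phi> UHP" and im: "\<phi> ` UHP = D" using bij by (auto simp: bij_betw_def)
  define \<psi> where "\<psi> = inv_into UHP \<phi>"
  note inv = inverse_conformal[folded \<psi>_def]
  note \<psi> = inv(1-3) and d0 = inv(4) and d\<phi> = inv(5) and d\<psi> = inv(6)
  have D: "\<phi> w \<in> D" using w im by blast
  have h: "h 0 (\<phi> w) = \<phi> w" "\<And>t. h t (\<phi> w) \<in> D"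
    "\<And>t. ((\<lambda>s. h s (\<phi> w)) has_vector_derivative sigma_field \<phi> s0 s1 (h t (\<phi> w))) (at t)"
    using flow D unfolding is_flow_def by blast+
  define k where "k = (\<lambda>t. \<psi> (h t (\<phi> w)))"
  have kU: "k t \<in> UHP" "\<phi> (k t) = h t (\<phi> w)" for t unfolding k_def using \<psi> h(2) by auto
  define \<sigma> where "\<sigma> = (\<lambda>z. 1 + of_real s0 * z + of_real s1 * z\<^sup>2 :: complex)"
  have kd: "(k has_vector_derivative - \<sigma> (k t)) (at t)" for t
  proof -
    have "(k has_vector_derivative sigma_field \<phi> s0 s1 (h t (\<phi> w)) * (1 / deriv \<phi> (k t))) (at t)"
      using field_vector_diff_chain_at[OF h(3) d\<psi>[OF h(2)]] by (simp add: k_def o_def)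
    also have "sigma_field \<phi> s0 s1 (h t (\<phi> w)) * (1 / deriv \<phi> (k t)) = - \<sigma> (k t)"
      unfolding kU(2)[symmetric] sigma_field_conformal[OF inj kU(1)] \<sigma>_def using d0[OF kU(1)] by simp
    finally show ?thesis .
  qed
  define I where "I = {-\<eta>..\<eta>}"
  have U: "U 0 = 0" "\<And>x. x \<in> I \<Longrightarrow> (U has_vector_derivative 1 / p x) (at x within I)"
    using UX unfolding driver_coordinates_def I_def by blast+
  have "((\<lambda>x. A x (k (U x))) has_vector_derivative 0) (at x within I)" if x: "x \<in> I" for x
  proof -
    define \<kappa> where "\<kappa> = k (U x)"
    define P where "P = complex_of_real (p x)"
    have "\<bar>x\<bar> \<le> \<eta>" using x by (auto simp: I_def)
    hence P0: "P \<noteq> 0" using p_ge[of x] by (simp add: P_def)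
    have kd': "((\<lambda>x. k (U x)) has_vector_derivative (1 / p x) *\<^sub>R (- \<sigma> \<kappa>)) (at x within I)"
      using vector_diff_chain_within[OF U(2)[OF x] has_vector_derivative_at_within[OF kd[of "U x"]]]
      by (simp add: o_def \<kappa>_def)
    define v where "v = - \<sigma> \<kappa> / P"
    have kv: "((\<lambda>x. k (U x)) has_vector_derivative v) (at x within I)"
      using kd' by (simp add: v_def P_def scaleR_conv_of_real)
    define q where "q = (\<lambda>x. 1 - of_real (s1 * x) * k (U x))"
    have q0: "q x \<noteq> 0"
      unfolding q_def using one_minus_real_mult_ne_0[of "k (U x)" "s1 * x"] kU(1)[of "U x"] by (simp add: UHP_def)
    have ofl: "((\<lambda>x. complex_of_real (c * x)) has_vector_derivative of_real c) (at x within I)" for c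
      by (rule bounded_linear.has_vector_derivative[OF bounded_linear_of_real])
         (auto intro!: derivative_eq_intros simp flip: has_real_derivative_iff_has_vector_derivative)
    have n: "((\<lambda>x. of_real (1 + s0 * x) * k (U x) + of_real x) has_vector_derivative
        (of_real (1 + s0 * x) * v + of_real s0 * \<kappa>) + 1) (at x within I)"
    proof -
      have "((\<lambda>x. complex_of_real (1 + s0 * x)) has_vector_derivative of_real s0) (at x within I)"
        using has_vector_derivative_add[OF has_vector_derivative_const[of 1] ofl[of s0]] by simp
      from has_vector_derivative_add[OF has_vector_derivative_mult[OF this kv] ofl[of 1]]
      show ?thesis by (simp add: \<kappa>_def)
    qed
    have qd: "(q has_vector_derivative - (of_real (s1 * x) * v + of_real s1 * \<kappa>)) (at x within I)"
      unfolding q_def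
      using has_vector_derivative_diff[OF has_vector_derivative_const[of 1] has_vector_derivative_mult[OF ofl[of s1] kv]]
      by (simp add: \<kappa>_def)
    have qi: "((\<lambda>x. inverse (q x)) has_vector_derivative
        - (of_real (s1 * x) * v + of_real s1 * \<kappa>) * - (inverse (q x) ^ Suc (Suc 0))) (at x within I)"
      using field_vector_diff_chain_within[OF qd DERIV_inverse[OF q0]] by (simp add: o_def)
    define N where "N = of_real (1 + s0 * x) * \<kappa> + complex_of_real x"
    have "((\<lambda>x. (of_real (1 + s0 * x) * k (U x) + of_real x) * inverse (q x)) has_vector_derivative
        N * (- (of_real (s1 * x) * v + of_real s1 * \<kappa>) * - (inverse (q x) ^ Suc (Suc 0)))
        + ((of_real (1 + s0 * x) * v + of_real s0 * \<kappa>) + 1) * inverse (q x)) (at x within I)"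
      using has_vector_derivative_mult[OF n qi] by (simp add: N_def \<kappa>_def)
    also have "(\<lambda>x. (of_real (1 + s0 * x) * k (U x) + of_real x) * inverse (q x)) = (\<lambda>x. A x (k (U x)))"
      by (simp add: A_def q_def divide_inverse)
    also have "N * (- (of_real (s1 * x) * v + of_real s1 * \<kappa>) * - (inverse (q x) ^ Suc (Suc 0)))
        + ((of_real (1 + s0 * x) * v + of_real s0 * \<kappa>) + 1) * inverse (q x)
      = (N * (of_real (s1 * x) * v + of_real s1 * \<kappa>)
        + ((of_real (1 + s0 * x) * v + of_real s0 * \<kappa>) + 1) * q x) / (q x)\<^sup>2"
      using q0 by (simp add: field_simps power2_eq_square)
    \<comment> \<open>The coefficient of \<open>v\<close> is the determinant \<open>p x\<close> of
      \<open>A x\<close>; the remaining terms come from differentiating the coefficients of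
      \<open>A x\<close> and add up to \<open>\<sigma> \<kappa>\<close>.\<close>
    also have "N * (of_real (s1 * x) * v + of_real s1 * \<kappa>)
        + ((of_real (1 + s0 * x) * v + of_real s0 * \<kappa>) + 1) * q x = P * v + \<sigma> \<kappa>"
      unfolding N_def q_def \<kappa>_def[symmetric] P_def \<sigma>_def p_def by (simp add: algebra_simps power2_eq_square)
    also have "P * v + \<sigma> \<kappa> = 0" using P0 by (simp add: v_def)
    finally show ?thesis by simp
  qed
  then obtain c where c: "\<And>x. x \<in> I \<Longrightarrow> A x (k (U x)) = c"
    using has_vector_derivative_zero_constant[of I "\<lambda>x. A x (k (U x))"] by (auto simp: I_def)
  have "A 0 (k (U 0)) = w" using U(1) h(1) \<psi>(1)[OF w] by (simp add: A_def k_def)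
  hence "A x (k (U x)) = w" using c[of 0] c[of x] x \<eta>_bounds by (simp add: I_def abs_le_iff)
  hence "k (U x) = B x w" by (intro B_eq_if_A_eq x kU w)
  thus ?thesis using kU(2)[of "U x"] by simp
qed

text \<open>On the open set \<open>D\<close> the flow map is \<open>\<phi>\<close> after
  \<open>B x\<close> after the inverse of \<open>\<phi>\<close>, so its derivative is given by the
  chain rule. The factor \<open>deriv \<phi> (B x w)\<close> cancels against the one in
  \<open>b_field\<close>, and so do the minus signs.\<close>

lemma loewner_vf_eq:
  assumes v: "\<bar>X (v s)\<bar> \<le> \<eta>" and w: "w \<in> UHP"
  shows "loewner_vf (b_field \<phi> bm1 b0 b1) h v s (\<phi> w) = deriv \<phi> w * F (X (v s)) w"
proof -
  have inj: "inj_on \<phi> UHP" and im: "\<phi> ` UHP = D" using bij by (auto simp: bij_betw_def)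
  define \<psi> where "\<psi> = inv_into UHP \<phi>"
  note inv = inverse_conformal[folded \<psi>_def]
  note \<psi> = inv(1-3) and d0 = inv(4) and d\<phi> = inv(5) and d\<psi> = inv(6)
  define x where "x = X (v s)"
  have x: "\<bar>x\<bar> \<le> \<eta>" using v by (simp add: x_def)
  have vs: "v s = U x" using UX v unfolding driver_coordinates_def x_def by simp
  define L where "L = of_real (s1 * x) * w + of_real (1 + s0 * x)"
  have L0: "L \<noteq> 0" unfolding L_def by (rule B_denom_ne_0[OF x w])
  have P0: "complex_of_real (p x) \<noteq> 0" using p_ge[OF x] by simp
  have D: "\<phi> w \<in> D" using w im by blast
  have BU: "B x w \<in> UHP" by (rule B_UHP[OF x w])
  have "((\<lambda>z. \<phi> (B x (\<psi> z))) has_field_derivative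
      deriv \<phi> (B x w) * (of_real (p x) / L\<^sup>2 * (1 / deriv \<phi> w))) (at (\<phi> w))"
  proof -
    have 1: "(\<psi> has_field_derivative 1 / deriv \<phi> w) (at (\<phi> w))" using d\<psi>[OF D] \<psi>(1)[OF w] by simp
    have "(B x has_field_derivative of_real (p x) / L\<^sup>2) (at (\<psi> (\<phi> w)))"
      using B_has_field_derivative[OF x w] \<psi>(1)[OF w] by (simp add: L_def)
    from DERIV_chain2[OF this 1]
    have 2: "((\<lambda>z. B x (\<psi> z)) has_field_derivative of_real (p x) / L\<^sup>2 * (1 / deriv \<phi> w)) (at (\<phi> w))" .
    have "(\<phi> has_field_derivative deriv \<phi> (B x w)) (at (B x (\<psi> (\<phi> w))))"
      using d\<phi>[OF BU] \<psi>(1)[OF w] by simp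
    from DERIV_chain2[OF this 2] show ?thesis .
  qed
  hence "(h (v s) has_field_derivative deriv \<phi> (B x w) * (of_real (p x) / L\<^sup>2 * (1 / deriv \<phi> w))) (at (\<phi> w))"
  proof (rule has_field_derivative_transform_within_open[OF _ openD D])
    fix z assume z: "z \<in> D"
    show "\<phi> (B x (\<psi> z)) = h (v s) z"
      using flow_eq[OF x \<psi>(2)[OF z]] \<psi>(3)[OF z] by (simp add: vs)
  qed
  hence dh: "deriv (h (v s)) (\<phi> w) = deriv \<phi> (B x w) * (of_real (p x) / L\<^sup>2 * (1 / deriv \<phi> w))"
    by (rule DERIV_imp_deriv)
  define q where "q = 2 / B x w + of_real bm1 + of_real b0 * B x w + of_real b1 * (B x w)\<^sup>2"
  have hB: "h (v s) (\<phi> w) = \<phi> (B x w)" unfolding vs by (rule flow_eq[OF x w])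
  have gen: "a * q / (a * (P / l * (1 / d))) = d * (l / P * q)"
    if "a \<noteq> 0" "P \<noteq> 0" "l \<noteq> 0" "d \<noteq> 0" for a P l d q :: complex
    using that by (simp add: field_simps)
  have "loewner_vf (b_field \<phi> bm1 b0 b1) h v s (\<phi> w)
      = deriv \<phi> (B x w) * q / (deriv \<phi> (B x w) * (of_real (p x) / L\<^sup>2 * (1 / deriv \<phi> w)))"
    unfolding loewner_vf_def dh hB b_field_conformal[OF inj BU] q_def by simp
  also have "\<dots> = deriv \<phi> w * (L\<^sup>2 / of_real (p x) * q)"
    by (rule gen) (use d0[OF BU] d0[OF w] L0 P0 in simp_all)
  also have "L\<^sup>2 / of_real (p x) * q = F x w"
    unfolding F_eq_pullback[OF x w] L_def q_def ..
  finally show ?thesis by (simp add: x_def)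
qed

lemma loewner_preimage_eq:
  assumes v: "\<And>s. s \<in> {0..t} \<Longrightarrow> \<bar>X (v s)\<bar> \<le> \<eta>"
  shows "loewner_preimage D (b_field \<phi> bm1 b0 b1) h v t = \<phi> ` chain_domain UHP (\<lambda>s. F (X (v s))) t"
proof -
  have im: "\<phi> ` UHP = D" using bij by (auto simp: bij_betw_def)
  define \<psi> where "\<psi> = inv_into UHP \<phi>"
  note inv = inverse_conformal[folded \<psi>_def]
  note \<psi> = inv(1-3) and d0 = inv(4) and d\<phi> = inv(5) and d\<psi> = inv(6)
  let ?V = "loewner_vf (b_field \<phi> bm1 b0 b1) h v"
  show ?thesis unfolding loewner_preimage_def
  proof (intro equalityI subsetI)
    fix z assume "z \<in> chain_domain D ?V t"
    then obtain \<gamma> where z: "z \<in> D" "0 \<le> t" and g: "\<gamma> 0 = z" "\<And>s. s \<in> {0..t} \<Longrightarrow> \<gamma> s \<in> D" "solves \<gamma> (\<lambda>s. ?V s (\<gamma> s)) t"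
      by (auto simp: chain_domain_def)
    have "solves (\<lambda>s. \<psi> (\<gamma> s)) (\<lambda>s. F (X (v s)) (\<psi> (\<gamma> s))) t"
    proof
      fix s assume s: "s \<in> {0..t}"
      define w where "w = \<psi> (\<gamma> s)"
      have w: "w \<in> UHP" "\<phi> w = \<gamma> s" using \<psi>(2,3) g(2)[OF s] by (auto simp: w_def)
      have "?V s (\<gamma> s) = deriv \<phi> w * F (X (v s)) w"
        using loewner_vf_eq[where v = v and s = s, OF v[OF s] w(1)] w(2) by simp
      hence "(\<gamma> has_vector_derivative deriv \<phi> w * F (X (v s)) w) (at s within {0..t})"
        using bspec[OF g(3) s] by simp
      from field_vector_diff_chain_within[OF this, of \<psi> "1 / deriv \<phi> w"] d\<psi>[OF g(2)[OF s]] d0[OF w(1)]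
      show "((\<lambda>s. \<psi> (\<gamma> s)) has_vector_derivative F (X (v s)) (\<psi> (\<gamma> s))) (at s within {0..t})"
        by (auto simp: o_def w_def[symmetric] intro: has_field_derivative_at_within)
    qed
    hence "\<psi> z \<in> chain_domain UHP (\<lambda>s. F (X (v s))) t"
      using z g \<psi>(2) unfolding chain_domain_def by (auto intro!: exI[of _ "\<lambda>s. \<psi> (\<gamma> s)"])
    thus "z \<in> \<phi> ` chain_domain UHP (\<lambda>s. F (X (v s))) t" using \<psi>(3)[OF z(1)] by force
  next
    fix z assume "z \<in> \<phi> ` chain_domain UHP (\<lambda>s. F (X (v s))) t"
    then obtain w \<gamma> where z: "z = \<phi> w" "w \<in> UHP" "0 \<le> t"
      and g: "\<gamma> 0 = w" "\<And>s. s \<in> {0..t} \<Longrightarrow> \<gamma> s \<in> UHP" "solves \<gamma> (\<lambda>s. F (X (v s)) (\<gamma> s)) t"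
      by (auto simp: chain_domain_def)
    have "solves (\<lambda>s. \<phi> (\<gamma> s)) (\<lambda>s. ?V s (\<phi> (\<gamma> s))) t"
    proof
      fix s assume s: "s \<in> {0..t}"
      from field_vector_diff_chain_within[OF bspec[OF g(3) s], of \<phi> "deriv \<phi> (\<gamma> s)"] d\<phi>[OF g(2)[OF s]]
      show "((\<lambda>s. \<phi> (\<gamma> s)) has_vector_derivative ?V s (\<phi> (\<gamma> s))) (at s within {0..t})"
        unfolding loewner_vf_eq[where v = v and s = s, OF v[OF s] g(2)[OF s]]
        by (auto simp: o_def mult.commute intro: has_field_derivative_at_within)
    qed
    thus "z \<in> chain_domain D ?V t"
      using z g im unfolding chain_domain_def by (auto intro!: exI[of _ "\<lambda>s. \<phi> (\<gamma> s)"])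
  qed
qed

lemma conv_loewner_preimage:
  assumes c: "conv \<Theta> \<kappa> x \<zeta> W" and x: "\<And>\<theta>. \<theta> \<in> {0..\<Theta>} \<Longrightarrow> X (v (\<kappa> \<theta>)) = x \<theta>"
  shows "loewner_preimage D (b_field \<phi> bm1 b0 b1) h v (\<kappa> \<Theta>) = \<phi> ` chain_domain UHP (chordal W) \<Theta>"
proof -
  have im: "\<kappa> ` {0..\<Theta>} = {0..\<kappa> \<Theta>}" using conv_inverse[OF c] by blast
  have "\<bar>X (v s)\<bar> \<le> \<eta>" if s: "s \<in> {0..\<kappa> \<Theta>}" for s
  proof -
    obtain \<theta> where "\<theta> \<in> {0..\<Theta>}" "s = \<kappa> \<theta>" using s im by blast
    thus ?thesis using x convD(8)[OF c] by simp
  qed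
  from loewner_preimage_eq[OF this] show ?thesis
    using conv_chain_domain[OF c, of "\<lambda>s. X (v s)"] x by simp
qed

end

end

section \<open>Reparameterization\<close>

lemma C1_on_continuous: "C1_on S f \<Longrightarrow> continuous_on S f"
  unfolding C1_on_def by (meson DERIV_continuous_on)

lemma C1_on_solves:
  assumes l: "solves l l' T" and c: "continuous_on {0..T} l'"
  shows "C1_on {0..<T} l"
  unfolding C1_on_def
proof (intro exI conjI ballI)
  show "continuous_on {0..<T} l'" by (rule continuous_on_subset[OF c]) auto
  fix t assume "t \<in> {0..<T}"
  hence "(l has_vector_derivative l' t) (at t within {0..T})" using l by auto
  hence "(l has_vector_derivative l' t) (at t within {0..<T})"
    by (rule has_vector_derivative_within_subset) auto
  thus "(l has_real_derivative l' t) (at t within {0..<T})"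
    by (simp add: has_real_derivative_iff_has_vector_derivative)
qed

lemma solves_derivative_unique_Ico:
  assumes l: "solves l l' T" and t: "t \<in> {0..<T}"
    and d: "(l has_real_derivative d) (at t within {0..<T})"
  shows "d = l' t"
proof -
  \<comment> \<open>The midpoint supplies a nondegenerate closed interval lying in both
    \<open>{0..T}\<close> and \<open>{0..<T}\<close>.\<close>
  define m where "m = (t + T) / 2"
  have m: "t < m" "m < T" using t by (auto simp: m_def)
  have "(l has_vector_derivative l' t) (at t within {0..T})" using l t by auto
  hence 1: "(l has_vector_derivative l' t) (at t within {t..m})"
    by (rule has_vector_derivative_within_subset) (use t m in auto)
  have 2: "(l has_vector_derivative d) (at t within {t..m})"
    using d unfolding has_real_derivative_iff_has_vector_derivative
    by (rule has_vector_derivative_within_subset) (use t m in auto)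
  show ?thesis
    using vector_derivative_unique_within_closed_interval[of t m t l d "l' t"] 1 2 m by simp
qed

text \<open>A driver whose chain coincides with a conjugated one, up to the time change \<open>l\<close>, is determined:
  its own conjugation to a chordal chain has the same capacity clock and the same chordal driver,
  and the backward equation is uniquely solvable.\<close>
lemma (in slit_coeffs) reparam_unique:
  fixes g v l :: "real \<Rightarrow> real"
  assumes openD: "open D" and hol: "\<phi> holomorphic_on UHP" and bij: "bij_betw \<phi> UHP D"
    and flow: "is_flow D (sigma_field \<phi> s0 s1) h" and UX: "driver_coordinates U X"
    and c: "conv \<Theta> \<kappa> x \<zeta> W" and T: "0 < \<Theta>"
    and strict: "\<And>\<theta>. \<theta> \<in> {0..\<Theta>} \<Longrightarrow> dist \<zeta>0 (\<zeta> \<theta>) < r \<and> \<bar>x \<theta>\<bar> < \<eta> \<and> \<bar>W \<theta>\<bar> \<le> r"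
    and l: "continuous_on {0..\<Theta>} l" "l 0 = 0" "\<And>\<theta>. \<theta> \<in> {0..\<Theta>} \<Longrightarrow> 0 \<le> l \<theta>"
    and v: "continuous_on {0..\<kappa> \<Theta>} v" "v 0 = 0"
    and dom: "\<And>\<theta>. \<theta> \<in> {0..\<Theta>} \<Longrightarrow>
      loewner_preimage D (b_field \<phi> bm1 b0 b1) h v (l \<theta>) = \<phi> ` chain_domain UHP (chordal W) \<theta>"
    and t: "\<theta> \<in> {0..\<Theta>}"
  shows "l \<theta> = \<kappa> \<theta>" "v (\<kappa> \<theta>) = U (x \<theta>)"
proof -
  have inj: "inj_on \<phi> UHP" using bij by (simp add: bij_betw_def)
  have U0: "U 0 = 0" and Xc: "continuous_on UNIV X" and XU: "\<And>v. \<bar>X v\<bar> \<le> \<eta> \<Longrightarrow> U (X v) = v"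
    using UX unfolding driver_coordinates_def by blast+
  have X0: "X 0 = 0" using UX \<eta>_bounds unfolding driver_coordinates_def
    by (metis U0 atLeastAtMost_iff less_imp_le neg_le_0_iff_le)
  have sm: "strict_mono_on {0..\<Theta>} \<kappa>" using conv_inverse[OF c] by blast
  define b where "b = \<kappa> \<Theta>"
  have b: "0 < b" using strict_mono_onD[OF sm, of 0 \<Theta>] T convD(2)[OF c] by (simp add: b_def)
  define y where "y = (\<lambda>s. X (v s))"
  have yc: "continuous_on {0..b} y"
    unfolding y_def b_def by (rule continuous_on_compose2[OF Xc v(1)]) auto
  have y0: "y 0 = 0" using v(2) X0 by (simp add: y_def)
  \<comment> \<open>The competitor is conjugated from its own driver in its own time. The exit
    \<open>e\<close> might come before \<open>b\<close>, and excluding this is the point of the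
    argument.\<close>
  obtain e \<zeta>' where e: "0 < e" "e \<le> b" and z: "\<zeta>' 0 = \<zeta>0" "solves \<zeta>' (\<lambda>s. RF (y s) (\<zeta>' s)) e"
    and reg: "\<And>s. s \<in> {0..e} \<Longrightarrow> \<zeta>' s \<in> Z \<and> \<bar>y s\<bar> \<le> \<eta>"
    and ex: "e = b \<or> \<bar>y e\<bar> = \<eta> \<or> dist \<zeta>0 (\<zeta>' e) = r"
    using forward_ode[OF b yc y0] by blast
  have yce: "continuous_on {0..e} y" by (rule continuous_on_subset[OF yc]) (use e in auto)
  obtain \<Theta>' \<kappa>' W' where T': "0 < \<Theta>'" and c': "conv \<Theta>' \<kappa>' (\<lambda>\<theta>. y (\<kappa>' \<theta>)) (\<lambda>\<theta>. \<zeta>' (\<kappa>' \<theta>)) W'" and ke: "\<kappa>' \<Theta>' = e"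
    using forward_conv[OF e(1) yce y0 z] reg by metis
  have im': "\<kappa>' ` {0..\<Theta>'} = {0..e}" using conv_inverse[OF c'] ke by metis
  have Nc: "continuous_on {0..\<Theta>} (\<lambda>\<theta>. l \<theta> / e)" using e by (intro continuous_intros l) auto
  have N0: "l 0 / e < 1" using l(2) by simp
  \<comment> \<open>\<open>\<theta>1\<close> is the first chordal time at which \<open>l\<close>
    reaches the end \<open>e\<close> of the conjugated part, or \<open>\<Theta>\<close> if it does
    not get there earlier.\<close>
  obtain \<theta>1 where t1: "0 < \<theta>1" "\<theta>1 \<le> \<Theta>" "\<forall>s\<in>{0..<\<theta>1}. l s / e < 1" "l \<theta>1 / e \<le> 1" "\<theta>1 = \<Theta> \<or> l \<theta>1 / e = 1"
    using first_exit[OF T Nc N0] by blast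
  have le: "l s \<le> e" if "s \<in> {0..\<theta>1}" for s
  proof (cases "s = \<theta>1")
    case False
    hence "l s / e < 1" using t1(3) that by auto
    thus ?thesis using e(1) by simp
  qed (use t1(4) e(1) in simp)
  \<comment> \<open>The time \<open>l s\<close> corresponds to some chordal time \<open>j\<close> of
    the competitor. Injectivity of \<open>\<phi>\<close> makes the chordal domains at
    \<open>s\<close> and \<open>j\<close> equal, and capacity forces \<open>j = s\<close>.\<close>
  have clock: "s \<le> \<Theta>' \<and> \<kappa>' s = l s \<and> chain_domain UHP (chordal W) s = chain_domain UHP (chordal W') s"
    if s: "s \<in> {0..\<theta>1}" for s
  proof -
    have sT: "s \<in> {0..\<Theta>}" using s t1(2) by auto
    have "l s \<in> \<kappa>' ` {0..\<Theta>'}" unfolding im' using l(3)[OF sT] le[OF s] by simp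
    then obtain j where j: "j \<in> {0..\<Theta>'}" "\<kappa>' j = l s" by force
    have cj: "conv j \<kappa>' (\<lambda>\<theta>. y (\<kappa>' \<theta>)) (\<lambda>\<theta>. \<zeta>' (\<kappa>' \<theta>)) W'" using conv_mono[OF c'] j(1) by auto
    have "loewner_preimage D (b_field \<phi> bm1 b0 b1) h v (\<kappa>' j) = \<phi> ` chain_domain UHP (chordal W') j"
      by (rule conv_loewner_preimage[OF openD hol bij flow UX cj]) (simp add: y_def)
    hence "\<phi> ` chain_domain UHP (chordal W') j = \<phi> ` chain_domain UHP (chordal W) s"
      using dom[OF sT] j(2) by simp
    hence eq: "chain_domain UHP (chordal W) s = chain_domain UHP (chordal W') j"
      using inj_on_image_eq_iff[OF inj, of "chain_domain UHP (chordal W') j" "chain_domain UHP (chordal W) s"]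
      by (auto simp: chain_domain_def)
    have Ws: "continuous_on {0..s} W" by (rule continuous_on_subset[OF conv_W_continuous[OF c]]) (use sT in auto)
    have W'j: "continuous_on {0..j} W'" by (rule conv_W_continuous[OF cj])
    have "s = j" using chordal_domain_unique(1)[OF _ Ws _ W'j eq] s j by simp
    thus ?thesis using j eq by simp
  qed
  have t1': "\<theta>1 \<le> \<Theta>'" using clock[of \<theta>1] t1(1) by simp
  have c1: "conv \<theta>1 \<kappa> x \<zeta> W" using conv_mono[OF c] t1 by simp
  have c1': "conv \<theta>1 \<kappa>' (\<lambda>\<theta>. y (\<kappa>' \<theta>)) (\<lambda>\<theta>. \<zeta>' (\<kappa>' \<theta>)) W'" using conv_mono[OF c'] t1 t1' by simp
  have WW: "W s = W' s" if "s \<in> {0..\<theta>1}" for s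
    using chordal_driver_unique[OF t1(1) conv_W_continuous[OF c1] conv_W_continuous[OF c1'] _ that] clock by blast
  have Wr: "\<bar>W s\<bar> \<le> r" if "s \<in> {0..\<theta>1}" for s using strict[of s] that t1(2) by auto
  have same: "\<zeta> s = \<zeta>' (\<kappa>' s)" "x s = y (\<kappa>' s)" "\<kappa> s = \<kappa>' s" if "s \<in> {0..\<theta>1}" for s
    using conv_unique[OF c1 c1' _ _ that] WW Wr by blast+
  \<comment> \<open>Stopping early would mean \<open>\<kappa> \<theta>1 = e < b\<close>, while the
    competitor's pole and Moebius map at \<open>e\<close> coincide with those of the constructed
    chain, which satisfy the strict bounds. This contradicts all three exit alternatives.\<close>
  have "\<theta>1 = \<Theta>"
  proof (rule ccontr)
    assume ne: "\<theta>1 \<noteq> \<Theta>"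
    have m: "\<theta>1 \<in> {0..\<theta>1}" "\<theta>1 \<in> {0..\<Theta>}" using t1 by auto
    have "l \<theta>1 = e" using t1(5) ne e(1) by simp
    hence ke1: "\<kappa>' \<theta>1 = e" using clock[OF m(1)] by simp
    have "\<kappa> \<theta>1 < \<kappa> \<Theta>" by (rule strict_mono_onD[OF sm]) (use t1 ne in auto)
    hence "e < b" using same(3)[OF m(1)] ke1 by (simp add: b_def)
    moreover have "\<bar>y e\<bar> < \<eta>" using same(2)[OF m(1)] ke1 strict[OF m(2)] by simp
    moreover have "dist \<zeta>0 (\<zeta>' e) < r" using same(1)[OF m(1)] ke1 strict[OF m(2)] by simp
    ultimately show False using ex by simp
  qed
  hence tt: "\<theta> \<in> {0..\<theta>1}" using t by simp
  show "l \<theta> = \<kappa> \<theta>" using clock[OF tt] same(3)[OF tt] by simp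
  have "X (v (\<kappa> \<theta>)) = x \<theta>" using same(2,3)[OF tt] by (simp add: y_def)
  thus "v (\<kappa> \<theta>) = U (x \<theta>)" using XU[of "v (\<kappa> \<theta>)"] strict[OF t] by simp
qed

theorem mainTheorem7:
  fixes D :: "complex set" and \<phi> :: "complex \<Rightarrow> complex"
    and bm1 b0 b1 s0 s1 tbm1 tb0 tb1 ts0 ts1 :: real
    and u :: "real \<Rightarrow> real"
    and h th :: "real \<Rightarrow> complex \<Rightarrow> complex"
  assumes "open D" and "connected D" and "simply_connected D" and "D \<noteq> UNIV"
    and "\<phi> holomorphic_on UHP" and "bij_betw \<phi> UHP D"
    and "is_flow D (sigma_field \<phi> s0 s1) h"
    and "is_flow D (sigma_field \<phi> ts0 ts1) th"
    and "continuous_on {0..} u" and "u 0 = 0"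
  shows "\<exists>Tmax>0. \<exists>Tt. \<exists>lam ut.
    (let good = (\<lambda>l v. l 0 = 0 \<and> C1_on {0..<Tmax} l \<and> l ` {0..<Tmax} \<subseteq> {0..<Tt}
                   \<and> continuous_on {0..<Tt} v \<and> v 0 = 0
                   \<and> (\<forall>t\<in>{0..<Tmax}.
                        loewner_preimage D (b_field \<phi> tbm1 tb0 tb1) th v (l t)
                        = loewner_preimage D (b_field \<phi> bm1 b0 b1) h u t))
     in good lam ut
        \<and> (\<forall>lam' ut'. good lam' ut' \<longrightarrow>
              (\<forall>t\<in>{0..<Tmax}. lam' t = lam t) \<and> (\<forall>s\<in>{0..<Tt}. ut' s = ut s))
        \<and> (\<forall>t\<in>{0..<Tmax}. \<forall>d. (lam has_real_derivative d) (at t within {0..<Tmax}) \<longrightarrow> d > 0))"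
proof -
  interpret org: slit_coeffs bm1 b0 b1 s0 s1 .
  interpret til: slit_coeffs tbm1 tb0 tb1 ts0 ts1 .
  note A = assms(1,5,6)
  obtain U X where UX: "org.driver_coordinates U X" using org.driver_coordinates_exist by blast
  obtain tU tX where tUX: "til.driver_coordinates tU tX" using til.driver_coordinates_exist by blast
  have X: "continuous_on UNIV X" "X 0 = 0"
    using UX org.\<eta>_bounds unfolding org.driver_coordinates_def
    by (auto, metis atLeastAtMost_iff less_imp_le neg_le_0_iff_le)
  have tU: "tU 0 = 0" "\<And>x. \<bar>x\<bar> \<le> til.\<eta> \<Longrightarrow> tX (tU x) = x"
    using tUX unfolding til.driver_coordinates_def by (auto simp: abs_le_iff)
  have tUc: "continuous_on {-til.\<eta>..til.\<eta>} tU"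
    using tUX unfolding til.driver_coordinates_def by (intro continuous_on_vector_derivative) blast

  define xo where "xo = (\<lambda>s. X (u s))"
  have xoc: "continuous_on {0..1} xo"
    unfolding xo_def by (rule continuous_on_compose2[OF X(1) continuous_on_subset[OF assms(9)]]) auto
  have xo0: "xo 0 = 0" using assms(10) X by (simp add: xo_def)
  obtain e \<zeta>o where e: "0 < e" "e \<le> 1" "\<zeta>o 0 = org.\<zeta>0" "solves \<zeta>o (\<lambda>s. org.RF (xo s) (\<zeta>o s)) e"
    "\<And>s. s \<in> {0..e} \<Longrightarrow> \<zeta>o s \<in> org.Z \<and> \<bar>xo s\<bar> \<le> org.\<eta>"
    using org.forward_ode[OF zero_less_one xoc xo0] by blast
  have xoce: "continuous_on {0..e} xo" by (rule continuous_on_subset[OF xoc]) (use e in auto)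
  \<comment> \<open>\<open>W\<close> is the chordal driver of the given chain. Both remaining
    constructions refer to it: the new chain is built from it, and every competitor is shown to have
    it.\<close>
  obtain \<Theta>o \<kappa>o W where To: "0 < \<Theta>o" and co: "org.conv \<Theta>o \<kappa>o (\<lambda>\<theta>. xo (\<kappa>o \<theta>)) (\<lambda>\<theta>. \<zeta>o (\<kappa>o \<theta>)) W"
    using org.forward_conv[OF e(1) xoce xo0 e(3,4)] e(5) by metis
  have W0: "W 0 = 0"
    using org.convD(10)[OF co, of 0] To xo0 e(3) org.convD(2)[OF co] by (simp add: org.drv_def)
  obtain \<Theta> \<kappa> x \<zeta> where T: "0 < \<Theta>" "\<Theta> \<le> \<Theta>o" and c: "til.conv \<Theta> \<kappa> x \<zeta> W"
    and Wr: "\<And>\<theta>. \<theta> \<in> {0..\<Theta>} \<Longrightarrow> \<bar>W \<theta>\<bar> \<le> til.r"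
    and strict: "\<And>\<theta>. \<theta> \<in> {0..<\<Theta>} \<Longrightarrow> dist til.\<zeta>0 (\<zeta> \<theta>) < til.r \<and> \<bar>x \<theta>\<bar> < til.\<eta>"
    using til.backward_conv[OF To org.conv_W_continuous[OF co] W0] by blast
  have co: "org.conv \<Theta> \<kappa>o (\<lambda>\<theta>. xo (\<kappa>o \<theta>)) (\<lambda>\<theta>. \<zeta>o (\<kappa>o \<theta>)) W"
    by (rule org.conv_mono[OF co]) (use T in auto)
  \<comment> \<open>The same chordal interval measured on the two clocks.\<close>
  define Tmax Tt where "Tmax = \<kappa>o \<Theta>" and "Tt = \<kappa> \<Theta>"
  obtain \<iota>o where io: "\<forall>s\<in>{0..\<Theta>}. \<iota>o (\<kappa>o s) = s" "\<kappa>o ` {0..\<Theta>} = {0..Tmax}" "\<iota>o ` {0..Tmax} = {0..\<Theta>}"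
     "solves \<iota>o (\<lambda>s. org.speed (xo (\<kappa>o (\<iota>o s))) (\<zeta>o (\<kappa>o (\<iota>o s))) / 2) Tmax" "\<forall>s\<in>{0..Tmax}. \<kappa>o (\<iota>o s) = s"
     "strict_mono_on {0..\<Theta>} \<kappa>o"
    using org.conv_inverse[OF co] unfolding Tmax_def by metis
  obtain \<iota> where it: "\<forall>s\<in>{0..\<Theta>}. \<iota> (\<kappa> s) = s" "\<kappa> ` {0..\<Theta>} = {0..Tt}" "\<iota> ` {0..Tt} = {0..\<Theta>}"
     "solves \<iota> (\<lambda>s. til.speed (x (\<iota> s)) (\<zeta> (\<iota> s)) / 2) Tt" "\<forall>s\<in>{0..Tt}. \<kappa> (\<iota> s) = s"
     "strict_mono_on {0..\<Theta>} \<kappa>"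
    using til.conv_inverse[OF c] unfolding Tt_def by metis
  have ko0: "\<kappa>o 0 = 0" and k0: "\<kappa> 0 = 0" using org.convD(2)[OF co] til.convD(2)[OF c] by auto
  have pos: "0 < Tmax" "0 < Tt"
    using strict_mono_onD[OF io(6), of 0 \<Theta>] strict_mono_onD[OF it(6), of 0 \<Theta>] T ko0 k0
    by (auto simp: Tmax_def Tt_def)
  have io_lt: "\<exists>\<theta>\<in>{0..<\<Theta>}. t = \<kappa>o \<theta> \<and> \<iota>o t = \<theta>" if t: "t \<in> {0..<Tmax}" for t
  proof -
    have "t \<in> \<kappa>o ` {0..\<Theta>}" using t unfolding io(2) by simp
    then obtain \<theta> where "\<theta> \<in> {0..\<Theta>}" "t = \<kappa>o \<theta>" by blast
    thus ?thesis using t io(1) by (intro bexI[of _ \<theta>]) (auto simp: Tmax_def less_le)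
  qed
  have it_lt: "\<exists>\<theta>\<in>{0..<\<Theta>}. t = \<kappa> \<theta> \<and> \<iota> t = \<theta>" if t: "t \<in> {0..<Tt}" for t
  proof -
    have "t \<in> \<kappa> ` {0..\<Theta>}" using t unfolding it(2) by simp
    then obtain \<theta> where "\<theta> \<in> {0..\<Theta>}" "t = \<kappa> \<theta>" by blast
    thus ?thesis using t it(1) by (intro bexI[of _ \<theta>]) (auto simp: Tt_def less_le)
  qed
  have klt: "\<kappa> \<theta> \<in> {0..<Tt}" "\<kappa>o \<theta> \<in> {0..<Tmax}" if \<theta>: "\<theta> \<in> {0..<\<Theta>}" for \<theta>
  proof -
    have "\<kappa> \<theta> < Tt" "\<kappa>o \<theta> < Tmax" unfolding Tt_def Tmax_def
      using strict_mono_onD[OF io(6), of \<theta> \<Theta>] strict_mono_onD[OF it(6), of \<theta> \<Theta>] \<theta> T by auto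
    moreover have "\<kappa> \<theta> \<in> {0..Tt}" "\<kappa>o \<theta> \<in> {0..Tmax}"
      unfolding it(2)[symmetric] io(2)[symmetric] using \<theta> by auto
    ultimately show "\<kappa> \<theta> \<in> {0..<Tt}" "\<kappa>o \<theta> \<in> {0..<Tmax}" by auto
  qed

  \<comment> \<open>From the given time back to chordal time, then forward on the new clock.\<close>
  define lam where "lam = (\<lambda>t. \<kappa> (\<iota>o t))"
  define ut where "ut = (\<lambda>s. tU (x (\<iota> s)))"
  \<comment> \<open>The derivative of \<open>lam\<close> is the quotient of the two speeds; this
    gives both its continuity and its sign.\<close>
  define l' where "l' = (\<lambda>t. (org.speed (xo (\<kappa>o (\<iota>o t))) (\<zeta>o (\<kappa>o (\<iota>o t))) / 2)
      * (2 / til.speed (x (\<iota>o t)) (\<zeta> (\<iota>o t))))"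
  have lam': "solves lam l' Tmax"
    using solves_compose[OF io(4) _ til.convD(7)[OF c]] io(3) unfolding lam_def l'_def by simp
  have iT: "\<iota>o t \<in> {0..\<Theta>}" if "t \<in> {0..Tmax}" for t using io(3) that by blast
  have so: "0 < org.speed (xo (\<kappa>o \<theta>)) (\<zeta>o (\<kappa>o \<theta>))" and st: "0 < til.speed (x \<theta>) (\<zeta> \<theta>)" if "\<theta> \<in> {0..\<Theta>}" for \<theta>
    using org.region_bounds(3)[OF org.convD(8,9)[OF co that]] til.region_bounds(3)[OF til.convD(8,9)[OF c that]] by auto
  have l'pos: "0 < l' t" if "t \<in> {0..Tmax}" for t
    unfolding l'_def using so[OF iT[OF that]] st[OF iT[OF that]] by simp
  have l'c: "continuous_on {0..Tmax} l'"
  proof -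
    have "continuous_on {0..\<Theta>} (\<lambda>\<theta>. org.speed (xo (\<kappa>o \<theta>)) (\<zeta>o (\<kappa>o \<theta>)))"
      by (rule org.RF_continuous(2)[OF org.convD(5)[OF co] solves_continuous[OF org.convD(6)[OF co]] org.convD(8,9)[OF co]])
    moreover have "continuous_on {0..\<Theta>} (\<lambda>\<theta>. til.speed (x \<theta>) (\<zeta> \<theta>))"
      by (rule til.RF_continuous(2)[OF til.convD(5)[OF c] solves_continuous[OF til.convD(6)[OF c]] til.convD(8,9)[OF c]])
    ultimately have "continuous_on {0..\<Theta>} (\<lambda>\<theta>. (org.speed (xo (\<kappa>o \<theta>)) (\<zeta>o (\<kappa>o \<theta>)) / 2) * (2 / til.speed (x \<theta>) (\<zeta> \<theta>)))"
      using st by (intro continuous_intros) (auto simp: less_imp_neq[THEN not_sym])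
    from continuous_on_compose2[OF this solves_continuous[OF io(4)]] show ?thesis
      unfolding l'_def using io(3) by simp
  qed
  have dom_o: "loewner_preimage D (b_field \<phi> bm1 b0 b1) h u (\<kappa>o \<theta>) = \<phi> ` chain_domain UHP (chordal W) \<theta>"
    if "\<theta> \<in> {0..\<Theta>}" for \<theta>
    using that by (intro org.conv_loewner_preimage[OF A assms(7) UX org.conv_mono[OF co]]) (auto simp: xo_def)
  have ut_x: "tX (ut (\<kappa> \<theta>)) = x \<theta>" if "\<theta> \<in> {0..\<Theta>}" for \<theta>
    using that it(1) tU(2)[OF til.convD(8)[OF c that]] by (simp add: ut_def)
  have dom_t: "loewner_preimage D (b_field \<phi> tbm1 tb0 tb1) th ut (\<kappa> \<theta>) = \<phi> ` chain_domain UHP (chordal W) \<theta>"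
    if "\<theta> \<in> {0..\<Theta>}" for \<theta>
    using that ut_x by (intro til.conv_loewner_preimage[OF A assms(8) tUX til.conv_mono[OF c]]) auto

  define good where "good = (\<lambda>l v. l 0 = 0 \<and> C1_on {0..<Tmax} l \<and> l ` {0..<Tmax} \<subseteq> {0..<Tt}
                   \<and> continuous_on {0..<Tt} v \<and> v 0 = 0
                   \<and> (\<forall>t\<in>{0..<Tmax}.
                        loewner_preimage D (b_field \<phi> tbm1 tb0 tb1) th v (l t)
                        = loewner_preimage D (b_field \<phi> bm1 b0 b1) h u t))"
  have "good lam ut"
    unfolding good_def
  proof (intro conjI ballI)
    have "\<iota>o 0 = 0" "\<iota> 0 = 0"
      using bspec[OF io(1), of 0] bspec[OF it(1), of 0] ko0 k0 T by simp_all
    thus "lam 0 = 0" "ut 0 = 0" using k0 til.convD(4)[OF c] tU(1) by (simp_all add: lam_def ut_def)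
    show "C1_on {0..<Tmax} lam" by (rule C1_on_solves[OF lam' l'c])
    show "lam ` {0..<Tmax} \<subseteq> {0..<Tt}"
    proof (rule image_subsetI)
      fix t assume "t \<in> {0..<Tmax}"
      then obtain \<theta> where "\<theta> \<in> {0..<\<Theta>}" "\<iota>o t = \<theta>" using io_lt by blast
      thus "lam t \<in> {0..<Tt}" using klt(1) by (simp add: lam_def)
    qed
    have "continuous_on {0..Tt} ut"
      unfolding ut_def
    proof (rule continuous_on_compose2[OF tUc])
      show "continuous_on {0..Tt} (\<lambda>s. x (\<iota> s))"
        by (rule continuous_on_compose2[OF til.convD(5)[OF c] solves_continuous[OF it(4)]]) (simp add: it(3))
      show "(\<lambda>s. x (\<iota> s)) ` {0..Tt} \<subseteq> {- til.\<eta>..til.\<eta>}"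
      proof (rule image_subsetI)
        fix s assume "s \<in> {0..Tt}"
        hence "\<iota> s \<in> {0..\<Theta>}" using it(3) by blast
        from til.convD(8)[OF c this] show "x (\<iota> s) \<in> {- til.\<eta>..til.\<eta>}" by auto
      qed
    qed
    thus "continuous_on {0..<Tt} ut" by (rule continuous_on_subset) auto
    fix t assume "t \<in> {0..<Tmax}"
    then obtain \<theta> where "\<theta> \<in> {0..<\<Theta>}" "t = \<kappa>o \<theta>" "\<iota>o t = \<theta>" using io_lt by blast
    thus "loewner_preimage D (b_field \<phi> tbm1 tb0 tb1) th ut (lam t) = loewner_preimage D (b_field \<phi> bm1 b0 b1) h u t"
      using dom_o[of \<theta>] dom_t[of \<theta>] by (simp add: lam_def)
  qed
  moreover have "(\<forall>t\<in>{0..<Tmax}. la t = lam t) \<and> (\<forall>s\<in>{0..<Tt}. ua s = ut s)" if g: "good la ua" for la ua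
  proof -
    have key: "la (\<kappa>o \<theta>) = \<kappa> \<theta>" "ua (\<kappa> \<theta>) = tU (x \<theta>)" if \<theta>: "\<theta> \<in> {0..<\<Theta>}" for \<theta>
    proof -
      \<comment> \<open>The strict bounds are known only before \<open>\<Theta>\<close>, and a
        competitor is constrained only before \<open>Tmax\<close> and \<open>Tt\<close>. Uniqueness
        is therefore applied on a shorter closed interval that contains
        \<open>\<theta>\<close>.\<close>
      define \<theta>2 where "\<theta>2 = (\<theta> + \<Theta>) / 2"
      have t2: "0 < \<theta>2" "\<theta>2 < \<Theta>" "\<theta> \<in> {0..\<theta>2}" using \<theta> T by (auto simp: \<theta>2_def)
      have sub: "\<theta>' \<in> {0..<\<Theta>}" if "\<theta>' \<in> {0..\<theta>2}" for \<theta>' using that t2 by auto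
      have c2: "til.conv \<theta>2 \<kappa> x \<zeta> W" by (rule til.conv_mono[OF c]) (use t2 in auto)
      have s2: "dist til.\<zeta>0 (\<zeta> \<theta>') < til.r \<and> \<bar>x \<theta>'\<bar> < til.\<eta> \<and> \<bar>W \<theta>'\<bar> \<le> til.r" if "\<theta>' \<in> {0..\<theta>2}" for \<theta>'
        using strict[OF sub[OF that]] Wr[of \<theta>'] sub[OF that] by simp
      have lac: "continuous_on {0..<Tmax} la" and la0: "la 0 = 0" and lim: "la ` {0..<Tmax} \<subseteq> {0..<Tt}"
        and uac: "continuous_on {0..<Tt} ua" and ua0: "ua 0 = 0"
        and dom: "\<And>t. t \<in> {0..<Tmax} \<Longrightarrow> loewner_preimage D (b_field \<phi> tbm1 tb0 tb1) th ua (la t)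
            = loewner_preimage D (b_field \<phi> bm1 b0 b1) h u t"
        using g C1_on_continuous unfolding good_def by blast+
      have koc: "continuous_on {0..\<theta>2} \<kappa>o"
        by (rule continuous_on_subset[OF solves_continuous[OF org.convD(7)[OF co]]]) (use t2 in auto)
      have 1: "continuous_on {0..\<theta>2} (\<lambda>\<theta>. la (\<kappa>o \<theta>))"
        by (rule continuous_on_compose2[OF lac koc]) (use klt(2)[OF sub] in blast)
      have 2: "la (\<kappa>o 0) = 0" using la0 ko0 by simp
      have 3: "0 \<le> la (\<kappa>o \<theta>')" if "\<theta>' \<in> {0..\<theta>2}" for \<theta>' 
        using subsetD[OF lim imageI[OF klt(2)[OF sub[OF that]]]] by simp
      have 4: "continuous_on {0..\<kappa> \<theta>2} ua"
        by (rule continuous_on_subset[OF uac]) (use klt(1)[of \<theta>2] t2 in auto)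
      have 5: "loewner_preimage D (b_field \<phi> tbm1 tb0 tb1) th ua (la (\<kappa>o \<theta>')) = \<phi> ` chain_domain UHP (chordal W) \<theta>'"
        if "\<theta>' \<in> {0..\<theta>2}" for \<theta>'
        using dom[OF klt(2)[OF sub[OF that]]] dom_o[of \<theta>'] sub[OF that] by simp
      show "la (\<kappa>o \<theta>) = \<kappa> \<theta>" "ua (\<kappa> \<theta>) = tU (x \<theta>)"
        using til.reparam_unique[OF A assms(8) tUX c2 t2(1) s2 1 2 3 4 ua0 5 t2(3)] by blast+
    qed
    show ?thesis
    proof (intro conjI ballI)
      fix t assume "t \<in> {0..<Tmax}"
      then obtain \<theta> where "\<theta> \<in> {0..<\<Theta>}" "t = \<kappa>o \<theta>" "\<iota>o t = \<theta>" using io_lt by blast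
      thus "la t = lam t" using key(1) by (simp add: lam_def)
    next
      fix s assume "s \<in> {0..<Tt}"
      then obtain \<theta> where "\<theta> \<in> {0..<\<Theta>}" "s = \<kappa> \<theta>" "\<iota> s = \<theta>" using it_lt by blast
      thus "ua s = ut s" using key(2) by (simp add: ut_def)
    qed
  qed
  moreover have "d > 0" if "t \<in> {0..<Tmax}" "(lam has_real_derivative d) (at t within {0..<Tmax})" for t d
    using solves_derivative_unique_Ico[OF lam' that] l'pos[of t] that(1) by simp
  ultimately have "good lam ut
        \<and> (\<forall>lam' ut'. good lam' ut' \<longrightarrow>
              (\<forall>t\<in>{0..<Tmax}. lam' t = lam t) \<and> (\<forall>s\<in>{0..<Tt}. ut' s = ut s))
        \<and> (\<forall>t\<in>{0..<Tmax}. \<forall>d. (lam has_real_derivative d) (at t within {0..<Tmax}) \<longrightarrow> d > 0)"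
    by blast
  note final = this[unfolded good_def]
  show ?thesis
    unfolding Let_def
    by (rule exI[of _ Tmax], rule conjI[OF pos(1)], rule exI[of _ Tt], rule exI[of _ lam], rule exI[of _ ut], rule final)
qed

end
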